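(* Let $\mathfrak{A}$ be a $(k,p,q)$-differential subalgebra of some $C^*$-algebra, let $\mathfrak{E}$ be a unital Banach algebra and let $\varphi:\widetilde{\mathfrak{A}}\to\mathfrak{E}$ be a continuous unital homomorphism. Set $I=\ker\varphi$. Then: (i) if $a\in\widetilde{\mathfrak{A}}$ is normal, ${\rm Spec}_{\widetilde{\mathfrak{A}}/I}(a+I)={\rm Spec}_{\mathfrak{E}}(\varphi(a))$; (ii) for a general $a\in\widetilde{\mathfrak{A}}$, ${\rm Spec}_{\widetilde{\mathfrak{A}}/I}(a+I)={\rm Spec}_{\mathfrak{E}}(\varphi(a))\cup\overline{{\rm Spec}_{\mathfrak{E}}(\varphi(a^* ))}$, where the bar denotes complex conjugation of the set.
   Context: A $(k,p,q)$-differential subalgebra of a $C^*$-algebra $\mathfrak{B}$ (with norm $\|\cdot\|_{\mathfrak{B}}$) is a $*$-subalgebra $\mathfrak{A}\subseteq\mathfrak{B}$ equipped with its own norm $\|\cdot\|_{\mathfrak{A}}$ making it a Banach $*$-algebra on which the involution is continuous, where $k\in\mathbb{Z}$, $k\geq 2$, and $p,q>0$ are reals with $p+q=k$, such that for some constant $C>0$, $\|a^k\|_{\mathfrak{A}}\leq C\|a\|_{\mathfrak{A}}^p\|a\|_{\mathfrak{B}}^q$ for all $a\in\mathfrak{A}$. $\widetilde{\mathfrak{A}}$ denotes the minimal unitization of $\mathfrak{A}$ ($\widetilde{\mathfrak{A}}=\mathfrak{A}$ if $\mathfrak{A}$ is unital). Spectra are taken in the indicated unital Banach algebras. *)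

theory Defs
  imports "HOL-Analysis.Analysis"
begin

class cscale =
  fixes cscale :: "complex \<Rightarrow> 'a \<Rightarrow> 'a"  (infixr "*\<^sub>C" 75)

class complex_normed_algebra = real_normed_algebra + cscale +
  assumes cscale_add_right: "c *\<^sub>C (x + y) = c *\<^sub>C x + c *\<^sub>C y"
    and cscale_add_left: "(c + d) *\<^sub>C x = c *\<^sub>C x + d *\<^sub>C x"
    and cscale_cscale: "c *\<^sub>C (d *\<^sub>C x) = (c * d) *\<^sub>C x"
    and cscale_one: "1 *\<^sub>C x = x"
    and cscale_of_real: "complex_of_real r *\<^sub>C x = r *\<^sub>R x"
    and norm_cscale: "norm (c *\<^sub>C x) = cmod c * norm x"
    and mult_cscale_left: "(c *\<^sub>C x) * y = c *\<^sub>C (x * y)"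
    and mult_cscale_right: "x * (c *\<^sub>C y) = c *\<^sub>C (x * y)"

class complex_banach_algebra_1 = complex_normed_algebra + real_normed_algebra_1 + banach

class cstar_algebra = complex_normed_algebra + banach +
  fixes star :: "'a \<Rightarrow> 'a"
  assumes star_star: "star (star x) = x"
    and star_add: "star (x + y) = star x + star y"
    and star_mult: "star (x * y) = star y * star x"
    and star_cscale: "star (c *\<^sub>C x) = cnj c *\<^sub>C star x"
    and cstar_identity: "norm (star x * x) = (norm x)\<^sup>2"

text \<open>Positive powers in a possibly non-unital algebra: \<open>ppow x n = x^n\<close> for \<open>n \<ge> 1\<close>.\<close>
fun ppow :: "'a::{times,zero} \<Rightarrow> nat \<Rightarrow> 'a" where
  "ppow x 0 = 0"
| "ppow x (Suc 0) = x"
| "ppow x (Suc (Suc n)) = x * ppow x (Suc n)"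

definition star_subalgebra :: "'b::cstar_algebra set \<Rightarrow> bool" where
  "star_subalgebra A \<longleftrightarrow> 0 \<in> A \<and>
     (\<forall>x\<in>A. \<forall>y\<in>A. x + y \<in> A \<and> x * y \<in> A) \<and>
     (\<forall>c. \<forall>x\<in>A. c *\<^sub>C x \<in> A) \<and>
     (\<forall>x\<in>A. star x \<in> A)"

definition banach_star_subalgebra :: "'b::cstar_algebra set \<Rightarrow> ('b \<Rightarrow> real) \<Rightarrow> bool" where
  "banach_star_subalgebra A nA \<longleftrightarrow>
     star_subalgebra A \<and>
     (\<forall>x\<in>A. nA x \<ge> 0 \<and> (nA x = 0 \<longleftrightarrow> x = 0)) \<and>
     (\<forall>x\<in>A. \<forall>y\<in>A. nA (x + y) \<le> nA x + nA y) \<and>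
     (\<forall>c. \<forall>x\<in>A. nA (c *\<^sub>C x) = cmod c * nA x) \<and>
     (\<forall>x\<in>A. \<forall>y\<in>A. nA (x * y) \<le> nA x * nA y) \<and>
     (\<forall>X::nat \<Rightarrow> 'b. (\<forall>n. X n \<in> A) \<longrightarrow>
          (\<forall>e>0. \<exists>N. \<forall>m\<ge>N. \<forall>n\<ge>N. nA (X m - X n) < e) \<longrightarrow>
          (\<exists>L\<in>A. \<forall>e>0. \<exists>N. \<forall>n\<ge>N. nA (X n - L) < e)) \<and>
     (\<forall>x\<in>A. \<forall>e>0. \<exists>d>0. \<forall>y\<in>A. nA (y - x) < d \<longrightarrow> nA (star y - star x) < e)"

definition differential_subalgebra ::
  "nat \<Rightarrow> real \<Rightarrow> real \<Rightarrow> 'b::cstar_algebra set \<Rightarrow> ('b \<Rightarrow> real) \<Rightarrow> bool" where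
  "differential_subalgebra k p q A nA \<longleftrightarrow>
     k \<ge> 2 \<and> p > 0 \<and> q > 0 \<and> p + q = real k \<and>
     banach_star_subalgebra A nA \<and>
     (\<exists>C>0. \<forall>a\<in>A. nA (ppow a k) \<le> C * nA a powr p * norm a powr q)"

definition has_unit :: "'b::cstar_algebra set \<Rightarrow> bool" where
  "has_unit A \<longleftrightarrow> (\<exists>e\<in>A. \<forall>x\<in>A. e * x = x \<and> x * e = x)"

definition unit_of :: "'b::cstar_algebra set \<Rightarrow> 'b" where
  "unit_of A = (SOME e. e \<in> A \<and> (\<forall>x\<in>A. e * x = x \<and> x * e = x))"

text \<open>Elements of the minimal unitization are represented as pairs \<open>(a, \<lambda>)\<close> standing
  for \<open>a + \<lambda>1\<close>. If \<open>A\<close> is unital, the unitization is \<open>A\<close> itself, represented by pairs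
  \<open>(a, 0)\<close>; the operations below restrict correctly to that case.\<close>
definition unitz :: "'b::cstar_algebra set \<Rightarrow> ('b \<times> complex) set" where
  "unitz A = (if has_unit A then {(a, 0) | a. a \<in> A} else A \<times> UNIV)"

definition uadd :: "'b::cstar_algebra \<times> complex \<Rightarrow> 'b \<times> complex \<Rightarrow> 'b \<times> complex" where
  "uadd x y = (fst x + fst y, snd x + snd y)"

definition usub :: "'b::cstar_algebra \<times> complex \<Rightarrow> 'b \<times> complex \<Rightarrow> 'b \<times> complex" where
  "usub x y = (fst x - fst y, snd x - snd y)"

definition uscale :: "complex \<Rightarrow> 'b::cstar_algebra \<times> complex \<Rightarrow> 'b \<times> complex" where
  "uscale c x = (c *\<^sub>C fst x, c * snd x)"

definition umult :: "'b::cstar_algebra \<times> complex \<Rightarrow> 'b \<times> complex \<Rightarrow> 'b \<times> complex" where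
  "umult x y = (fst x * fst y + snd x *\<^sub>C fst y + snd y *\<^sub>C fst x, snd x * snd y)"

definition ustar :: "'b::cstar_algebra \<times> complex \<Rightarrow> 'b \<times> complex" where
  "ustar x = (star (fst x), cnj (snd x))"

definition uone :: "'b::cstar_algebra set \<Rightarrow> 'b \<times> complex" where
  "uone A = (if has_unit A then (unit_of A, 0) else (0, 1))"

definition unorm :: "('b::cstar_algebra \<Rightarrow> real) \<Rightarrow> 'b \<times> complex \<Rightarrow> real" where
  "unorm nA x = nA (fst x) + cmod (snd x)"

definition cont_unital_hom ::
  "'b::cstar_algebra set \<Rightarrow> ('b \<Rightarrow> real) \<Rightarrow> ('b \<times> complex \<Rightarrow> 'e::complex_banach_algebra_1) \<Rightarrow> bool" where
  "cont_unital_hom A nA \<phi> \<longleftrightarrow>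
     (\<forall>x\<in>unitz A. \<forall>y\<in>unitz A. \<phi> (uadd x y) = \<phi> x + \<phi> y \<and> \<phi> (umult x y) = \<phi> x * \<phi> y) \<and>
     (\<forall>c. \<forall>x\<in>unitz A. \<phi> (uscale c x) = c *\<^sub>C \<phi> x) \<and>
     \<phi> (uone A) = 1 \<and>
     (\<forall>x\<in>unitz A. \<forall>e>0. \<exists>d>0. \<forall>y\<in>unitz A.
        unorm nA (usub y x) < d \<longrightarrow> norm (\<phi> y - \<phi> x) < e)"

definition spec :: "'e::complex_banach_algebra_1 \<Rightarrow> complex set" where
  "spec x = {c. \<not> (\<exists>y. (x - c *\<^sub>C 1) * y = 1 \<and> y * (x - c *\<^sub>C 1) = 1)}"

text \<open>Spectrum of the coset \<open>a + I\<close> in the quotient algebra \<open>unitz A / I\<close> (unit \<open>uone A + I\<close>).\<close>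
definition spec_quot :: "'b::cstar_algebra set \<Rightarrow> ('b \<times> complex) set \<Rightarrow> 'b \<times> complex \<Rightarrow> complex set" where
  "spec_quot A I a = {c. \<not> (\<exists>b\<in>unitz A.
      usub (umult (usub a (uscale c (uone A))) b) (uone A) \<in> I \<and>
      usub (umult b (usub a (uscale c (uone A)))) (uone A) \<in> I)}"

end

theory Submission
  imports Defs
begin

text \<open>
  In the unitization \<open>R\<close> of \<open>A\<close> the differential inequality bounds the growth of the powers of any
  element of norm at most 1 in the \<open>C\<^sup>*\<close>-algebra by \<open>exp (K n\<^sup>\<gamma>)\<close> with \<open>\<gamma> < 1\<close>. Hence \<open>1 - y\<close> is
  invertible in \<open>R\<close> as soon as the \<open>C\<^sup>*\<close>-norm of \<open>y\<close> is less than 1, selfadjoint elements have real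
  spectrum, and the Cayley transform \<open>u\<close> of a selfadjoint element has powers \<open>u\<^sup>n\<close>, \<open>n \<in> \<int>\<close>, of
  non-quasianalytic growth. Absolutely convergent series in \<open>u\<close> therefore contain partitions of
  unity with arbitrarily small supports. Let \<open>a\<close> be normal with \<open>\<phi> a\<close> invertible, and decompose 1 with
  respect to the real and imaginary parts of \<open>a\<close>: a piece \<open>z\<close> located near 0 satisfies
  \<open>\<phi> z = (\<phi> a)\<^sup>-\<^sup>n \<phi> (a\<^sup>n z) \<rightarrow> 0\<close>, and every other piece is a multiple of \<open>a\<close>, so that
  \<open>1 \<in> ker \<phi> + a R\<close>. For general \<open>a\<close> this is applied to \<open>a\<^sup>* a\<close>; that \<open>\<phi> (a\<^sup>*)\<close> is invertible when
  \<open>a + ker \<phi>\<close> is follows from the density of \<open>ker \<phi>\<close> in a selfadjoint ideal.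
\<close>

section \<open>Band-limited sequences\<close>

text \<open>The location of an element is never read off a spectrum. That \<open>z\<close> sits
  within \<open>r\<close> of the value \<theta> of \<open>a\<close> is encoded by estimates \<nu>((a
  - \<theta>)^n z) \<le> M r^n for all n, with \<open>M\<close> independent of n. For commuting
  elements such radii add, the estimates pass through any bounded homomorphism, and they make
  geometric series applied to \<open>z\<close> converge although \<open>a - \<theta>\<close> alone
  satisfies no such bound.

  The growth exponent comes from comparing the logarithms of \<nu>(x^(kn)) and \<nu>(x^n): the
  differential inequality multiplies them by about \<open>p\<close>, and p < k^\<gamma> turns this
  into growth n^\<gamma> with \<gamma> < 1. Then the sum of |n|^\<gamma> / n^2 converges, which
  leaves room for functions on the circle with small support and matching coefficient decay; an
  infinite convolution of boxes is an explicit one.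

  The obstacle in the general case is that the target carries no involution and the kernel need not
  be selfadjoint. Invertibility of the image of \<open>a\<close> in the target thus says nothing
  about the image of its adjoint, whence the second set in (ii).\<close>

definition backward_difference :: "nat \<Rightarrow> (int \<Rightarrow> real) \<Rightarrow> int \<Rightarrow> real" where
  "backward_difference n c m = (\<Sum>i\<le>n. (-1) ^ (n - i) * real (n choose i) * c (m - int i))"

definition sinc :: "real \<Rightarrow> real" where
  "sinc x = (if x = 0 then 1 else sin x / x)"

lemma sinc_0 [simp]: "sinc 0 = 1"
  by (simp add: sinc_def)

lemma abs_sinc_le_1: "\<bar>sinc x\<bar> \<le> 1"
  by (simp add: sinc_def divide_le_eq_1 abs_sin_x_le_abs_x)

lemma abs_sinc_le_half: "2 \<le> \<bar>x\<bar> \<Longrightarrow> \<bar>sinc x\<bar> \<le> 1 / 2"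
proof -
  assume x: "2 \<le> \<bar>x\<bar>"
  have "\<bar>sin x\<bar> / \<bar>x\<bar> \<le> 1 / 2"
    by (rule frac_le) (use x in auto)
  then show ?thesis using x by (auto simp: sinc_def)
qed

text \<open>Multiplication by \<open>sinc\<close> becomes an average of frequency shifts. The
  average is parametrised over a fixed interval, so that no division by \<open>x\<close> enters the
  statement.\<close>

lemma sinc_has_integral:
  "((\<lambda>t. cis (x * (2 * t - 1))) has_integral of_real (sinc x)) {0..1::real}"
proof (cases "x = 0")
  case True
  then show ?thesis
    using has_integral_const_real[of "1::complex" 0 1] by simp
next
  case False
  define G where "G = (\<lambda>t. cis (x * (2 * t - 1)) / (2 * \<i> * of_real x))"
  have "((\<lambda>t. cis (x * (2 * t - 1))) has_integral (G 1 - G 0)) {0..1::real}"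
  proof (rule fundamental_theorem_of_calculus)
    fix t :: real
    show "(G has_vector_derivative cis (x * (2 * t - 1))) (at t within {0..1})"
      unfolding G_def cis_conv_exp using False
      by (auto intro!: derivative_eq_intros has_vector_derivative_real_field
          simp: field_simps)
  qed auto
  moreover have "G 1 - G 0 = of_real (sinc x)"
    using False by (simp add: G_def sinc_def cis.ctr complex_eq_iff field_simps Re_divide Im_divide power2_eq_square)
  ultimately show ?thesis by simp
qed

text \<open>Membership in the closed absolutely convex hull of the exponentials with frequency at most
  \<open>\<delta>\<close>, expressed by duality.\<close>
definition band_limited :: "real \<Rightarrow> (int \<Rightarrow> real) \<Rightarrow> bool" where
  "band_limited \<delta> f \<longleftrightarrow> (\<forall>(n::nat) (\<mu>::nat \<Rightarrow> complex) (t::nat \<Rightarrow> int) B.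
     (\<forall>s. \<bar>s\<bar> \<le> \<delta> \<longrightarrow> cmod (\<Sum>i\<le>n. \<mu> i * cis (of_int (t i) * s)) \<le> B) \<longrightarrow>
     cmod (\<Sum>i\<le>n. \<mu> i * of_real (f (t i))) \<le> B)"

lemma band_limited_1: "0 \<le> \<delta> \<Longrightarrow> band_limited \<delta> (\<lambda>_. 1)"
  unfolding band_limited_def
proof (intro allI impI)
  fix n \<mu> t B
  assume "0 \<le> \<delta>" and "\<forall>s. \<bar>s\<bar> \<le> \<delta> \<longrightarrow> cmod (\<Sum>i\<le>(n::nat). \<mu> i * cis (of_int (t i) * s)) \<le> B"
  from this(2)[rule_format, of 0] this(1)
  show "cmod (\<Sum>i\<le>n. \<mu> i * of_real 1) \<le> B" by simp
qed

lemma band_limited_mono: "band_limited \<delta> f \<Longrightarrow> \<delta> \<le> \<delta>' \<Longrightarrow> band_limited \<delta>' f"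
  unfolding band_limited_def by (meson order_trans)

text \<open>The new factor averages frequency shifts by at most \<open>a\<close>. For each
  \<open>r\<close> the shift is absorbed into the weights \<open>\<mu> i\<close>, to which the
  hypothesis on \<open>f\<close> applies; integration over \<open>r\<close> keeps the bound.\<close>

lemma band_limited_mult_sinc:
  assumes f: "band_limited \<delta> f" and a: "0 \<le> a"
  shows "band_limited (\<delta> + a) (\<lambda>m. f m * sinc (a * of_int m))"
  unfolding band_limited_def
proof (intro allI impI)
  fix n and \<mu> :: "nat \<Rightarrow> complex" and t :: "nat \<Rightarrow> int" and B
  assume B: "\<forall>s. \<bar>s\<bar> \<le> \<delta> + a \<longrightarrow> cmod (\<Sum>i\<le>n. \<mu> i * cis (of_int (t i) * s)) \<le> B"
  define g where "g r = (\<Sum>i\<le>n. \<mu> i * of_real (f (t i)) * cis (a * of_int (t i) * (2 * r - 1)))" for r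
  have int: "(g has_integral (\<Sum>i\<le>n. \<mu> i * of_real (f (t i)) * of_real (sinc (a * of_int (t i))))) {0..1}"
    unfolding g_def by (intro has_integral_sum has_integral_mult_right sinc_has_integral) auto
  have bd: "cmod (g r) \<le> B" if "r \<in> {0..1}" for r
  proof -
    have abs: "\<bar>a * (2 * r - 1)\<bar> \<le> a"
      using that a by (auto simp: abs_mult intro!: mult_left_le)
    have "cmod (\<Sum>i\<le>n. (\<mu> i * cis (of_int (t i) * (a * (2 * r - 1)))) * of_real (f (t i))) \<le> B"
    proof (rule f[unfolded band_limited_def, rule_format])
      fix s assume "\<bar>s\<bar> \<le> \<delta>"
      then have "\<bar>s + a * (2 * r - 1)\<bar> \<le> \<delta> + a" using abs by linarith
      from B[rule_format, OF this]
      show "cmod (\<Sum>i\<le>n. \<mu> i * cis (of_int (t i) * (a * (2 * r - 1))) * cis (of_int (t i) * s)) \<le> B"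
        by (simp add: mult.assoc cis_mult distrib_left add.commute)
    qed
    then show ?thesis by (simp add: g_def mult_ac)
  qed
  have "0 \<le> B" by (rule order_trans[OF norm_ge_zero bd[of 0]]) simp
  from has_integral_bound[OF this int[unfolded box_real(2)[symmetric]]] bd
  show "cmod (\<Sum>i\<le>n. \<mu> i * of_real (f (t i) * sinc (a * of_int (t i)))) \<le> B"
    by (auto simp: mult.assoc)
qed

lemma band_limited_mult_sinc_power:
  assumes "band_limited \<delta> f" and "0 \<le> a"
  shows "band_limited (\<delta> + real j * a) (\<lambda>m. f m * sinc (a * of_int m) ^ j)"
proof (induction j)
  case (Suc j)
  from band_limited_mult_sinc[OF this assms(2)] show ?case
    by (simp add: algebra_simps)
qed (use assms in simp)

lemma band_limited_lim:
  assumes "\<And>j. band_limited \<delta> (f j)" and lim: "\<And>m. (\<lambda>j. f j m) \<longlonglongrightarrow> g m"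
  shows "band_limited \<delta> g"
  unfolding band_limited_def
proof (intro allI impI)
  fix n and \<mu> :: "nat \<Rightarrow> complex" and t :: "nat \<Rightarrow> int" and B
  assume B: "\<forall>s. \<bar>s\<bar> \<le> \<delta> \<longrightarrow> cmod (\<Sum>i\<le>n. \<mu> i * cis (of_int (t i) * s)) \<le> B"
  have "cmod (\<Sum>i\<le>n. \<mu> i * of_real (f j (t i))) \<le> B" for j
    using assms(1)[of j] B unfolding band_limited_def by blast
  moreover have "(\<lambda>j. cmod (\<Sum>i\<le>n. \<mu> i * of_real (f j (t i)))) \<longlonglongrightarrow> cmod (\<Sum>i\<le>n. \<mu> i * of_real (g (t i)))"
    by (intro tendsto_intros lim)
  ultimately show "cmod (\<Sum>i\<le>n. \<mu> i * of_real (g (t i))) \<le> B"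
    by (intro LIMSEQ_le_const2) auto
qed

lemma cmod_cis_minus_1_le: "cmod (cis s - 1) \<le> \<bar>s\<bar>"
proof -
  have "cmod (cis s - 1) = 2 * \<bar>sin (s / 2)\<bar>"
    using dist_exp_i_1[of s] by (simp add: cis_conv_exp)
  also have "\<dots> \<le> \<bar>s\<bar>" using abs_sin_x_le_abs_x[of "s / 2"] by simp
  finally show ?thesis .
qed

text \<open>A Bernstein inequality. On the exponential of frequency \<open>s\<close> the difference
  acts as multiplication by a number of modulus |cis(-s) - 1|^n \<le> |s|^n, and duality carries
  this bound to the whole hull.\<close>

lemma band_limited_backward_difference:
  assumes "band_limited \<delta> f"
  shows "\<bar>backward_difference n f m\<bar> \<le> \<delta> ^ n"
proof -
  have "cmod (\<Sum>i\<le>n. ((-1) ^ (n - i) * of_nat (n choose i)) * of_real (f (m - int i))) \<le> \<delta> ^ n"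
  proof (rule assms[unfolded band_limited_def, rule_format])
    fix s assume s: "\<bar>s\<bar> \<le> \<delta>"
    have "cis (of_int (m - int i) * s) = cis (of_int m * s) * cis (- s) ^ i" for i
      by (simp add: Complex.DeMoivre cis_mult algebra_simps)
    then have "(\<Sum>i\<le>n. ((-1) ^ (n - i) * of_nat (n choose i)) * cis (of_int (m - int i) * s))
        = cis (of_int m * s) * (\<Sum>i\<le>n. of_nat (n choose i) * cis (- s) ^ i * (-1) ^ (n - i))"
      by (simp add: sum_distrib_left mult_ac)
    also have "\<dots> = cis (of_int m * s) * (cis (- s) - 1) ^ n"
      using binomial_ring[of "cis (- s)" "-1" n] by simp
    finally show "cmod (\<Sum>i\<le>n. ((-1) ^ (n - i) * of_nat (n choose i)) * cis (of_int (m - int i) * s)) \<le> \<delta> ^ n"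
      using power_mono[OF order_trans[OF cmod_cis_minus_1_le[of "- s"]], of \<delta> n] s
      by (simp add: norm_mult norm_power)
  qed
  also have "(\<Sum>i\<le>n. ((-1) ^ (n - i) * of_nat (n choose i)) * of_real (f (m - int i)))
      = complex_of_real (backward_difference n f m)"
    by (simp add: backward_difference_def)
  finally show ?thesis by simp
qed

section \<open>A rapidly decaying band-limited sequence\<close>

lemma powr_add_le:
  fixes x y :: real
  assumes "0 \<le> x" "0 \<le> y" "0 < \<gamma>" "\<gamma> \<le> 1"
  shows "(x + y) powr \<gamma> \<le> x powr \<gamma> + y powr \<gamma>"
proof (cases "x + y = 0")
  case False
  then have s: "x + y > 0" using assms by auto
  have *: "t \<le> t powr \<gamma>" if "0 \<le> t" "t \<le> 1" for t :: real
    using powr_mono'[of \<gamma> 1 t] that assms by simp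
  have "1 = x / (x + y) + y / (x + y)" using s by (simp add: add_divide_distrib[symmetric])
  also have "\<dots> \<le> (x / (x + y)) powr \<gamma> + (y / (x + y)) powr \<gamma>"
    by (intro add_mono *) (use s assms in \<open>auto simp: divide_le_eq_1\<close>)
  also have "\<dots> = (x powr \<gamma> + y powr \<gamma>) / (x + y) powr \<gamma>"
    using assms by (simp add: powr_divide add_divide_distrib)
  finally show ?thesis using s by (simp add: pos_le_divide_eq)
qed (use assms in auto)

lemma sum_inverse_squares_int_le:
  fixes F :: "int set"
  assumes "finite F"
  shows "(\<Sum>m\<in>F. 1 / (1 + of_int m ^ 2)) \<le> 2 * (\<Sum>n. 1 / (1 + real n ^ 2))"
proof -
  have sm: "summable (\<lambda>n. 1 / (1 + real n ^ 2))"
  proof (rule summable_comparison_test'[of "\<lambda>n. inverse (real n ^ 2)" 1])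
    show "summable (\<lambda>n. inverse (real n ^ 2))" by (rule inverse_power_summable) simp
  qed (auto simp: divide_inverse intro!: le_imp_inverse_le)
  define h where "h m = 1 / (1 + (of_int m :: real) ^ 2)" for m :: int
  have pos: "h m \<ge> 0" for m by (simp add: h_def)
  have half: "sum h G \<le> (\<Sum>n. 1 / (1 + real n ^ 2))" if "finite G" "inj_on (\<lambda>m. nat \<bar>m\<bar>) G" for G
  proof -
    have "sum h G = (\<Sum>m\<in>G. 1 / (1 + real (nat \<bar>m\<bar>) ^ 2))"
      by (intro sum.cong) (auto simp: h_def)
    also have "\<dots> = (\<Sum>n\<in>(\<lambda>m. nat \<bar>m\<bar>) ` G. 1 / (1 + real n ^ 2))"
      using that by (simp add: sum.reindex)
    also have "\<dots> \<le> (\<Sum>n. 1 / (1 + real n ^ 2))"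
      by (rule sum_le_suminf[OF sm]) (use that in auto)
    finally show ?thesis .
  qed
  have "sum h F = sum h {m\<in>F. 0 \<le> m} + sum h {m\<in>F. m < 0}"
    using assms by (subst sum.union_disjoint[symmetric]) (auto intro!: sum.cong)
  also have "\<dots> \<le> 2 * (\<Sum>n. 1 / (1 + real n ^ 2))"
  proof -
    have "sum h {m\<in>F. 0 \<le> m} \<le> (\<Sum>n. 1 / (1 + real n ^ 2))"
      by (rule half) (use assms in \<open>auto simp: inj_on_def\<close>)
    moreover have "sum h {m\<in>F. m < 0} \<le> (\<Sum>n. 1 / (1 + real n ^ 2))"
      by (rule half) (use assms in \<open>auto simp: inj_on_def\<close>)
    ultimately show ?thesis by simp
  qed
  finally show ?thesis by (simp add: h_def)
qed

definition bump_partial :: "nat \<Rightarrow> real \<Rightarrow> nat \<Rightarrow> int \<Rightarrow> real" where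
  "bump_partial b \<eta> j m = (\<Prod>l<j. sinc (\<eta> / real b ^ l * of_int m) ^ (2 * (b - 1) ^ l))"

text \<open>The Fourier transform of an infinite convolution of box functions. The even exponents make
  the partial products decreasing in \<open>j\<close>; the factor \<open>l\<close> contributes \<open>2 \<eta> ((b - 1) / b) ^ l\<close>
  to the bandwidth.\<close>
definition bump :: "nat \<Rightarrow> real \<Rightarrow> int \<Rightarrow> real" where
  "bump b \<eta> m = lim (\<lambda>j. bump_partial b \<eta> j m)"

lemma sinc_even_power: "0 \<le> sinc x ^ (2 * e)" "sinc x ^ (2 * e) \<le> 1"
proof -
  show "0 \<le> sinc x ^ (2 * e)" by (simp add: power_mult)
  have "\<bar>sinc x\<bar> ^ (2 * e) \<le> 1" using abs_sinc_le_1[of x] by (simp add: power_le_one)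
  then show "sinc x ^ (2 * e) \<le> 1" by (simp add: power_mult)
qed

lemma bump_partial_nonneg: "0 \<le> bump_partial b \<eta> j m"
  unfolding bump_partial_def by (intro prod_nonneg ballI sinc_even_power)

lemma bump_partial_decseq: "decseq (\<lambda>j. bump_partial b \<eta> j m)"
  by (rule decseq_SucI)
    (use bump_partial_nonneg[of b \<eta> _ m] sinc_even_power in
      \<open>auto simp: bump_partial_def intro!: mult_left_le\<close>)

lemma bump_partial_lim: "(\<lambda>j. bump_partial b \<eta> j m) \<longlonglongrightarrow> bump b \<eta> m"
proof -
  obtain L where "(\<lambda>j. bump_partial b \<eta> j m) \<longlonglongrightarrow> L"
    by (rule decseq_convergent[OF bump_partial_decseq[of b \<eta> m], of 0])
      (auto simp: bump_partial_nonneg)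
  then have "convergent (\<lambda>j. bump_partial b \<eta> j m)"
    by (rule convergentI)
  then show ?thesis by (simp add: bump_def convergent_LIMSEQ_iff)
qed

lemma bump_le: "bump b \<eta> m \<le> bump_partial b \<eta> j m"
  using decseq_ge[OF bump_partial_decseq bump_partial_lim] .

lemma bump_nonneg: "0 \<le> bump b \<eta> m"
  by (rule LIMSEQ_le_const[OF bump_partial_lim]) (simp add: bump_partial_nonneg)

lemma bump_le_factor:
  "bump b \<eta> m \<le> sinc (\<eta> / real b ^ l * of_int m) ^ (2 * (b - 1) ^ l)"
proof -
  have "bump b \<eta> m \<le> bump_partial b \<eta> (Suc l) m" by (rule bump_le)
  also have "\<dots> \<le> 1 * sinc (\<eta> / real b ^ l * of_int m) ^ (2 * (b - 1) ^ l)"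
    unfolding bump_partial_def prod.lessThan_Suc
    by (intro mult_right_mono prod_le_1 sinc_even_power conjI)
  finally show ?thesis by simp
qed

lemma bump_le_1: "bump b \<eta> m \<le> 1"
  using bump_le[of b \<eta> m 0] by (simp add: bump_partial_def)

lemma bump_0: "bump b \<eta> 0 = 1"
  using bump_partial_lim[of b \<eta> 0] by (simp add: bump_partial_def LIMSEQ_const_iff)

text \<open>The factor \<open>l = 0\<close> already vanishes, because \<eta> m is a nonzero multiple
  of \<pi>. These zeros make the \<open>N\<close> rotated copies of the bump add up to an exact
  constant in \<open>spectral_partition\<close>.\<close>

lemma bump_eq_0:
  assumes "\<eta> = pi / real N" "N > 0" "int N dvd m" "m \<noteq> 0"
  shows "bump b \<eta> m = 0"
proof -
  obtain k where m: "m = int N * k" using assms by auto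
  have "\<eta> * of_int m = pi * of_int k" using assms m by simp
  then have "sinc (\<eta> * of_int m) = 0"
    using assms m by (auto simp: sinc_def sin_zero_iff_int2)
  then show ?thesis
    using bump_le_factor[of b \<eta> m 0] bump_nonneg[of b \<eta> m] by simp
qed

lemma band_limited_bump:
  assumes "0 \<le> \<eta>" "1 \<le> b"
  shows "band_limited (2 * \<eta> * real b) (bump b \<eta>)"
proof (rule band_limited_lim[OF _ bump_partial_lim])
  fix j
  have r: "real (b - Suc 0) = real b - 1" using assms by simp
  have "band_limited (\<Sum>l<j. real (2 * (b - 1) ^ l) * (\<eta> / real b ^ l)) (bump_partial b \<eta> j)"
  proof (induction j)
    case 0
    show ?case using band_limited_1[of 0] by (simp add: bump_partial_def[abs_def])
  next
    case (Suc j)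
    show ?case
      using band_limited_mult_sinc_power[OF Suc, of "\<eta> / real b ^ j" "2 * (b - 1) ^ j"] assms
      by (simp add: bump_partial_def[abs_def])
  qed
  moreover have "(\<Sum>l<j. real (2 * (b - 1) ^ l) * (\<eta> / real b ^ l)) \<le> 2 * \<eta> * real b"
  proof -
    define x where "x = (real b - 1) / real b"
    have x: "0 \<le> x" "x < 1" and bx: "real b * (1 - x) = 1" using assms by (auto simp: x_def field_simps)
    have "(\<Sum>l<j. real (2 * (b - 1) ^ l) * (\<eta> / real b ^ l)) = 2 * \<eta> * (\<Sum>l<j. x ^ l)"
      by (simp add: sum_distrib_left x_def power_divide r mult_ac)
    also have "(\<Sum>l<j. x ^ l) \<le> real b"
    proof -
      have "(\<Sum>l<j. x ^ l) = real b * (1 - x) * (\<Sum>l<j. x ^ l)" by (simp add: bx)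
      also have "\<dots> = real b * (1 - x ^ j)" using one_diff_power_eq[of x j] by simp
      also have "\<dots> \<le> real b" using x by (simp add: mult_left_le)
      finally show ?thesis .
    qed
    finally show ?thesis using assms by (simp add: mult_left_mono)
  qed
  ultimately show "band_limited (2 * \<eta> * real b) (bump_partial b \<eta> j)"
    by (rule band_limited_mono)
qed

text \<open>At |m| of size b^l one factor alone forces the square root below 2^(-(b-1)^l), while the
  weight is only exp(L b^(\<gamma> l)). Since b^\<gamma> < b - 1 the decay wins, with enough to
  spare for a factor 1 + m^2 that makes the sum converge. The square root is what remains of the
  decay once the other half has been traded for the Bernstein bound.\<close>

lemma bump_weighted_bound:
  fixes b :: nat and K \<gamma> \<eta> :: real
  assumes b: "3 \<le> b" and \<gamma>: "0 < \<gamma>" and b\<gamma>: "real b powr \<gamma> < real b - 1"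
    and K: "0 \<le> K" and \<eta>: "0 < \<eta>"
  obtains S where "\<And>F. finite F \<Longrightarrow>
    (\<Sum>m\<in>F. sqrt (bump b \<eta> m) * exp (K * \<bar>of_int m\<bar> powr \<gamma>)) \<le> S"
proof -
  define \<sigma> where "\<sigma> = real b - 1"
  define \<rho> where "\<rho> = real b powr \<gamma>"
  define L where "L = K * (2 / \<eta> * real b) powr \<gamma>"
  have \<sigma>: "\<sigma> \<ge> 2" "real (b - 1) = \<sigma>" and \<rho>: "0 < \<rho>" "\<rho> < \<sigma>" and b0: "real b > 1"
    using b b\<gamma> by (auto simp: \<sigma>_def \<rho>_def)
  have L: "0 \<le> L" using K by (simp add: L_def)
  \<comment> \<open>Up to constants, \<open>h l\<close> bounds weight times decay times 1 + m^2 at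
    scale b^l; it remains to see that \<open>h\<close> is bounded.\<close>
  define h where "h l = real b ^ (2 * l) * exp (L * \<rho> ^ l - ln 2 * \<sigma> ^ l)" for l :: nat
  \<comment> \<open>The logarithms of the polynomial factor and of the weight, divided by
    \<sigma>^l, tend to 0 because \<sigma> > 1 and \<rho> < \<sigma>.\<close>
  have "(\<lambda>l. 2 * ln (real b) * (real l * (1 / \<sigma>) ^ l) + L * (\<rho> / \<sigma>) ^ l) \<longlonglongrightarrow>
      2 * ln (real b) * 0 + L * 0"
    using \<sigma> \<rho>
    by (intro tendsto_intros powser_times_n_limit_0 LIMSEQ_realpow_zero) (auto simp: field_simps)
  then have "\<forall>\<^sub>F l in sequentially.
      2 * ln (real b) * (real l * (1 / \<sigma>) ^ l) + L * (\<rho> / \<sigma>) ^ l < ln 2"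
    by (intro order_tendstoD(2)) auto
  then have "\<forall>\<^sub>F l in sequentially. h l \<le> 1"
  proof eventually_elim
    case (elim l)
    have "2 * ln (real b) * real l + L * \<rho> ^ l
        = \<sigma> ^ l * (2 * ln (real b) * (real l * (1 / \<sigma>) ^ l) + L * (\<rho> / \<sigma>) ^ l)"
      using \<sigma> by (simp add: field_simps)
    also have "\<dots> \<le> \<sigma> ^ l * ln 2"
      using elim \<sigma> by (intro mult_left_mono) auto
    finally have "2 * ln (real b) * real l + (L * \<rho> ^ l - ln 2 * \<sigma> ^ l) \<le> 0"
      by (simp add: mult.commute)
    moreover have "real b ^ (2 * l) = exp (2 * ln (real b) * real l)"
      using exp_of_nat_mult[of "2 * l" "ln (real b)"] b0 by (simp add: mult_ac)
    then have "h l = exp (2 * ln (real b) * real l + (L * \<rho> ^ l - ln 2 * \<sigma> ^ l))"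
      by (simp only: h_def exp_add)
    ultimately show ?case by simp
  qed
  then obtain l0 where l0: "\<And>l. l \<ge> l0 \<Longrightarrow> h l \<le> 1" by (auto simp: eventually_sequentially)
  define H where "H = 1 + (\<Sum>l<l0. h l)"
  have hpos: "0 \<le> h l" for l by (simp add: h_def)
  have H: "h l \<le> H" for l
  proof (cases "l < l0")
    case True
    then have "h l \<le> (\<Sum>l<l0. h l)" by (intro member_le_sum) (auto simp: hpos)
    then show ?thesis by (simp add: H_def)
  next
    case False
    then show ?thesis using l0[of l] sum_nonneg[of "{..<l0}" h] hpos by (simp add: H_def)
  qed
  have H1: "1 \<le> H" by (simp add: H_def sum_nonneg hpos)
  define C where "C = (1 + (2 / \<eta> * real b) ^ 2) * H * exp L"
  have bound: "sqrt (bump b \<eta> m) * exp (K * \<bar>of_int m\<bar> powr \<gamma>) \<le> C * (1 / (1 + of_int m ^ 2))"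
    for m :: int
  proof -
    define x where "x = \<bar>real_of_int m\<bar>"
    have x: "0 \<le> x" "1 + of_int m ^ 2 = 1 + x ^ 2" by (auto simp: x_def)
    show ?thesis
    \<comment> \<open>Below this threshold no factor is known to be at most 1/2, but only finitely
      many \<open>m\<close> occur and a constant suffices.\<close>
    proof (cases "x < 2 / \<eta>")
      case True
      have "x \<le> 2 / \<eta> * real b"
        using True b0 \<eta> mult_left_mono[of 1 "real b" "2 / \<eta>"] by simp
      then have "x powr \<gamma> \<le> (2 / \<eta> * real b) powr \<gamma>" and x2: "x ^ 2 \<le> (2 / \<eta> * real b) ^ 2"
        using x \<gamma> by (auto intro!: powr_mono2 power_mono)
      then have 1: "K * x powr \<gamma> \<le> L" using K by (auto simp: L_def intro: mult_left_mono)
      have "(sqrt (bump b \<eta> m) * exp (K * x powr \<gamma>)) * (1 + x ^ 2)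
          \<le> (1 * exp L) * (1 + (2 / \<eta> * real b) ^ 2)"
        using 1 x2 bump_le_1[of b \<eta> m] bump_nonneg[of b \<eta> m]
        by (intro mult_mono) auto
      also have "\<dots> \<le> C" using H1 mult_right_mono[of 1 H "exp L * (1 + (2 / \<eta> * real b) ^ 2)"]
        by (simp add: C_def algebra_simps)
      finally show ?thesis using x by (simp add: x_def[symmetric] pos_le_divide_eq add_pos_nonneg)
    next
      case False
      \<comment> \<open>The largest \<open>l\<close> with b^l \<le> x \<eta> / 2, so the last factor
        whose \<open>sinc\<close> argument still has modulus at least 2. Among the factors known to
        be small it has the largest exponent.\<close>
      define l where "l = nat \<lfloor>log (real b) (x * \<eta> / 2)\<rfloor>"
      have x1: "x * \<eta> / 2 \<ge> 1" using False \<eta> by (simp add: field_simps)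
      then have lg: "0 \<le> log (real b) (x * \<eta> / 2)" using b0 by simp
      have lo: "real b ^ l \<le> x * \<eta> / 2"
      proof -
        have "real l \<le> log (real b) (x * \<eta> / 2)" using lg by (simp add: l_def)
        then have "real b powr real l \<le> x * \<eta> / 2" using b0 x1 by (simp add: le_log_iff)
        then show ?thesis using b0 by (simp add: powr_realpow)
      qed
      have hi: "x * \<eta> / 2 \<le> real b ^ (Suc l)"
      proof -
        have "log (real b) (x * \<eta> / 2) \<le> real (Suc l)" using lg unfolding l_def by linarith
        then have "x * \<eta> / 2 \<le> real b powr real (Suc l)" using b0 x1 by (simp add: log_le_iff)
        then show ?thesis using b0 by (simp add: powr_realpow del: of_nat_Suc)
      qed
      have xhi: "x \<le> (2 / \<eta> * real b) * real b ^ l" using hi \<eta> by (simp add: field_simps)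
      have "bump b \<eta> m \<le> sinc (\<eta> / real b ^ l * of_int m) ^ (2 * (b - 1) ^ l)"
        by (rule bump_le_factor)
      also have "\<dots> = (\<bar>sinc (\<eta> / real b ^ l * of_int m)\<bar> ^ ((b - 1) ^ l)) ^ 2"
        by (simp add: power_mult[symmetric] mult.commute power_even_abs)
      also have "\<dots> \<le> ((1 / 2) ^ ((b - 1) ^ l)) ^ 2"
      proof (intro power_mono abs_sinc_le_half)
        show "2 \<le> \<bar>\<eta> / real b ^ l * of_int m\<bar>"
          using lo \<eta> b0 by (simp add: abs_mult x_def[symmetric] field_simps)
      qed auto
      finally have "sqrt (bump b \<eta> m) \<le> sqrt (((1 / 2) ^ ((b - 1) ^ l)) ^ 2)"
        by (simp only: real_sqrt_le_iff)
      then have "sqrt (bump b \<eta> m) \<le> (1 / 2) ^ ((b - 1) ^ l)"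
        by (simp only: real_sqrt_abs abs_of_nonneg zero_le_power zero_le_divide_1_iff zero_le_numeral)
      also have "\<dots> = exp (- ln 2) ^ ((b - 1) ^ l)" by (simp add: exp_minus field_simps)
      also have "\<dots> = exp (- (ln 2 * \<sigma> ^ l))"
        by (subst exp_of_nat_mult[symmetric]) (use \<sigma> in simp)
      finally have s: "sqrt (bump b \<eta> m) \<le> exp (- (ln 2 * \<sigma> ^ l))" .
      have "x powr \<gamma> \<le> ((2 / \<eta> * real b) * real b ^ l) powr \<gamma>"
        using x \<gamma> xhi by (intro powr_mono2) auto
      also have "\<dots> = (2 / \<eta> * real b) powr \<gamma> * \<rho> ^ l"
      proof -
        have "(real b ^ l) powr \<gamma> = \<rho> ^ l"
          using b0 by (simp add: \<rho>_def powr_realpow[symmetric] powr_powr mult.commute)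
        then show ?thesis using \<eta> b0 powr_mult[of "2 / \<eta> * real b" "real b ^ l" \<gamma>] by simp
      qed
      finally have e: "exp (K * x powr \<gamma>) \<le> exp (L * \<rho> ^ l)"
        using K by (simp add: L_def mult.assoc mult_left_mono)
      have q: "1 + x ^ 2 \<le> (1 + (2 / \<eta> * real b) ^ 2) * real b ^ (2 * l)"
      proof -
        have "x ^ 2 \<le> ((2 / \<eta> * real b) * real b ^ l) ^ 2" using x xhi by (intro power_mono)
        also have "\<dots> = (2 / \<eta> * real b) ^ 2 * real b ^ (2 * l)"
          by (simp only: power_mult_distrib power_mult[symmetric] mult.commute[of l 2])
        finally have "x ^ 2 \<le> (2 / \<eta> * real b) ^ 2 * real b ^ (2 * l)" .
        moreover have "1 \<le> real b ^ (2 * l)" using b0 by simp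
        ultimately show ?thesis by (simp add: distrib_right)
      qed
      have "(sqrt (bump b \<eta> m) * exp (K * x powr \<gamma>)) * (1 + x ^ 2)
        \<le> (exp (- (ln 2 * \<sigma> ^ l)) * exp (L * \<rho> ^ l)) * ((1 + (2 / \<eta> * real b) ^ 2) * real b ^ (2 * l))"
        using s e q by (intro mult_mono) (auto simp: bump_nonneg)
      also have "\<dots> = (1 + (2 / \<eta> * real b) ^ 2) * h l"
        by (simp add: h_def exp_diff exp_minus field_simps)
      also have "\<dots> \<le> (1 + (2 / \<eta> * real b) ^ 2) * (H * exp L)"
        using H[of l] H1 L mult_left_mono[of 1 "exp L" H]
        by (intro mult_left_mono) (auto intro: order_trans)
      finally show ?thesis using x
        by (simp add: x_def[symmetric] pos_le_divide_eq add_pos_nonneg C_def mult.assoc)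
    qed
  qed
  show ?thesis
  proof (rule that)
    fix F :: "int set" assume F: "finite F"
    have C: "0 \<le> C" using H1 by (simp add: C_def)
    have "(\<Sum>m\<in>F. sqrt (bump b \<eta> m) * exp (K * \<bar>of_int m\<bar> powr \<gamma>))
        \<le> C * (\<Sum>m\<in>F. 1 / (1 + of_int m ^ 2))"
      unfolding sum_distrib_left by (intro sum_mono bound)
    also have "\<dots> \<le> C * (2 * (\<Sum>n. 1 / (1 + real n ^ 2)))"
      by (intro mult_left_mono sum_inverse_squares_int_le F C)
    finally show "(\<Sum>m\<in>F. sqrt (bump b \<eta> m) * exp (K * \<bar>of_int m\<bar> powr \<gamma>))
      \<le> C * (2 * (\<Sum>n. 1 / (1 + real n ^ 2)))" .
  qed
qed

section \<open>Interpolation between bandwidth and decay\<close>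

lemma sqrt_sum_le:
  assumes "\<And>i. i \<in> F \<Longrightarrow> 0 \<le> f i"
  shows "sqrt (\<Sum>i\<in>F. f i) \<le> (\<Sum>i\<in>F. sqrt (f i))"
  using assms
proof (induction F rule: infinite_finite_induct)
  case (insert i F)
  then have "sqrt (f i + sum f F) \<le> sqrt (f i) + sqrt (sum f F)"
    by (intro sqrt_add_le_add_sqrt sum_nonneg) auto
  with insert show ?case by (force intro: order_trans)
qed auto

lemma abs_backward_difference_le:
  "\<bar>backward_difference n c m\<bar> \<le> 2 ^ n * (\<Sum>i\<le>n. \<bar>c (m - int i)\<bar>)"
proof -
  have "\<bar>backward_difference n c m\<bar> \<le> (\<Sum>i\<le>n. \<bar>(-1) ^ (n - i) * real (n choose i) * c (m - int i)\<bar>)"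
    unfolding backward_difference_def by (rule sum_abs)
  also have "\<dots> \<le> (\<Sum>i\<le>n. 2 ^ n * \<bar>c (m - int i)\<bar>)"
  proof (intro sum_mono)
    fix i assume "i \<in> {..n}"
    have "n choose i \<le> 2 ^ n" by (rule binomial_le_pow2)
    then have "real (n choose i) \<le> 2 ^ n" by (metis of_nat_le_iff of_nat_numeral of_nat_power)
    then show "\<bar>(-1) ^ (n - i) * real (n choose i) * c (m - int i)\<bar> \<le> 2 ^ n * \<bar>c (m - int i)\<bar>"
      by (simp add: abs_mult power_abs mult_right_mono)
  qed
  finally show ?thesis by (simp add: sum_distrib_left)
qed

text \<open>As \<gamma> < 1, the exponent is of smaller order than n, so any geometric growth
  dominates. The factor \<open>n + 1\<close> pays for the n + 1 shifts that occur in an n-th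
  backward difference.\<close>

lemma subexponential_bounded:
  fixes K \<gamma> \<beta> :: real
  assumes "\<gamma> < 1" "1 < \<beta>"
  obtains B where "0 \<le> B" and "\<And>n::nat. real (n + 1) * exp (K * real n powr \<gamma>) \<le> B * \<beta> ^ n"
proof -
  have 1: "(\<lambda>n. real n powr (\<gamma> - 1)) \<longlonglongrightarrow> 0"
    using assms by (intro tendsto_neg_powr filterlim_real_sequentially) auto
  have "(\<lambda>n. K * real n powr (\<gamma> - 1) + ln (real n + 1) / real n) \<longlonglongrightarrow> K * 0 + 0"
  proof (intro tendsto_intros 1)
    have "(\<lambda>n. ln (real (Suc n)) / real (Suc n) * (1 + inverse (real n))) \<longlonglongrightarrow> 0 * (1 + 0)"
      by (intro tendsto_intros lim_inverse_n LIMSEQ_Suc lim_ln_over_n)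
    then have "(\<lambda>n. ln (real (Suc n)) / real (Suc n) * (1 + inverse (real n))) \<longlonglongrightarrow> 0" by simp
    moreover have "\<forall>\<^sub>F n in sequentially.
        ln (real (Suc n)) / real (Suc n) * (1 + inverse (real n)) = ln (real n + 1) / real n"
      using eventually_gt_at_top[of 0]
    proof eventually_elim
      case (elim n)
      then have "1 + inverse (real n) = real (Suc n) / real n" by (simp add: field_simps)
      then show ?case by (simp add: add.commute)
    qed
    ultimately show "(\<lambda>n. ln (real n + 1) / real n) \<longlonglongrightarrow> 0"
      by (rule Lim_transform_eventually)
  qed
  then have "\<forall>\<^sub>F n in sequentially. K * real n powr (\<gamma> - 1) + ln (real n + 1) / real n < ln \<beta>"
    using assms by (intro order_tendstoD(2)) auto
  then have "\<forall>\<^sub>F n in sequentially. real (n + 1) * exp (K * real n powr \<gamma>) \<le> \<beta> ^ n"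
    using eventually_gt_at_top[of 0]
  proof eventually_elim
    case (elim n)
    have "real n powr \<gamma> = real n powr (\<gamma> - 1) * real n"
      using elim by (simp add: powr_diff)
    then have "K * real n powr \<gamma> + ln (real n + 1)
        = real n * (K * real n powr (\<gamma> - 1) + ln (real n + 1) / real n)"
      using elim by (simp add: field_simps)
    also have "\<dots> \<le> real n * ln \<beta>" using elim by (intro mult_left_mono) auto
    finally have "exp (K * real n powr \<gamma> + ln (real n + 1)) \<le> exp (real n * ln \<beta>)" by simp
    then show ?case using assms by (simp add: exp_add exp_of_nat_mult mult.commute add.commute)
  qed
  then obtain n0 where n0: "\<And>n. n \<ge> n0 \<Longrightarrow> real (n + 1) * exp (K * real n powr \<gamma>) \<le> \<beta> ^ n"
    by (auto simp: eventually_sequentially)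
  define B where "B = 1 + (\<Sum>n<n0. real (n + 1) * exp (K * real n powr \<gamma>))"
  have B1: "1 \<le> B" by (simp add: B_def sum_nonneg)
  have "real (n + 1) * exp (K * real n powr \<gamma>) \<le> B * \<beta> ^ n" for n
  proof (cases "n < n0")
    case True
    then have "real (n + 1) * exp (K * real n powr \<gamma>) \<le> (\<Sum>n<n0. real (n + 1) * exp (K * real n powr \<gamma>))"
      by (intro member_le_sum) auto
    also have "\<dots> \<le> B" by (simp add: B_def)
    also have "\<dots> \<le> B * \<beta> ^ n" using B1 mult_left_mono[of 1 "\<beta> ^ n" B] assms by simp
    finally show ?thesis .
  next
    case False
    then have "real (n + 1) * exp (K * real n powr \<gamma>) \<le> 1 * \<beta> ^ n" using n0[of n] by simp
    also have "\<dots> \<le> B * \<beta> ^ n" using B1 assms by (intro mult_right_mono) auto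
    finally show ?thesis .
  qed
  with B1 show ?thesis by (intro that[of B]) auto
qed

text \<open>The Fourier coefficients of a bump function supported near \<open>1\<close> on the circle;
  \<open>backward_difference n c\<close> are those of its product with \<open>(z - 1) ^ n\<close>. Interpolating between the
  Bernstein bound \<open>\<delta> ^ n\<close> and the decay of \<open>c\<close> gives the weighted bound.\<close>
lemma localizing_sequence:
  fixes K \<gamma> \<epsilon> :: real
  assumes K: "0 \<le> K" and \<gamma>: "0 < \<gamma>" "\<gamma> < 1" and \<epsilon>: "0 < \<epsilon>"
  obtains N :: nat and c :: "int \<Rightarrow> real" and M :: real
  where "0 < N" "c 0 = 1" "\<And>m. int N dvd m \<Longrightarrow> m \<noteq> 0 \<Longrightarrow> c m = 0" "0 \<le> M"
    "\<And>n F. finite F \<Longrightarrow>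
      (\<Sum>m\<in>F. \<bar>backward_difference n c m\<bar> * exp (K * \<bar>of_int m\<bar> powr \<gamma>)) \<le> M * \<epsilon> ^ n"
proof -
  \<comment> \<open>The condition says b^(1-\<gamma>) > 2, hence 2 b^\<gamma> < b, and so b^\<gamma>
    < b - 1, which is what the decay of the bump requires.\<close>
  obtain b0 :: nat where b0: "2 powr (1 / (1 - \<gamma>)) < real b0" using reals_Archimedean2 by blast
  define b where "b = max 3 b0"
  have b: "3 \<le> b" "2 powr (1 / (1 - \<gamma>)) < real b" using b0 by (auto simp: b_def)
  have b\<gamma>: "real b powr \<gamma> < real b - 1"
  proof -
    have "2 = (2 powr (1 / (1 - \<gamma>))) powr (1 - \<gamma>)" using \<gamma> by (simp add: powr_powr)
    also have "\<dots> < real b powr (1 - \<gamma>)" using b \<gamma> by (intro powr_less_mono2) auto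
    finally have "2 * real b powr \<gamma> < real b powr (1 - \<gamma>) * real b powr \<gamma>"
      using b by (intro mult_strict_right_mono) auto
    also have "\<dots> = real b" using b by (simp flip: powr_add)
    finally show ?thesis using b by simp
  qed
  \<comment> \<open>The final ratio will be 2 sqrt(2 \<delta>) = sqrt(8 \<delta>) with bandwidth
    \<delta> = 2 \<pi> b / N: sqrt \<delta> is half of the Bernstein bound, sqrt 2 is half of the
    bound 2^n for binomial coefficients, and 2 absorbs the subexponential factor. The size of
    \<open>N\<close> makes 8 \<delta> \<le> \<epsilon>^2.\<close>
  obtain N :: nat where N: "16 * pi * real b / \<epsilon> ^ 2 < real N" using reals_Archimedean2 by blast
  have "0 \<le> 16 * pi * real b / \<epsilon> ^ 2" by simp
  then have N0: "0 < N" using N by (metis less_le_trans not_gr0 of_nat_0 order_less_irrefl)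
  define \<eta> where "\<eta> = pi / real N"
  have \<eta>: "0 < \<eta>" using N0 by (simp add: \<eta>_def)
  define \<delta> where "\<delta> = 2 * \<eta> * real b"
  have \<delta>: "0 \<le> \<delta>" "8 * \<delta> \<le> \<epsilon> ^ 2"
    using N N0 \<epsilon> \<eta> by (auto simp: \<delta>_def \<eta>_def field_simps)
  obtain S where S: "\<And>F. finite F \<Longrightarrow>
    (\<Sum>m\<in>F. sqrt (bump b \<eta> m) * exp (K * \<bar>of_int m\<bar> powr \<gamma>)) \<le> S"
    using bump_weighted_bound[OF b(1) \<gamma>(1) b\<gamma> K \<eta>] by blast
  have S0: "0 \<le> S" using S[of "{}"] by simp
  obtain B where B: "0 \<le> B" "\<And>n::nat. real (n + 1) * exp (K * real n powr \<gamma>) \<le> B * 2 ^ n"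
    using subexponential_bounded[OF \<gamma>(2), of 2] by auto
  have "(\<Sum>m\<in>F. \<bar>backward_difference n (bump b \<eta>) m\<bar> * exp (K * \<bar>of_int m\<bar> powr \<gamma>)) \<le> B * S * \<epsilon> ^ n"
    if F: "finite F" for n F
  proof -
    have D: "\<bar>backward_difference n (bump b \<eta>) m\<bar>
        \<le> sqrt (2 * \<delta>) ^ n * (\<Sum>i\<le>n. sqrt (bump b \<eta> (m - int i)))" for m
    proof -
      let ?D = "\<bar>backward_difference n (bump b \<eta>) m\<bar>"
      have 1: "?D \<le> \<delta> ^ n"
        unfolding \<delta>_def by (intro band_limited_backward_difference band_limited_bump) (use \<eta> b in auto)
      have 2: "?D \<le> 2 ^ n * (\<Sum>i\<le>n. bump b \<eta> (m - int i))"
        using abs_backward_difference_le[of n "bump b \<eta>" m] by (simp add: bump_nonneg)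
      have "?D = sqrt ?D * sqrt ?D" by simp
      also have "\<dots> \<le> sqrt (\<delta> ^ n) * sqrt (2 ^ n * (\<Sum>i\<le>n. bump b \<eta> (m - int i)))"
        using 1 2 \<delta> by (intro mult_mono real_sqrt_le_mono) auto
      also have "\<dots> = sqrt (2 * \<delta>) ^ n * sqrt (\<Sum>i\<le>n. bump b \<eta> (m - int i))"
        by (simp add: real_sqrt_mult real_sqrt_power power_mult_distrib)
      also have "\<dots> \<le> sqrt (2 * \<delta>) ^ n * (\<Sum>i\<le>n. sqrt (bump b \<eta> (m - int i)))"
        using \<delta> by (intro mult_left_mono sqrt_sum_le) (auto simp: bump_nonneg)
      finally show ?thesis .
    qed
    \<comment> \<open>By subadditivity of t^\<gamma>, translation by i \<le> n costs at most the
      factor exp(K n^\<gamma>), which is still subexponential in n.\<close>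
    have shift: "(\<Sum>m\<in>F. sqrt (bump b \<eta> (m - int i)) * exp (K * \<bar>of_int m\<bar> powr \<gamma>))
        \<le> exp (K * real n powr \<gamma>) * S" if "i \<le> n" for i
    proof -
      have "(\<Sum>m\<in>F. sqrt (bump b \<eta> (m - int i)) * exp (K * \<bar>of_int m\<bar> powr \<gamma>))
          \<le> (\<Sum>m\<in>F. exp (K * real n powr \<gamma>) *
              (sqrt (bump b \<eta> (m - int i)) * exp (K * \<bar>of_int (m - int i)\<bar> powr \<gamma>)))"
      proof (intro sum_mono)
        fix m
        have "\<bar>real_of_int m\<bar> powr \<gamma> \<le> (\<bar>of_int (m - int i)\<bar> + real i) powr \<gamma>"
          using \<gamma> by (intro powr_mono2) auto
        also have "\<dots> \<le> \<bar>of_int (m - int i)\<bar> powr \<gamma> + real i powr \<gamma>"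
          using \<gamma> by (intro powr_add_le) auto
        also have "\<dots> \<le> \<bar>of_int (m - int i)\<bar> powr \<gamma> + real n powr \<gamma>"
          using \<gamma> that by (intro add_left_mono powr_mono2) auto
        finally have "K * \<bar>of_int m\<bar> powr \<gamma> \<le> K * (\<bar>of_int (m - int i)\<bar> powr \<gamma> + real n powr \<gamma>)"
          using K by (intro mult_left_mono) auto
        then have "exp (K * \<bar>of_int m\<bar> powr \<gamma>) \<le>
            exp (K * real n powr \<gamma>) * exp (K * \<bar>of_int (m - int i)\<bar> powr \<gamma>)"
          by (simp add: distrib_left mult_exp_exp add.commute)
        then have "sqrt (bump b \<eta> (m - int i)) * exp (K * \<bar>of_int m\<bar> powr \<gamma>) \<le>
          sqrt (bump b \<eta> (m - int i)) * (exp (K * real n powr \<gamma>) * exp (K * \<bar>of_int (m - int i)\<bar> powr \<gamma>))"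
          by (intro mult_left_mono) (auto simp: bump_nonneg)
        then show "sqrt (bump b \<eta> (m - int i)) * exp (K * \<bar>of_int m\<bar> powr \<gamma>) \<le> exp (K * real n powr \<gamma>) *
              (sqrt (bump b \<eta> (m - int i)) * exp (K * \<bar>of_int (m - int i)\<bar> powr \<gamma>))"
          by (simp only: mult_ac)
      qed
      also have "\<dots> = exp (K * real n powr \<gamma>) * (\<Sum>m\<in>(\<lambda>m. m - int i) ` F.
              sqrt (bump b \<eta> m) * exp (K * \<bar>of_int m\<bar> powr \<gamma>))"
        by (subst sum.reindex) (auto simp: inj_on_def sum_distrib_left)
      also have "\<dots> \<le> exp (K * real n powr \<gamma>) * S"
        using F by (intro mult_left_mono S) auto
      finally show ?thesis .
    qed
    have "(\<Sum>m\<in>F. \<bar>backward_difference n (bump b \<eta>) m\<bar> * exp (K * \<bar>of_int m\<bar> powr \<gamma>))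
        \<le> (\<Sum>m\<in>F. (sqrt (2 * \<delta>) ^ n * (\<Sum>i\<le>n. sqrt (bump b \<eta> (m - int i)))) * exp (K * \<bar>of_int m\<bar> powr \<gamma>))"
      by (intro sum_mono mult_right_mono D) auto
    also have "\<dots> = sqrt (2 * \<delta>) ^ n *
        (\<Sum>i\<le>n. \<Sum>m\<in>F. sqrt (bump b \<eta> (m - int i)) * exp (K * \<bar>of_int m\<bar> powr \<gamma>))"
      by (subst sum.swap) (simp add: sum_distrib_left sum_distrib_right mult.assoc)
    also have "\<dots> \<le> sqrt (2 * \<delta>) ^ n * (\<Sum>i\<le>n. exp (K * real n powr \<gamma>) * S)"
      using \<delta> by (intro mult_left_mono sum_mono shift) auto
    also have "\<dots> = sqrt (2 * \<delta>) ^ n * ((real (n + 1) * exp (K * real n powr \<gamma>)) * S)"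
      by simp
    also have "\<dots> \<le> sqrt (2 * \<delta>) ^ n * ((B * 2 ^ n) * S)"
      using \<delta> S0 by (intro mult_left_mono mult_right_mono B) auto
    also have "\<dots> = B * S * (2 * sqrt (2 * \<delta>)) ^ n" by (simp add: power_mult_distrib)
    also have "\<dots> \<le> B * S * \<epsilon> ^ n"
    proof (intro mult_left_mono power_mono)
      have "2 * sqrt (2 * \<delta>) = sqrt (8 * \<delta>)" using real_sqrt_mult[of 4 "2 * \<delta>"] by simp
      also have "\<dots> \<le> \<epsilon>" using \<delta>(2) \<epsilon> by (simp add: real_le_lsqrt)
      finally show "2 * sqrt (2 * \<delta>) \<le> \<epsilon>" .
    qed (use \<delta> B S0 in auto)
    finally show ?thesis .
  qed
  then show ?thesis
    using N0 bump_0 bump_eq_0[OF \<eta>_def N0] B S0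
    by (intro that[of N "bump b \<eta>" "B * S"]) auto
qed

section \<open>Banach subrings\<close>

lemma binomial_commuting:
  fixes x y :: "'a::ring_1"
  assumes c: "x * y = y * x"
  shows "(x + y) ^ n = (\<Sum>k\<le>n. of_nat (n choose k) * x ^ k * y ^ (n - k))"
proof (induction n)
  case (Suc n)
  have yx: "y * x ^ k = x ^ k * y" for k
    using power_commuting_commutes[OF c] by simp
  have 1: "x * (of_nat (n choose k) * x ^ k * y ^ (n - k)) = of_nat (n choose k) * x ^ Suc k * y ^ (n - k)" for k
    using mult_of_nat_commute[of "n choose k" x] by (simp add: mult.assoc[symmetric])
  have 2: "y * (of_nat (n choose k) * x ^ k * y ^ (n - k)) = of_nat (n choose k) * x ^ k * y ^ (Suc n - k)"
    if "k \<le> n" for k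
  proof -
    have "y * (of_nat (n choose k) * x ^ k * y ^ (n - k)) = of_nat (n choose k) * (y * x ^ k) * y ^ (n - k)"
      using mult_of_nat_commute[of "n choose k" y] by (simp add: mult.assoc[symmetric])
    also have "\<dots> = of_nat (n choose k) * x ^ k * y ^ (Suc n - k)"
      using that by (simp add: yx mult.assoc Suc_diff_le)
    finally show ?thesis .
  qed
  have "(x + y) ^ Suc n = x * (\<Sum>k\<le>n. of_nat (n choose k) * x ^ k * y ^ (n - k))
      + y * (\<Sum>k\<le>n. of_nat (n choose k) * x ^ k * y ^ (n - k))"
    by (simp add: Suc distrib_right)
  also have "\<dots> = (\<Sum>k\<le>n. of_nat (n choose k) * x ^ Suc k * y ^ (n - k))
      + (\<Sum>k\<le>n. of_nat (n choose k) * x ^ k * y ^ (Suc n - k))"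
    unfolding sum_distrib_left 1 using 2 by (intro arg_cong2[of _ _ _ _ "(+)"] sum.cong) auto
  also have "(\<Sum>k\<le>n. of_nat (n choose k) * x ^ k * y ^ (Suc n - k))
      = (\<Sum>k\<le>Suc n. of_nat (n choose k) * x ^ k * y ^ (Suc n - k))"
    by (simp add: binomial_eq_0)
  also have "\<dots> = y ^ Suc n + (\<Sum>k\<le>n. of_nat (n choose Suc k) * x ^ Suc k * y ^ (n - k))"
    by (subst sum.atMost_Suc_shift) simp
  also have "(\<Sum>k\<le>n. of_nat (n choose k) * x ^ Suc k * y ^ (n - k))
      + (y ^ Suc n + (\<Sum>k\<le>n. of_nat (n choose Suc k) * x ^ Suc k * y ^ (n - k)))
      = (\<Sum>k\<le>Suc n. of_nat (Suc n choose k) * x ^ k * y ^ (Suc n - k))"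
    by (subst sum.atMost_Suc_shift) (simp add: sum.distrib[symmetric] distrib_right add_ac)
  finally show ?case .
qed simp

text \<open>Integer powers of a unit \<open>u\<close> with inverse \<open>v\<close>.\<close>
definition zpow :: "'a::ring_1 \<Rightarrow> 'a \<Rightarrow> int \<Rightarrow> 'a" where
  "zpow u v m = (if 0 \<le> m then u ^ nat m else v ^ nat (- m))"

lemma zpow_0 [simp]: "zpow u v 0 = 1"
  by (simp add: zpow_def)

lemma zpow_add_nat:
  assumes uv: "u * v = 1"
  shows "zpow u v (m + int i) = u ^ i * zpow u v m"
proof (induction i)
  case (Suc i)
  have "zpow u v (k + 1) = u * zpow u v k" for k
  proof (cases "0 \<le> k")
    case True
    then show ?thesis by (simp add: zpow_def nat_add_distrib)
  next
    case False
    then obtain l where l: "nat (- k) = Suc l" by (metis neg_0_less_iff_less not0_implies_Suc not_le nat_0_iff)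
    have "u * v ^ Suc l = v ^ l" by (simp add: mult.assoc[symmetric] uv)
    moreover have "zpow u v (k + 1) = v ^ l"
    proof (cases "k + 1 = 0")
      case True
      then have "k = - 1" by simp
      then show ?thesis using l by (simp add: zpow_def)
    next
      case False
      then have "nat (- (k + 1)) = l" "\<not> 0 \<le> k + 1" using l \<open>\<not> 0 \<le> k\<close> by linarith+
      then show ?thesis by (simp add: zpow_def)
    qed
    ultimately show ?thesis using False l by (simp add: zpow_def)
  qed
  from this[of "m + int i"] Suc show ?case by (simp add: mult.assoc add_ac)
qed simp

text \<open>Scalars enter as central elements \<open>sc a\<close>, so that ring operations of the
  type suffice. \<open>R\<close> is only a subset of that type and \<open>\<nu>\<close> is a norm
  only on \<open>R\<close>: this is the shape in which a subalgebra with its own norm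
  arrives.\<close>

locale banach_subring =
  fixes R :: "'r::ring_1 set" and \<nu> :: "'r \<Rightarrow> real" and sc :: "complex \<Rightarrow> 'r"
  assumes sc_1 [simp]: "sc 1 = 1"
    and sc_add: "sc (a + b) = sc a + sc b"
    and sc_mult: "sc (a * b) = sc a * sc b"
    and sc_commute: "sc a * x = x * sc a"
    and sc_mem [simp]: "sc a \<in> R"
    and add_mem: "x \<in> R \<Longrightarrow> y \<in> R \<Longrightarrow> x + y \<in> R"
    and mult_mem: "x \<in> R \<Longrightarrow> y \<in> R \<Longrightarrow> x * y \<in> R"
    and \<nu>_nonneg: "x \<in> R \<Longrightarrow> 0 \<le> \<nu> x"
    and \<nu>_eq_0: "x \<in> R \<Longrightarrow> \<nu> x = 0 \<Longrightarrow> x = 0"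
    and \<nu>_add: "x \<in> R \<Longrightarrow> y \<in> R \<Longrightarrow> \<nu> (x + y) \<le> \<nu> x + \<nu> y"
    and \<nu>_mult: "x \<in> R \<Longrightarrow> y \<in> R \<Longrightarrow> \<nu> (x * y) \<le> \<nu> x * \<nu> y"
    and \<nu>_sc: "\<nu> (sc a) = cmod a"
    and complete: "(\<And>n::nat. X n \<in> R) \<Longrightarrow>
          (\<forall>e>0. \<exists>N. \<forall>m\<ge>N. \<forall>n\<ge>N. \<nu> (X m - X n) < e) \<Longrightarrow>
          (\<exists>L\<in>R. \<forall>e>0. \<exists>N. \<forall>n\<ge>N. \<nu> (X n - L) < e)"
begin

lemma sc_0 [simp]: "sc 0 = 0"
  using sc_add[of 0 0] by simp

lemma sc_minus: "sc (- a) = - sc a"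
  using sc_add[of a "- a"] by (simp add: eq_neg_iff_add_eq_0 add.commute)

lemma sc_diff: "sc (a - b) = sc a - sc b"
  using sc_add[of a "- b"] by (simp add: sc_minus)

lemma sc_power: "sc (a ^ n) = sc a ^ n"
  by (induction n) (auto simp: sc_mult)

lemma sc_sum: "sc (sum f F) = (\<Sum>i\<in>F. sc (f i))"
  by (induction F rule: infinite_finite_induct) (auto simp: sc_add)

lemma sc_of_nat: "sc (of_nat n) = of_nat n"
  by (induction n) (auto simp: sc_add)

lemma sc_cancel: "a \<noteq> 0 \<Longrightarrow> sc a * (sc (1 / a) * x) = x"
  by (simp add: mult.assoc[symmetric] sc_mult[symmetric])

lemma one_mem [simp]: "1 \<in> R"
  using sc_mem[of 1] by simp

lemma zero_mem [simp]: "0 \<in> R"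
  using sc_mem[of 0] by simp

lemma minus_mem: "x \<in> R \<Longrightarrow> - x \<in> R"
  using mult_mem[OF sc_mem[of "- 1"], of x] by (simp add: sc_minus del: sc_mem)

lemma diff_mem: "x \<in> R \<Longrightarrow> y \<in> R \<Longrightarrow> x - y \<in> R"
  using add_mem[of x "- y"] minus_mem[of y] by simp

lemma sum_mem: "(\<And>i. i \<in> F \<Longrightarrow> f i \<in> R) \<Longrightarrow> sum f F \<in> R"
  by (induction F rule: infinite_finite_induct) (auto intro: add_mem)

lemma power_mem: "x \<in> R \<Longrightarrow> x ^ n \<in> R"
  by (induction n) (auto intro: mult_mem)

lemma zpow_mem: "u \<in> R \<Longrightarrow> v \<in> R \<Longrightarrow> zpow u v m \<in> R"
  by (simp add: zpow_def power_mem)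

lemmas mem_intros = add_mem mult_mem diff_mem minus_mem sum_mem power_mem zpow_mem

lemma \<nu>_0 [simp]: "\<nu> 0 = 0"
  using \<nu>_sc[of 0] by simp

lemma \<nu>_1 [simp]: "\<nu> 1 = 1"
  using \<nu>_sc[of 1] by simp

lemma \<nu>_sc_mult_le: "x \<in> R \<Longrightarrow> \<nu> (sc a * x) \<le> cmod a * \<nu> x"
  using \<nu>_mult[of "sc a" x] by (simp add: \<nu>_sc)

lemma \<nu>_minus: "x \<in> R \<Longrightarrow> \<nu> (- x) = \<nu> x"
  using \<nu>_sc_mult_le[of x "-1"] \<nu>_sc_mult_le[of "- x" "-1"] minus_mem[of x]
  by (simp add: sc_minus)

lemma \<nu>_diff: "x \<in> R \<Longrightarrow> y \<in> R \<Longrightarrow> \<nu> (x - y) \<le> \<nu> x + \<nu> y"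
  using \<nu>_add[of x "- y"] \<nu>_minus[of y] minus_mem[of y] by simp

lemma \<nu>_diff_commute: "x \<in> R \<Longrightarrow> y \<in> R \<Longrightarrow> \<nu> (x - y) = \<nu> (y - x)"
  using \<nu>_minus[of "x - y"] by (simp add: diff_mem)

lemma \<nu>_triangle: "x \<in> R \<Longrightarrow> y \<in> R \<Longrightarrow> z \<in> R \<Longrightarrow> \<nu> (x - z) \<le> \<nu> (x - y) + \<nu> (y - z)"
  using \<nu>_add[of "x - y" "y - z"] by (simp add: diff_mem)

lemma \<nu>_sum: "(\<And>i. i \<in> F \<Longrightarrow> f i \<in> R) \<Longrightarrow> \<nu> (sum f F) \<le> (\<Sum>i\<in>F. \<nu> (f i))"
proof (induction F rule: infinite_finite_induct)
  case (insert i F)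
  then have "\<nu> (f i + sum f F) \<le> \<nu> (f i) + \<nu> (sum f F)" by (intro \<nu>_add sum_mem) auto
  with insert show ?case by (force intro: order_trans)
qed auto

lemma \<nu>_power_add: "x \<in> R \<Longrightarrow> \<nu> (x ^ (m + n)) \<le> \<nu> (x ^ m) * \<nu> (x ^ n)"
  by (simp add: power_add \<nu>_mult power_mem)

lemma eqI_small:
  assumes "x \<in> R" "y \<in> R" "\<And>e. e > 0 \<Longrightarrow> \<nu> (x - y) \<le> e"
  shows "x = y"
proof -
  have "\<nu> (x - y) \<le> 0" using assms(3) field_le_epsilon[of "\<nu> (x - y)" 0] by simp
  then have "x - y = 0" using \<nu>_nonneg[of "x - y"] \<nu>_eq_0[of "x - y"] diff_mem[OF assms(1,2)] by simp
  then show ?thesis by simp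
qed

text \<open>The rule that radii add: if \<open>s\<close> and \<open>t\<close> commute and act on
  \<open>z\<close> with radii \<open>a\<close> and \<open>b\<close>, the binomial theorem gives
  radius a + b for the sum, with the same constant \<open>M\<close>.\<close>

lemma \<nu>_power_sum_mult_le:
  assumes mem: "s \<in> R" "t \<in> R" "z \<in> R" and c: "s * t = t * s"
    and le: "\<And>i j. \<nu> (s ^ i * t ^ j * z) \<le> M * a ^ i * b ^ j"
  shows "\<nu> ((s + t) ^ n * z) \<le> M * (a + b) ^ n"
proof -
  have "(s + t) ^ n * z = (\<Sum>k\<le>n. sc (of_nat (n choose k)) * (s ^ k * t ^ (n - k) * z))"
    by (simp add: binomial_commuting[OF c] sum_distrib_right mult.assoc sc_of_nat)
  also have "\<nu> \<dots> \<le> (\<Sum>k\<le>n. \<nu> (sc (of_nat (n choose k)) * (s ^ k * t ^ (n - k) * z)))"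
    by (intro \<nu>_sum mem_intros mem sc_mem)
  also have "\<dots> \<le> (\<Sum>k\<le>n. real (n choose k) * (M * a ^ k * b ^ (n - k)))"
  proof (intro sum_mono)
    fix k
    have "\<nu> (sc (of_nat (n choose k)) * (s ^ k * t ^ (n - k) * z)) \<le>
        cmod (of_nat (n choose k)) * \<nu> (s ^ k * t ^ (n - k) * z)"
      by (intro \<nu>_sc_mult_le mem_intros mem)
    also have "\<dots> \<le> real (n choose k) * (M * a ^ k * b ^ (n - k))"
      by (simp add: le mult_left_mono)
    finally show "\<nu> (sc (of_nat (n choose k)) * (s ^ k * t ^ (n - k) * z)) \<le>
      real (n choose k) * (M * a ^ k * b ^ (n - k))" .
  qed
  also have "\<dots> = M * (a + b) ^ n"
    by (simp add: binomial_ring sum_distrib_left mult_ac)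
  finally show ?thesis .
qed

text \<open>Convergence along the net of finite subsets, spelled out with \<open>\<nu>\<close>
  because the ring type carries no topology. Being unordered, it allows series over the integers to
  be shifted freely.\<close>

definition sums_to :: "('i \<Rightarrow> 'r) \<Rightarrow> 'r \<Rightarrow> bool" where
  "sums_to f S \<longleftrightarrow> (\<forall>e>0. \<exists>F0. finite F0 \<and> (\<forall>F. finite F \<longrightarrow> F0 \<subseteq> F \<longrightarrow> \<nu> (sum f F - S) < e))"

lemma sums_toD:
  assumes "sums_to f S" "e > 0"
  obtains F0 where "finite F0" "\<And>F. finite F \<Longrightarrow> F0 \<subseteq> F \<Longrightarrow> \<nu> (sum f F - S) < e"
  using assms unfolding sums_to_def by meson

lemma sums_to_unique:
  assumes f: "\<And>i. f i \<in> R" and S: "S \<in> R" "T \<in> R" and "sums_to f S" "sums_to f T"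
  shows "S = T"
proof (rule eqI_small[OF S])
  fix e :: real assume "e > 0"
  then have e: "e / 2 > 0" by simp
  obtain F where F: "finite F" "\<And>G. finite G \<Longrightarrow> F \<subseteq> G \<Longrightarrow> \<nu> (sum f G - S) < e / 2"
    using sums_toD[OF assms(4) e] by blast
  obtain F' where F': "finite F'" "\<And>G. finite G \<Longrightarrow> F' \<subseteq> G \<Longrightarrow> \<nu> (sum f G - T) < e / 2"
    using sums_toD[OF assms(5) e] by blast
  let ?s = "sum f (F \<union> F')"
  have s: "?s \<in> R" by (intro mem_intros f)
  have "\<nu> (S - T) \<le> \<nu> (S - ?s) + \<nu> (?s - T)" by (intro \<nu>_triangle S s)
  also have "\<dots> < e / 2 + e / 2"
    using F(2)[of "F \<union> F'"] F'(2)[of "F \<union> F'"] F(1) F'(1) \<nu>_diff_commute[OF S(1) s]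
    by (intro add_strict_mono) auto
  finally show "\<nu> (S - T) \<le> e" by simp
qed

text \<open>Bounded partial sums of norms give uniformly small tails. Completeness is available for
  sequences only, so a limit is found along the exhaustion \<open>E n\<close> by an enumeration of
  the index type and then shown to be the limit of the whole net.\<close>

lemma sums_to_exists:
  fixes f :: "'i::countable \<Rightarrow> 'r"
  assumes f: "\<And>i. f i \<in> R" and bd: "\<And>F. finite F \<Longrightarrow> (\<Sum>i\<in>F. \<nu> (f i)) \<le> B"
  obtains S where "S \<in> R" "sums_to f S"
proof -
  have "(\<lambda>i. \<nu> (f i)) summable_on UNIV"
    by (rule nonneg_bdd_above_summable_on) (auto simp: \<nu>_nonneg f bdd_above_def intro!: exI[of _ B] bd)
  then obtain s where "((\<lambda>i. \<nu> (f i)) has_sum s) UNIV" by (auto simp: summable_on_def)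
  then have lim: "((\<lambda>F. \<Sum>i\<in>F. \<nu> (f i)) \<longlongrightarrow> s) (finite_subsets_at_top UNIV)"
    by (simp add: has_sum_def)
  have tail: "\<exists>F0. finite F0 \<and> (\<forall>G. finite G \<longrightarrow> G \<inter> F0 = {} \<longrightarrow> (\<Sum>i\<in>G. \<nu> (f i)) < e)" if "e > 0" for e
  proof -
    have "\<forall>\<^sub>F F in finite_subsets_at_top UNIV. dist (\<Sum>i\<in>F. \<nu> (f i)) s < e / 2"
      using that by (intro tendstoD[OF lim]) auto
    then obtain F0 where F0: "finite F0" "\<And>F. finite F \<Longrightarrow> F0 \<subseteq> F \<Longrightarrow> dist (\<Sum>i\<in>F. \<nu> (f i)) s < e / 2"
      by (auto simp: eventually_finite_subsets_at_top)
    have "(\<Sum>i\<in>G. \<nu> (f i)) < e" if "finite G" "G \<inter> F0 = {}" for G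
    proof -
      have "(\<Sum>i\<in>F0 \<union> G. \<nu> (f i)) = (\<Sum>i\<in>F0. \<nu> (f i)) + (\<Sum>i\<in>G. \<nu> (f i))"
        using that F0 by (intro sum.union_disjoint) auto
      moreover have "dist (\<Sum>i\<in>F0. \<nu> (f i)) s < e / 2" "dist (\<Sum>i\<in>F0 \<union> G. \<nu> (f i)) s < e / 2"
        using F0 that by auto
      ultimately show ?thesis unfolding dist_real_def by linarith
    qed
    then show ?thesis using F0(1) by blast
  qed
  have small: "\<nu> (sum f F - sum f G) < 2 * e"
    if F0: "\<forall>G. finite G \<longrightarrow> G \<inter> F0 = {} \<longrightarrow> (\<Sum>i\<in>G. \<nu> (f i)) < e" "F0 \<subseteq> F" "F0 \<subseteq> G" "finite F" "finite G"
    for e F0 F G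
  proof -
    have "sum f F = sum f (F - G) + sum f (F \<inter> G)"
      using that by (subst sum.union_disjoint[symmetric]) (auto intro!: sum.cong)
    moreover have "sum f G = sum f (G - F) + sum f (F \<inter> G)"
      using that by (subst sum.union_disjoint[symmetric]) (auto intro!: sum.cong)
    ultimately have "sum f F - sum f G = sum f (F - G) - sum f (G - F)" by simp
    also have "\<nu> \<dots> \<le> \<nu> (sum f (F - G)) + \<nu> (sum f (G - F))" by (intro \<nu>_diff mem_intros f)
    also have "\<dots> \<le> (\<Sum>i\<in>F - G. \<nu> (f i)) + (\<Sum>i\<in>G - F. \<nu> (f i))"
      by (intro add_mono \<nu>_sum f)
    also have "\<dots> < e + e"
      using that by (intro add_strict_mono F0(1)[rule_format]) auto
    finally show ?thesis by simp
  qed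
  define E where "E n = {i::'i. to_nat i < n}" for n
  have E: "finite (E n)" for n
    unfolding E_def using finite_vimageI[of "{..<n}" "to_nat :: 'i \<Rightarrow> nat"] by (simp add: vimage_def)
  have Esub: "\<exists>n0. \<forall>n\<ge>n0. F \<subseteq> E n" if "finite F" for F
  proof -
    obtain b where "\<forall>i\<in>F. to_nat i \<le> b" 
      using finite_imageI[OF \<open>finite F\<close>, of to_nat] by (force simp: finite_nat_set_iff_bounded_le)
    then have "\<forall>n\<ge>Suc b. F \<subseteq> E n" by (fastforce simp: E_def)
    then show ?thesis ..
  qed
  have "\<exists>L\<in>R. \<forall>e>0. \<exists>N. \<forall>n\<ge>N. \<nu> (sum f (E n) - L) < e"
  proof (rule complete)
    show "\<forall>e>0. \<exists>N. \<forall>m\<ge>N. \<forall>n\<ge>N. \<nu> (sum f (E m) - sum f (E n)) < e"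
    proof (intro allI impI)
      fix e :: real assume "e > 0"
      then obtain F0 where F0: "finite F0" "\<forall>G. finite G \<longrightarrow> G \<inter> F0 = {} \<longrightarrow> (\<Sum>i\<in>G. \<nu> (f i)) < e / 2"
        using tail[of "e / 2"] by auto
      obtain n0 where "\<forall>n\<ge>n0. F0 \<subseteq> E n" using Esub[OF F0(1)] by blast
      then show "\<exists>N. \<forall>m\<ge>N. \<forall>n\<ge>N. \<nu> (sum f (E m) - sum f (E n)) < e"
        using small[OF F0(2)] E by (intro exI[of _ n0]) auto
    qed
  qed (intro mem_intros f)
  then obtain S where S: "S \<in> R" "\<And>e. e > 0 \<Longrightarrow> \<exists>N. \<forall>n\<ge>N. \<nu> (sum f (E n) - S) < e" by blast
  have "sums_to f S"
    unfolding sums_to_def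
  proof (intro allI impI)
    fix e :: real assume e: "e > 0"
    then obtain F0 where F0: "finite F0" "\<forall>G. finite G \<longrightarrow> G \<inter> F0 = {} \<longrightarrow> (\<Sum>i\<in>G. \<nu> (f i)) < e / 4"
      using tail[of "e / 4"] by auto
    obtain n0 where n0: "\<forall>n\<ge>n0. F0 \<subseteq> E n" using Esub[OF F0(1)] by blast
    obtain n1 where n1: "\<forall>n\<ge>n1. \<nu> (sum f (E n) - S) < e / 2" using S(2)[of "e / 2"] e by auto
    have "\<nu> (sum f F - S) < e" if F: "finite F" "F0 \<subseteq> F" for F
    proof -
      have "\<nu> (sum f F - S) \<le> \<nu> (sum f F - sum f (E (max n0 n1))) + \<nu> (sum f (E (max n0 n1)) - S)"
        by (intro \<nu>_triangle mem_intros f S)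
      also have "\<dots> < 2 * (e / 4) + e / 2"
        using n0 n1 F E by (intro add_strict_mono small[OF F0(2)]) auto
      finally show ?thesis by simp
    qed
    then show "\<exists>F0. finite F0 \<and> (\<forall>F. finite F \<longrightarrow> F0 \<subseteq> F \<longrightarrow> \<nu> (sum f F - S) < e)" using F0(1) by blast
  qed
  with S(1) show ?thesis by (rule that)
qed

section \<open>Operations on unordered sums\<close>

lemma sums_to_scaleI:
  assumes "sums_to f S" "0 \<le> C" "\<And>F. \<nu> (sum g F - T) \<le> C * \<nu> (sum f F - S)"
  shows "sums_to g T"
  unfolding sums_to_def
proof (intro allI impI)
  fix e :: real assume e: "e > 0"
  obtain F0 where F0: "finite F0" "\<And>F. finite F \<Longrightarrow> F0 \<subseteq> F \<Longrightarrow> \<nu> (sum f F - S) < e / (C + 1)"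
    using sums_toD[OF assms(1), of "e / (C + 1)"] e assms(2) by auto
  have "\<nu> (sum g F - T) < e" if F: "finite F" "F0 \<subseteq> F" for F
  proof -
    have "\<nu> (sum g F - T) \<le> C * \<nu> (sum f F - S)" by (rule assms(3))
    also have "\<dots> \<le> C * (e / (C + 1))" using F0(2)[OF F] assms(2) by (intro mult_left_mono) auto
    also have "\<dots> < e" using e assms(2) by (simp add: field_simps)
    finally show ?thesis .
  qed
  then show "\<exists>F0. finite F0 \<and> (\<forall>F. finite F \<longrightarrow> F0 \<subseteq> F \<longrightarrow> \<nu> (sum g F - T) < e)" using F0(1) by blast
qed

lemma sums_to_mult_left:
  assumes "\<And>i. f i \<in> R" "S \<in> R" "x \<in> R" "sums_to f S"
  shows "sums_to (\<lambda>i. x * f i) (x * S)"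
  by (rule sums_to_scaleI[OF assms(4) \<nu>_nonneg[OF assms(3)]])
    (simp add: sum_distrib_left[symmetric] right_diff_distrib[symmetric] \<nu>_mult mem_intros assms)

lemma sums_to_mult_right:
  assumes "\<And>i. f i \<in> R" "S \<in> R" "x \<in> R" "sums_to f S"
  shows "sums_to (\<lambda>i. f i * x) (S * x)"
proof (rule sums_to_scaleI[OF assms(4) \<nu>_nonneg[OF assms(3)]])
  fix F
  show "\<nu> ((\<Sum>i\<in>F. f i * x) - S * x) \<le> \<nu> x * \<nu> (sum f F - S)"
    using \<nu>_mult[of "sum f F - S" x] assms
    by (simp add: sum_distrib_right[symmetric] left_diff_distrib[symmetric] mem_intros mult.commute)
qed

lemma sums_to_add:
  assumes mem: "\<And>i. f i \<in> R" "S \<in> R" "\<And>i. g i \<in> R" "T \<in> R" and f: "sums_to f S" and g: "sums_to g T"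
  shows "sums_to (\<lambda>i. f i + g i) (S + T)"
  unfolding sums_to_def
proof (intro allI impI)
  fix e :: real assume "e > 0"
  then have e: "e / 2 > 0" by simp
  obtain F where F: "finite F" "\<And>G. finite G \<Longrightarrow> F \<subseteq> G \<Longrightarrow> \<nu> (sum f G - S) < e / 2"
    using sums_toD[OF f e] by blast
  obtain F' where F': "finite F'" "\<And>G. finite G \<Longrightarrow> F' \<subseteq> G \<Longrightarrow> \<nu> (sum g G - T) < e / 2"
    using sums_toD[OF g e] by blast
  have "\<nu> ((\<Sum>i\<in>G. f i + g i) - (S + T)) < e" if G: "finite G" "F \<union> F' \<subseteq> G" for G
  proof -
    have "(\<Sum>i\<in>G. f i + g i) - (S + T) = (sum f G - S) + (sum g G - T)"
      by (simp add: sum.distrib algebra_simps)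
    also have "\<nu> \<dots> \<le> \<nu> (sum f G - S) + \<nu> (sum g G - T)"
      by (intro \<nu>_add mem_intros mem)
    finally have "\<nu> ((\<Sum>i\<in>G. f i + g i) - (S + T)) \<le> \<nu> (sum f G - S) + \<nu> (sum g G - T)" .
    also have "\<dots> < e / 2 + e / 2" using F(2)[of G] F'(2)[of G] G by (intro add_strict_mono) auto
    finally show ?thesis by simp
  qed
  then show "\<exists>F0. finite F0 \<and> (\<forall>G. finite G \<longrightarrow> F0 \<subseteq> G \<longrightarrow> \<nu> ((\<Sum>i\<in>G. f i + g i) - (S + T)) < e)"
    using F(1) F'(1) by (intro exI[of _ "F \<union> F'"]) auto
qed

lemma sums_to_finite_support:
  assumes "finite F0" "\<And>i. i \<notin> F0 \<Longrightarrow> f i = 0"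
  shows "sums_to f (sum f F0)"
  unfolding sums_to_def
proof (intro allI impI exI[of _ F0] conjI)
  fix e :: real and F assume "e > 0" "finite F" "F0 \<subseteq> F"
  then have "sum f F = sum f F0" using assms by (intro sum.mono_neutral_right) auto
  then show "\<nu> (sum f F - sum f F0) < e" using \<open>e > 0\<close> by simp
qed (rule assms)

lemma sums_to_sum:
  assumes "finite J" "\<And>j i. f j i \<in> R" "\<And>j. S j \<in> R" "\<And>j. j \<in> J \<Longrightarrow> sums_to (f j) (S j)"
  shows "sums_to (\<lambda>i. \<Sum>j\<in>J. f j i) (\<Sum>j\<in>J. S j)"
  using assms(1,4)
proof (induction J)
  case empty
  show ?case using sums_to_finite_support[of "{}" "\<lambda>_. 0"] by simp
next
  case (insert j J)
  then show ?case by (simp add: sums_to_add assms mem_intros)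
qed

lemma sums_to_reindex:
  assumes b: "bij h" and f: "sums_to f S"
  shows "sums_to (\<lambda>i. f (h i)) S"
  unfolding sums_to_def
proof (intro allI impI)
  fix e :: real assume "e > 0"
  then obtain F0 where F0: "finite F0" "\<And>F. finite F \<Longrightarrow> F0 \<subseteq> F \<Longrightarrow> \<nu> (sum f F - S) < e"
    using sums_toD[OF f] by blast
  have inj: "inj h" and surj: "surj h" using b by (auto simp: bij_def)
  have "\<nu> ((\<Sum>i\<in>F. f (h i)) - S) < e" if F: "finite F" "h -` F0 \<subseteq> F" for F
  proof -
    have "F0 \<subseteq> h ` F"
    proof
      fix y assume "y \<in> F0"
      moreover obtain x where "y = h x" using surj by (rule surjE)
      ultimately show "y \<in> h ` F" using F by auto
    qed
    then have "\<nu> (sum f (h ` F) - S) < e" using F by (intro F0) auto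
    then show ?thesis using inj by (simp add: sum.reindex inj_on_subset[OF inj])
  qed
  then show "\<exists>F0. finite F0 \<and> (\<forall>F. finite F \<longrightarrow> F0 \<subseteq> F \<longrightarrow> \<nu> ((\<Sum>i\<in>F. f (h i)) - S) < e)"
    using finite_vimageI[OF F0(1) inj] by blast
qed

lemma sums_to_norm_le:
  assumes f: "\<And>i. f i \<in> R" "S \<in> R" "sums_to f S" and bd: "\<And>F. finite F \<Longrightarrow> (\<Sum>i\<in>F. \<nu> (f i)) \<le> B"
  shows "\<nu> S \<le> B"
proof (rule field_le_epsilon)
  fix e :: real assume "e > 0"
  then obtain F where F: "finite F" "\<nu> (sum f F - S) < e"
    using f(3) unfolding sums_to_def by (meson order_refl)
  have s: "sum f F \<in> R" by (intro mem_intros f)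
  have "\<nu> S \<le> \<nu> (sum f F) + \<nu> (S - sum f F)"
    using \<nu>_add[of "sum f F" "S - sum f F"] s f by (simp add: mem_intros)
  also have "\<nu> (sum f F) \<le> B" using \<nu>_sum[of F f] bd[OF F(1)] f by force
  also have "\<nu> (S - sum f F) \<le> e" using F(2) \<nu>_diff_commute[OF f(2) s] by simp
  finally show "\<nu> S \<le> B + e" by simp
qed

lemma sums_to_commute:
  assumes "\<And>i. f i \<in> R" "S \<in> R" "sums_to f S" "z \<in> R" "\<And>i. z * f i = f i * z"
  shows "z * S = S * z"
proof (rule sums_to_unique)
  show "sums_to (\<lambda>i. z * f i) (z * S)" by (intro sums_to_mult_left assms)
  show "sums_to (\<lambda>i. z * f i) (S * z)"
    unfolding assms(5) by (intro sums_to_mult_right assms)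
qed (intro mem_intros assms)+

text \<open>Only the powers of \<open>y\<close> applied to \<open>z\<close> have to decay, so
  \<open>S\<close> acts as (1-y)^(-1) z even where \<open>1 - y\<close> is not invertible. The
  commutation clause later turns a right inverse into a two-sided one.\<close>

lemma neumann:
  assumes mem: "y \<in> R" "z \<in> R" and bd: "\<And>n. \<nu> (y ^ n * z) \<le> M * \<rho> ^ n" and \<rho>: "0 \<le> \<rho>" "\<rho> < 1"
  obtains S where "S \<in> R" "(1 - y) * S = z"
    "\<And>w. w \<in> R \<Longrightarrow> w * y = y * w \<Longrightarrow> w * z = z * w \<Longrightarrow> w * S = S * w"
proof -
  define f where "f n = y ^ n * z" for n :: nat
  have f: "f n \<in> R" for n by (simp add: f_def mem_intros mem)
  have M: "0 \<le> M" using bd[of 0] \<nu>_nonneg[of z] mem by simp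
  have sm: "summable (\<lambda>n. M * \<rho> ^ n)" using \<rho> by (intro summable_mult summable_geometric) auto
  have "(\<Sum>i\<in>F. \<nu> (f i)) \<le> (\<Sum>n. M * \<rho> ^ n)" if "finite F" for F
  proof -
    have "(\<Sum>i\<in>F. \<nu> (f i)) \<le> (\<Sum>i\<in>F. M * \<rho> ^ i)" by (intro sum_mono) (simp add: f_def bd)
    also have "\<dots> \<le> (\<Sum>n. M * \<rho> ^ n)" using sm that M \<rho> by (intro sum_le_suminf) auto
    finally show ?thesis .
  qed
  then obtain S where S: "S \<in> R" "sums_to f S" using sums_to_exists[of f] f by blast
  have "(1 - y) * S = z"
  proof (rule eqI_small)
    fix e :: real assume e: "e > 0"
    define D where "D = \<nu> (1 - y) + 1"
    have D: "1 \<le> D" using mem by (simp add: D_def \<nu>_nonneg mem_intros)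
    obtain F0 where F0: "finite F0" "\<And>F. finite F \<Longrightarrow> F0 \<subseteq> F \<Longrightarrow> \<nu> (sum f F - S) < e / (2 * D)"
      using sums_toD[OF S(2), of "e / (2 * D)"] e D by auto
    obtain n1 where n1: "F0 \<subseteq> {..<n1}" using F0(1) finite_nat_iff_bounded by blast
    have "(\<lambda>n. M * \<rho> ^ n) \<longlonglongrightarrow> M * 0" using \<rho> by (intro tendsto_intros LIMSEQ_realpow_zero)
    then have "\<forall>\<^sub>F n in sequentially. M * \<rho> ^ n < e / 2" using e by (intro order_tendstoD(2)) auto
    then obtain n2 where n2: "\<And>n. n \<ge> n2 \<Longrightarrow> M * \<rho> ^ n < e / 2" by (auto simp: eventually_sequentially)
    define n where "n = max n1 n2"
    let ?s = "sum f {..<n}"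
    have s: "?s \<in> R" by (intro mem_intros f)
    have tel: "(1 - y) * ?s = z - f n"
    proof (induction n)
      case (Suc n)
      then show ?case
        by (simp only: sum.lessThan_Suc distrib_left) (simp add: f_def left_diff_distrib mult.assoc)
    qed (simp add: f_def)
    have "(1 - y) * S - z = (1 - y) * (S - ?s) - f n"
      using tel by (simp add: right_diff_distrib)
    then have "\<nu> ((1 - y) * S - z) \<le> \<nu> ((1 - y) * (S - ?s)) + \<nu> (f n)"
      using \<nu>_diff[of "(1 - y) * (S - ?s)" "f n"] by (simp add: mem_intros mem S s f)
    also have "\<nu> ((1 - y) * (S - ?s)) \<le> \<nu> (1 - y) * \<nu> (S - ?s)"
      by (intro \<nu>_mult mem_intros mem S s one_mem)
    also have "\<dots> \<le> D * (e / (2 * D))"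
    proof (rule mult_mono)
      have "F0 \<subseteq> {..<n}" using n1 by (auto simp: n_def)
      then show "\<nu> (S - ?s) \<le> e / (2 * D)"
        using F0(2)[of "{..<n}"] \<nu>_diff_commute[OF S(1) s] by simp
      show "0 \<le> \<nu> (S - ?s)" by (intro \<nu>_nonneg diff_mem S s)
    qed (use D in \<open>auto simp: D_def\<close>)
    also have "\<dots> = e / 2" using D by simp
    also have "\<nu> (f n) \<le> e / 2" using bd[of n] n2[of n] by (simp add: f_def n_def)
    finally show "\<nu> ((1 - y) * S - z) \<le> e" by simp
  qed (intro mem_intros mem S one_mem)+
  then show ?thesis
  proof (rule that[OF S(1)])
    fix w assume w: "w \<in> R" "w * y = y * w" "w * z = z * w"
    have "w * f i = f i * w" for i
    proof -
      have "w * f i = (y ^ i * w) * z"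
        using power_commuting_commutes[of y w i] w(2) by (simp add: f_def mult.assoc)
      then show ?thesis using w(3) by (simp add: f_def mult.assoc)
    qed
    then show "w * S = S * w" by (intro sums_to_commute[OF f S] w)
  qed
qed

end

section \<open>Spectral partitions of unity\<close>

lemma (in banach_subring) sc_left_commute: "x * (sc a * y) = sc a * (x * y)"
  using sc_commute[of a x] by (simp add: mult.assoc[symmetric])

lemma (in banach_subring) sc_mult_power: "(sc a * x) ^ n = sc (a ^ n) * x ^ n"
proof (induction n)
  case (Suc n)
  have "(sc a * x) ^ Suc n = sc a * (x * (sc (a ^ n) * x ^ n))" by (simp add: Suc mult.assoc)
  also have "\<dots> = sc (a ^ Suc n) * x ^ Suc n"
    by (simp only: sc_left_commute[of x]) (simp add: sc_mult mult.assoc)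
  finally show ?case .
qed simp

text \<open>Multiplication by \<open>u\<close> shifts coefficients, so the product of (u - 1)^n with
  the series has the n-th backward differences of \<open>c\<close> as coefficients. The last
  estimate says that \<open>T\<close> is located within \<epsilon> of the value 1 of
  \<open>u\<close>.\<close>

lemma (in banach_subring) localized_element:
  fixes c :: "int \<Rightarrow> real"
  assumes mem: "u \<in> R" "v \<in> R" and uv: "u * v = 1"
    and g: "\<And>m. \<nu> (zpow u v m) \<le> exp (K * \<bar>of_int m\<bar> powr \<gamma>)"
    and bd: "\<And>n F. finite F \<Longrightarrow>
      (\<Sum>m\<in>F. \<bar>backward_difference n c m\<bar> * exp (K * \<bar>of_int m\<bar> powr \<gamma>)) \<le> M * \<epsilon> ^ n"
  obtains T where "T \<in> R" "sums_to (\<lambda>m. sc (of_real (c m)) * zpow u v m) T"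
    "\<And>n. \<nu> ((u - 1) ^ n * T) \<le> M * \<epsilon> ^ n"
proof -
  define f where "f n m = sc (of_real (backward_difference n c m)) * zpow u v m" for n m
  have f: "f n m \<in> R" for n m by (simp add: f_def mem_intros mem)
  have f0: "f 0 = (\<lambda>m. sc (of_real (c m)) * zpow u v m)"
    by (simp add: f_def backward_difference_def fun_eq_iff)
  have fbd: "(\<Sum>m\<in>F. \<nu> (f n m)) \<le> M * \<epsilon> ^ n" if "finite F" for n F
  proof -
    have "\<nu> (f n m) \<le> \<bar>backward_difference n c m\<bar> * exp (K * \<bar>of_int m\<bar> powr \<gamma>)" for m
    proof -
      have "\<nu> (f n m) \<le> cmod (of_real (backward_difference n c m)) * \<nu> (zpow u v m)"
        unfolding f_def by (intro \<nu>_sc_mult_le mem_intros mem)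
      also have "\<dots> \<le> \<bar>backward_difference n c m\<bar> * exp (K * \<bar>of_int m\<bar> powr \<gamma>)"
        by (simp add: g mult_left_mono)
      finally show ?thesis .
    qed
    then have "(\<Sum>m\<in>F. \<nu> (f n m)) \<le>
        (\<Sum>m\<in>F. \<bar>backward_difference n c m\<bar> * exp (K * \<bar>of_int m\<bar> powr \<gamma>))"
      by (intro sum_mono)
    also have "\<dots> \<le> M * \<epsilon> ^ n" by (rule bd[OF that])
    finally show ?thesis .
  qed
  obtain T where T: "T \<in> R" "sums_to (f 0) T"
    using sums_to_exists[OF f fbd, of 0] by blast
  have shift: "sums_to (\<lambda>m. sc (of_real (c (m - int i))) * zpow u v m) (u ^ i * T)" for i
  proof -
    have "sums_to (\<lambda>m. u ^ i * f 0 m) (u ^ i * T)"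
      by (intro sums_to_mult_left f T mem_intros mem)
    moreover have "u ^ i * f 0 m = sc (of_real (c m)) * zpow u v (m + int i)" for m
      unfolding f0 zpow_add_nat[OF uv] by (rule sc_left_commute)
    ultimately have 1: "sums_to (\<lambda>m. sc (of_real (c m)) * zpow u v (m + int i)) (u ^ i * T)" by simp
    have "bij (\<lambda>m. m - int i)"
      by (rule bij_betw_byWitness[of _ "\<lambda>m. m + int i"]) auto
    from sums_to_reindex[OF this 1] show ?thesis by simp
  qed
  have "\<nu> ((u - 1) ^ n * T) \<le> M * \<epsilon> ^ n" for n
  proof (rule sums_to_norm_le[OF f _ _ fbd])
    define d where "d i = complex_of_real ((-1) ^ (n - i) * real (n choose i))" for i
    have "sums_to (\<lambda>m. \<Sum>i\<le>n. sc (d i) * (sc (of_real (c (m - int i))) * zpow u v m))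
        (\<Sum>i\<le>n. sc (d i) * (u ^ i * T))"
      by (intro sums_to_sum sums_to_mult_left shift mem_intros mem T sc_mem finite_atMost)
    moreover have "(\<Sum>i\<le>n. sc (d i) * (sc (of_real (c (m - int i))) * zpow u v m)) = f n m" for m
      unfolding f_def backward_difference_def of_real_sum sc_sum sum_distrib_right
      by (intro sum.cong) (simp_all add: d_def sc_mult mult.assoc)
    moreover have "(\<Sum>i\<le>n. sc (d i) * (u ^ i * T)) = (u - 1) ^ n * T"
    proof -
      have "sc (d i) * (u ^ i * T) = of_nat (n choose i) * u ^ i * (- 1) ^ (n - i) * T" for i
      proof -
        have "sc (d i) = sc ((- 1) ^ (n - i)) * sc (of_nat (n choose i))"
          by (simp add: d_def sc_mult)
        also have "\<dots> = (- 1) ^ (n - i) * of_nat (n choose i)"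
          by (simp only: sc_power sc_of_nat sc_minus sc_1)
        finally show ?thesis by (cases "even (n - i)") (auto simp: mult.assoc)
      qed
      then show ?thesis
        using binomial_commuting[of u "-1" n] by (simp add: sum_distrib_right)
    qed
    ultimately show "sums_to (f n) ((u - 1) ^ n * T)" by simp
    show "(u - 1) ^ n * T \<in> R" by (intro mem_intros mem T one_mem)
  qed
  with T show ?thesis unfolding f0 by (intro that)
qed

lemma sum_cis_roots_of_unity:
  fixes N :: nat and m :: int
  assumes "0 < N" "\<not> int N dvd m"
  shows "(\<Sum>j<N. cis (- (2 * pi * real j / real N * of_int m))) = 0"
proof -
  define w where "w = cis (- (2 * pi * of_int m / real N))"
  have "w \<noteq> 1"
  proof
    assume "w = 1"
    then obtain k :: int where "- (2 * pi * of_int m / real N) = of_int (2 * k) * pi"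
      by (auto simp: w_def cis_conv_exp exp_eq_1)
    then have "pi * of_int m = pi * (of_int (- k) * real N)"
      using assms by (simp add: field_simps)
    then have "real_of_int m = of_int (- k) * real N" by (rule mult_left_cancel[THEN iffD1, rotated]) simp
    then have "real_of_int m = of_int (- k * int N)" by simp
    then have "m = - k * int N" by (simp only: of_int_eq_iff)
    then show False using assms by simp
  qed
  moreover have "w ^ N = 1"
  proof -
    have "w ^ N = cis (2 * pi * of_int (- m))"
      using assms by (simp add: w_def Complex.DeMoivre)
    then show ?thesis by (metis Ints_of_int cis_multiple_2pi)
  qed
  ultimately have "(\<Sum>j<N. w ^ j) = 0"
    using geometric_sum[of w N] by simp
  moreover have "w ^ j = cis (- (2 * pi * real j / real N * of_int m))" for j
    by (simp add: w_def Complex.DeMoivre field_simps)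
  ultimately show ?thesis by simp
qed

lemma (in banach_subring) zpow_sc_mult:
  "zpow (sc (cis (- t)) * u) (sc (cis t) * v) m = sc (cis (- (t * of_int m))) * zpow u v m"
  by (simp add: zpow_def sc_mult_power Complex.DeMoivre mult.commute)

text \<open>Rotating \<open>u\<close> by the N-th roots of unity moves the localized element around
  the circle; unimodular factors leave the growth bound untouched. In the sum of the rotated series
  the coefficient at \<open>m\<close> cancels unless \<open>N\<close> divides \<open>m\<close>, and
  there \<open>c\<close> vanishes except at 0. The sum is therefore the constant \<open>N\<close>,
  by which the pieces are divided.\<close>

lemma (in banach_subring) spectral_partition:
  assumes mem: "u \<in> R" "v \<in> R" and uv: "u * v = 1"
    and K: "0 \<le> K" and \<gamma>: "0 < \<gamma>" "\<gamma> < 1"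
    and g: "\<And>m. \<nu> (zpow u v m) \<le> exp (K * \<bar>of_int m\<bar> powr \<gamma>)" and \<epsilon>: "0 < \<epsilon>"
  obtains N :: nat and P :: "nat \<Rightarrow> 'r" and \<zeta> :: "nat \<Rightarrow> complex" and M :: real
  where "0 \<le> M" "\<And>j. P j \<in> R" "(\<Sum>j<N. P j) = 1"
    "\<And>j n. \<nu> ((u - sc (\<zeta> j)) ^ n * P j) \<le> M * \<epsilon> ^ n"
    "\<And>j z. z \<in> R \<Longrightarrow> z * u = u * z \<Longrightarrow> z * v = v * z \<Longrightarrow> z * P j = P j * z"
proof -
  obtain N c M where c: "0 < N" "c 0 = 1" "\<And>m. int N dvd m \<Longrightarrow> m \<noteq> 0 \<Longrightarrow> c m = 0" "0 \<le> M"
    "\<And>n F. finite F \<Longrightarrow>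
      (\<Sum>m\<in>F. \<bar>backward_difference n c m\<bar> * exp (K * \<bar>of_int m\<bar> powr \<gamma>)) \<le> M * \<epsilon> ^ n"
    using localizing_sequence[OF K \<gamma> \<epsilon>] by blast
  define t where "t j = 2 * pi * real j / real N" for j
  define f where "f j m = sc (of_real (c m)) * (sc (cis (- (t j * of_int m))) * zpow u v m)" for j m
  have f: "f j m \<in> R" for j m by (simp add: f_def mem_intros mem)
  have "\<exists>T. T \<in> R \<and> sums_to (f j) T \<and> (\<forall>n. \<nu> ((sc (cis (- t j)) * u - 1) ^ n * T) \<le> M * \<epsilon> ^ n)" for j
  proof -
    have 1: "(sc (cis (- t j)) * u) * (sc (cis (t j)) * v) = 1"
    proof -
      have "(sc (cis (- t j)) * u) * (sc (cis (t j)) * v) = sc (cis (- t j)) * (sc (cis (t j)) * (u * v))"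
        by (simp only: mult.assoc sc_left_commute[of u])
      also have "\<dots> = 1" by (simp add: uv sc_mult[symmetric] cis_mult)
      finally show ?thesis .
    qed
    have 2: "\<nu> (zpow (sc (cis (- t j)) * u) (sc (cis (t j)) * v) m) \<le> exp (K * \<bar>of_int m\<bar> powr \<gamma>)" for m
      unfolding zpow_sc_mult
      using order_trans[OF \<nu>_sc_mult_le[OF zpow_mem[OF mem], of "cis (- (t j * of_int m))" m] _] g[of m]
      by simp
    show ?thesis
    proof (rule localized_element[OF mult_mem[OF sc_mem mem(1)] mult_mem[OF sc_mem mem(2)] 1 2 c(5)])
      fix T
      assume "T \<in> R" and "\<And>n. \<nu> ((sc (cis (- t j)) * u - 1) ^ n * T) \<le> M * \<epsilon> ^ n"
        and "sums_to (\<lambda>m. sc (of_real (c m)) * zpow (sc (cis (- t j)) * u) (sc (cis (t j)) * v) m) T"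
      then show ?thesis by (auto simp: zpow_sc_mult f_def[abs_def])
    qed
  qed
  then obtain T where T: "\<And>j. T j \<in> R" "\<And>j. sums_to (f j) (T j)"
    "\<And>j n. \<nu> ((sc (cis (- t j)) * u - 1) ^ n * T j) \<le> M * \<epsilon> ^ n"
    by metis
  have sum: "(\<Sum>j<N. T j) = sc (of_nat N)"
  proof (rule sums_to_unique)
    show "sums_to (\<lambda>m. \<Sum>j<N. f j m) (\<Sum>j<N. T j)"
      by (intro sums_to_sum f T finite_lessThan)
    have zero: "(\<Sum>j<N. f j m) = 0" if "m \<noteq> 0" for m
    proof (cases "int N dvd m")
      case True
      then show ?thesis using c(3) that by (simp add: f_def)
    next
      case False
      have "(\<Sum>j<N. f j m) = sc (of_real (c m)) * (sc (\<Sum>j<N. cis (- (t j * of_int m))) * zpow u v m)"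
        by (simp add: f_def sc_sum sum_distrib_left sum_distrib_right)
      then show ?thesis using sum_cis_roots_of_unity[OF c(1) False] by (simp add: t_def)
    qed
    have "sums_to (\<lambda>m. \<Sum>j<N. f j m) (\<Sum>m\<in>{0}. \<Sum>j<N. f j m)"
      by (rule sums_to_finite_support) (use zero in auto)
    moreover have "(\<Sum>m\<in>{0}. \<Sum>j<N. f j m) = sc (of_nat N)"
      by (simp add: f_def c(2) sc_of_nat)
    ultimately show "sums_to (\<lambda>m. \<Sum>j<N. f j m) (sc (of_nat N))" by simp
  qed (intro mem_intros f T sc_mem)+
  define P where "P j = sc (1 / of_nat N) * T j" for j
  show ?thesis
  proof (rule that[of M P N "\<lambda>j. cis (t j)"])
    show "0 \<le> M" by (rule c(4))
    show P: "P j \<in> R" for j by (simp add: P_def mem_intros T)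
    show "(\<Sum>j<N. P j) = 1"
      using c(1) by (simp add: P_def sum_distrib_left[symmetric] sum sc_mult[symmetric])
    show "z * P j = P j * z" if z: "z \<in> R" "z * u = u * z" "z * v = v * z" for z j
    proof -
      have zz: "z * zpow u v m = zpow u v m * z" for m
        using power_commuting_commutes[of u z] power_commuting_commutes[of v z] z
        by (auto simp: zpow_def)
      have "z * T j = T j * z"
      proof (rule sums_to_commute[OF f T(1,2) z(1)])
        fix m show "z * f j m = f j m * z"
          by (simp only: f_def sc_left_commute[of z] zz mult.assoc)
      qed
      then show ?thesis by (simp only: P_def sc_left_commute[of z] mult.assoc)
    qed
    show "\<nu> ((u - sc (cis (t j))) ^ n * P j) \<le> M * \<epsilon> ^ n" for j n
    proof -
      have e: "u - sc (cis (t j)) = sc (cis (t j)) * (sc (cis (- t j)) * u - 1)"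
        by (simp add: right_diff_distrib mult.assoc[symmetric] sc_mult[symmetric] cis_mult)
      have "(u - sc (cis (t j))) ^ n * P j
          = sc (cis (t j) ^ n) * (sc (1 / of_nat N) * ((sc (cis (- t j)) * u - 1) ^ n * T j))"
        unfolding e P_def sc_mult_power mult.assoc
        by (simp only: sc_left_commute[of "(sc (cis (- t j)) * u - 1) ^ n"])
      also have "\<nu> \<dots> \<le> cmod (cis (t j) ^ n) * \<nu> (sc (1 / of_nat N) * ((sc (cis (- t j)) * u - 1) ^ n * T j))"
        by (intro \<nu>_sc_mult_le mem_intros mem T sc_mem one_mem)
      also have "\<dots> = \<nu> (sc (1 / of_nat N) * ((sc (cis (- t j)) * u - 1) ^ n * T j))"
        by (simp add: norm_power)
      also have "\<dots> \<le> cmod (1 / of_nat N) * \<nu> ((sc (cis (- t j)) * u - 1) ^ n * T j)"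
        by (intro \<nu>_sc_mult_le mem_intros mem T sc_mem one_mem)
      also have "\<dots> \<le> 1 * \<nu> ((sc (cis (- t j)) * u - 1) ^ n * T j)"
        using c(1) by (intro mult_right_mono \<nu>_nonneg mem_intros mem T sc_mem one_mem) (simp add: norm_divide)
      also have "\<dots> \<le> M * \<epsilon> ^ n" using T(3) by simp
      finally show ?thesis .
    qed
  qed
qed

text \<open>Induction with n = k m + r. If ln(w i) \<le> K i^\<gamma> for i < n, then the
  alternatives w(m)^p and w(i m), i < k, are all bounded by exp(K \<theta> m^\<gamma>), where
  \<theta> = max(p, (k-1)^\<gamma>) stays below k^\<gamma>. The gap K (k^\<gamma> - \<theta>)
  m^\<gamma> absorbs the constant \<open>D\<close> and the factor w(r).\<close>

lemma subexponential_recursion: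
  fixes w :: "nat \<Rightarrow> real" and k :: nat and p \<gamma> D :: real
  assumes k: "2 \<le> k" and \<gamma>: "0 < \<gamma>" and p: "p < real k powr \<gamma>" and p0: "0 < p"
    and w0: "w 0 = 1" and w1: "\<And>n. 1 \<le> w n" and D: "1 \<le> D"
    and sub: "\<And>m n. w (m + n) \<le> w m * w n"
    and rec: "\<And>n B. w n powr p \<le> B \<Longrightarrow> (\<And>i. i < k \<Longrightarrow> w (i * n) \<le> B) \<Longrightarrow> w (k * n) \<le> D * B"
  obtains K where "0 \<le> K" "\<And>n. w n \<le> exp (K * real n powr \<gamma>)"
proof -
  define b where "b = (\<Prod>i<k. w i)"
  have b: "w i \<le> b" if "i < k" for i
  proof -
    have "b = w i * prod w ({..<k} - {i})" unfolding b_def using that by (intro prod.remove) auto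
    moreover have "1 \<le> prod w ({..<k} - {i})" using w1 by (intro prod_ge_1) auto
    ultimately show ?thesis using w1[of i] mult_left_mono[of 1 "prod w ({..<k} - {i})" "w i"] by simp
  qed
  have b1: "1 \<le> b" using b[of 0] w0 k by simp
  define \<theta> where "\<theta> = max p (real (k - 1) powr \<gamma>)"
  have \<theta>: "p \<le> \<theta>" "real (k - 1) powr \<gamma> \<le> \<theta>" "\<theta> < real k powr \<gamma>"
    using p k \<gamma> by (auto simp: \<theta>_def intro!: powr_less_mono2)
  \<comment> \<open>The summand \<open>ln b\<close> settles the base case n < k; the other one makes
    the gap at least ln(D b) already for m = 1.\<close>
  define K where "K = ln b + ln (D * b) / (real k powr \<gamma> - \<theta>)"
  have Db: "1 \<le> D * b" using D b1 mult_mono[of 1 D 1 b] by simp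
  have lD: "0 \<le> ln (D * b)" using Db by simp
  have K: "0 \<le> K" "ln b \<le> K"
    unfolding K_def using \<theta> lD b1 by (auto intro!: add_nonneg_nonneg divide_nonneg_nonneg)
  have K2: "ln (D * b) \<le> K * (real k powr \<gamma> - \<theta>)"
  proof -
    have "ln (D * b) = ln (D * b) / (real k powr \<gamma> - \<theta>) * (real k powr \<gamma> - \<theta>)" using \<theta> by simp
    also have "\<dots> \<le> K * (real k powr \<gamma> - \<theta>)"
      unfolding K_def using \<theta> b1 by (intro mult_right_mono) auto
    finally show ?thesis .
  qed
  have "w n \<le> exp (K * real n powr \<gamma>)" for n
  proof (induction n rule: less_induct)
    case (less n)
    show ?case
    proof (cases "n < k")
      case True
      show ?thesis
      proof (cases "n = 0")
        case False
        then have "1 \<le> real n powr \<gamma>" using \<gamma> by (intro ge_one_powr_ge_zero) auto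
        then have "K * 1 \<le> K * real n powr \<gamma>" using K by (intro mult_left_mono) auto
        then have "ln b \<le> K * real n powr \<gamma>" using K by simp
        then have "b \<le> exp (K * real n powr \<gamma>)" 
          using b1 by (metis exp_le_cancel_iff exp_ln less_le_trans zero_less_one)
        then show ?thesis using b[OF True] by simp
      qed (simp add: w0)
    next
      case False
      define m where "m = n div k"
      define r where "r = n mod k"
      have n: "n = k * m + r" "r < k" using k by (auto simp: m_def r_def)
      have m: "1 \<le> m" using False k by (simp add: m_def div_greater_zero_iff Suc_le_eq)
      have m1: "1 \<le> real m powr \<gamma>" using m \<gamma> by (intro ge_one_powr_ge_zero) auto
      have lt: "i * m < n" if "i < k" for i
        using that m n by (metis less_le_trans le_add1 mult_less_mono1 less_le_trans zero_less_one)
      define B where "B = exp (K * \<theta> * real m powr \<gamma>)"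
      have "w (k * m) \<le> D * B"
      proof (rule rec)
        have "w m \<le> exp (K * real m powr \<gamma>)" using less[of m] lt[of 1] k by simp
        then have "w m powr p \<le> exp (K * real m powr \<gamma>) powr p"
          using p0 w1[of m] by (intro powr_mono2) auto
        also have "\<dots> = exp (K * real m powr \<gamma> * p)" by (simp add: exp_powr_real)
        also have "\<dots> \<le> B"
          unfolding B_def using \<theta>(1) K mult_left_mono[of p \<theta> "K * real m powr \<gamma>"]
          by (simp add: mult_ac)
        finally show "w m powr p \<le> B" .
        fix i assume i: "i < k"
        have "w (i * m) \<le> exp (K * real (i * m) powr \<gamma>)" by (rule less[OF lt[OF i]])
        also have "\<dots> \<le> exp (K * (\<theta> * real m powr \<gamma>))"
        proof -
          have "real (i * m) powr \<gamma> = real i powr \<gamma> * real m powr \<gamma>" by (simp add: powr_mult)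
          also have "\<dots> \<le> real (k - 1) powr \<gamma> * real m powr \<gamma>"
            using i \<gamma> by (intro mult_right_mono powr_mono2) auto
          also have "\<dots> \<le> \<theta> * real m powr \<gamma>" using \<theta> by (intro mult_right_mono) auto
          finally show ?thesis using K by (simp add: mult_left_mono)
        qed
        finally show "w (i * m) \<le> B" by (simp add: B_def mult.assoc)
      qed
      then have "w (k * m) * w r \<le> (D * B) * b"
        using b[OF n(2)] w1[of r] D by (intro mult_mono) (auto simp: B_def)
      then have "w n \<le> (D * B) * b" using sub[of "k * m" r] n by simp
      also have "\<dots> = exp (ln (D * b)) * B" using Db by simp
      also have "\<dots> \<le> exp (K * (real k powr \<gamma> - \<theta>) * real m powr \<gamma>) * B"
      proof -
        have "ln (D * b) \<le> K * (real k powr \<gamma> - \<theta>) * 1" using K2 by simp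
        also have "\<dots> \<le> K * (real k powr \<gamma> - \<theta>) * real m powr \<gamma>"
          using K \<theta> m1 by (intro mult_left_mono) auto
        finally show ?thesis unfolding B_def by (intro mult_right_mono) auto
      qed
      also have "\<dots> = exp (K * (real k powr \<gamma> * real m powr \<gamma>))"
        by (simp add: B_def mult_exp_exp algebra_simps)
      also have "\<dots> \<le> exp (K * real n powr \<gamma>)"
      proof -
        have "real k powr \<gamma> * real m powr \<gamma> = real (k * m) powr \<gamma>" by (simp add: powr_mult)
        also have "\<dots> \<le> real n powr \<gamma>" using n \<gamma> by (intro powr_mono2) auto
        finally show ?thesis using K by (simp add: mult_left_mono)
      qed
      finally show ?thesis .
    qed
  qed
  with K show ?thesis by (intro that[of K]) auto
qed

section \<open>Differential star rings\<close>

text \<open>\<open>bounded_by x r\<close> says that \<open>x\<close> has norm at most \<open>r\<close> in an ambient \<open>C\<^sup>*\<close>-algebra. The last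
  assumption is the differential inequality for \<open>x ^ n\<close>, after removal of its scalar part.\<close>
locale differential_star_ring = banach_subring R \<nu> sc
  for R :: "'r::ring_1 set" and \<nu> :: "'r \<Rightarrow> real" and sc :: "complex \<Rightarrow> 'r" +
  fixes adj :: "'r \<Rightarrow> 'r" and bounded_by :: "'r \<Rightarrow> real \<Rightarrow> bool"
    and k :: nat and p :: real and C :: real
  assumes adj_adj [simp]: "adj (adj x) = x"
    and adj_add: "adj (x + y) = adj x + adj y"
    and adj_mult: "adj (x * y) = adj y * adj x"
    and adj_sc: "adj (sc a) = sc (cnj a)"
    and adj_mem: "x \<in> R \<Longrightarrow> adj x \<in> R"
    and bounded_by_nonneg: "bounded_by x r \<Longrightarrow> 0 \<le> r"
    and bounded_by_mono: "bounded_by x r \<Longrightarrow> r \<le> s \<Longrightarrow> bounded_by x s"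
    and bounded_by_sc: "bounded_by (sc a) (cmod a)"
    and bounded_by_add: "bounded_by x r \<Longrightarrow> bounded_by y s \<Longrightarrow> bounded_by (x + y) (r + s)"
    and bounded_by_mult: "bounded_by x r \<Longrightarrow> bounded_by y s \<Longrightarrow> bounded_by (x * y) (r * s)"
    and bounded_by_adj_mult: "bounded_by (adj x * x) (r ^ 2) \<Longrightarrow> 0 \<le> r \<Longrightarrow> bounded_by x r"
    and bounded_by_ex: "\<exists>r. bounded_by x r"
    and k: "2 \<le> k" and p: "0 < p" "p < real k" and C: "0 \<le> C"
    and differential: "x \<in> R \<Longrightarrow> bounded_by x 1 \<Longrightarrow>
      \<exists>a. cmod a \<le> 1 \<and> (\<forall>n. \<nu> ((x ^ n - sc (a ^ n)) ^ k) \<le> C * \<nu> (x ^ n - sc (a ^ n)) powr p)"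
begin

text \<open>Since p < k, the number log_k p is less than 1, and any exponent strictly between it and
  1 will do when p > 1. For p \<le> 1 the value 1/2 suffices, because k > 1.\<close>

lemma growth_exponent: obtains \<gamma> where "0 < \<gamma>" "\<gamma> < 1" "p < real k powr \<gamma>"
proof (cases "p \<le> 1")
  case True
  have "1 < real k powr (1 / 2)" using k by simp
  then show ?thesis using True by (intro that[of "1 / 2"]) auto
next
  case False
  define l where "l = log (real k) p"
  have l: "0 < l" "l < 1" "real k powr l = p"
    using False k p by (auto simp: l_def)
  have "real k powr l < real k powr ((1 + l) / 2)"
    using k l by (intro powr_less_mono) auto
  then show ?thesis using l by (intro that[of "(1 + l) / 2"]) auto
qed

text \<open>The inequality controls the k-th power of y^n - a^n rather than of y^n. Expanding that
  power and solving for y^(kn) leaves the lower powers y^(in), i < k, with coefficients no larger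
  than binomial ones since |a| \<le> 1. This is the recursion solved above.\<close>

lemma subexponential_growth:
  assumes \<gamma>: "0 < \<gamma>" "p < real k powr \<gamma>" and y: "y \<in> R" "bounded_by y 1"
  obtains K where "0 \<le> K" "\<And>n. \<nu> (y ^ n) \<le> exp (K * real n powr \<gamma>)"
proof -
  obtain a where a: "cmod a \<le> 1"
    "\<And>n. \<nu> ((y ^ n - sc (a ^ n)) ^ k) \<le> C * \<nu> (y ^ n - sc (a ^ n)) powr p"
    using differential[OF y] by blast
  define w where "w n = max 1 (\<nu> (y ^ n))" for n
  \<comment> \<open>The factor 2^p comes from \<nu>(y^n - a^n) \<le> 2 w(n), and 2^k is the sum of
    the binomial coefficients.\<close>
  define D where "D = C * 2 powr p + 2 ^ k"
  have w1: "1 \<le> w n" for n by (simp add: w_def)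
  have \<nu>w: "\<nu> (y ^ n) \<le> w n" for n by (simp add: w_def)
  have D: "1 \<le> D" using C by (simp add: D_def add_increasing)
  have an: "cmod (a ^ n) \<le> 1" for n using a(1) by (simp add: norm_power power_le_one)
  have "w (k * n) \<le> D * B" if B: "w n powr p \<le> B" "\<And>i. i < k \<Longrightarrow> w (i * n) \<le> B" for n B
  proof -
    have B1: "1 \<le> B" using B(2)[of 0] w1[of 0] k by simp
    define x where "x = y ^ n"
    define z where "z = x - sc (a ^ n)"
    have x: "x \<in> R" and z: "z \<in> R" by (auto simp: x_def z_def mem_intros y)
    have "\<nu> z \<le> \<nu> x + cmod (a ^ n)"
      unfolding z_def using \<nu>_diff[OF x sc_mem] by (simp add: \<nu>_sc)
    also have "\<dots> \<le> 2 * w n" using an[of n] \<nu>w[of n] w1[of n] by (simp add: x_def)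
    finally have "\<nu> z powr p \<le> (2 * w n) powr p"
      using p \<nu>_nonneg[OF z] by (intro powr_mono2) auto
    also have "\<dots> = 2 powr p * w n powr p" using w1[of n] by (simp add: powr_mult)
    also have "\<dots> \<le> 2 powr p * B" using B(1) by (intro mult_left_mono) auto
    finally have zk: "\<nu> (z ^ k) \<le> C * (2 powr p * B)"
      using a(2)[of n] C by (fastforce simp: z_def x_def intro: order_trans mult_left_mono)
    have "z ^ k = (\<Sum>i\<le>k. of_nat (k choose i) * x ^ i * (sc (- (a ^ n))) ^ (k - i))"
      using binomial_commuting[of x "sc (- (a ^ n))" k] sc_commute[of "- (a ^ n)" x]
      by (simp add: z_def sc_minus)
    also have "\<dots> = (\<Sum>i\<le>k. sc (of_nat (k choose i) * (- (a ^ n)) ^ (k - i)) * x ^ i)"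
      by (intro sum.cong) (simp_all only: sc_mult sc_of_nat sc_power[symmetric] mult.assoc sc_commute)
    also have "\<dots> = (\<Sum>i<k. sc (of_nat (k choose i) * (- (a ^ n)) ^ (k - i)) * x ^ i) + x ^ k"
      by (simp add: lessThan_Suc_atMost[symmetric])
    finally have "x ^ k = z ^ k - (\<Sum>i<k. sc (of_nat (k choose i) * (- (a ^ n)) ^ (k - i)) * x ^ i)"
      by simp
    also have "\<nu> \<dots> \<le> \<nu> (z ^ k) + \<nu> (\<Sum>i<k. sc (of_nat (k choose i) * (- (a ^ n)) ^ (k - i)) * x ^ i)"
      by (intro \<nu>_diff mem_intros x z sc_mem)
    also have "\<nu> (\<Sum>i<k. sc (of_nat (k choose i) * (- (a ^ n)) ^ (k - i)) * x ^ i)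
        \<le> (\<Sum>i<k. \<nu> (sc (of_nat (k choose i) * (- (a ^ n)) ^ (k - i)) * x ^ i))"
      by (intro \<nu>_sum mem_intros x sc_mem)
    also have "\<dots> \<le> (\<Sum>i<k. real (k choose i) * B)"
    proof (intro sum_mono)
      fix i assume i: "i \<in> {..<k}"
      have "\<nu> (sc (of_nat (k choose i) * (- (a ^ n)) ^ (k - i)) * x ^ i)
          \<le> cmod (of_nat (k choose i) * (- (a ^ n)) ^ (k - i)) * \<nu> (x ^ i)"
        by (intro \<nu>_sc_mult_le mem_intros x)
      also have "\<dots> \<le> real (k choose i) * B"
      proof (intro mult_mono)
        have "cmod (a ^ n) ^ (k - i) \<le> 1" using an[of n] by (intro power_le_one) auto
        then show "cmod (of_nat (k choose i) * (- (a ^ n)) ^ (k - i)) \<le> real (k choose i)"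
          by (simp add: norm_mult norm_power[of "- (a ^ n)"] mult_left_le)
        show "\<nu> (x ^ i) \<le> B"
          using \<nu>w[of "i * n"] B(2)[of i] i by (simp add: x_def power_mult[symmetric] mult.commute)
      qed (auto intro!: \<nu>_nonneg mem_intros x)
      finally show "\<nu> (sc (of_nat (k choose i) * (- (a ^ n)) ^ (k - i)) * x ^ i) \<le> real (k choose i) * B" .
    qed
    also have "\<dots> \<le> (\<Sum>i\<le>k. real (k choose i) * B)"
      using B1 by (intro sum_mono2) auto
    also have "\<dots> = 2 ^ k * B"
    proof -
      have "(\<Sum>i\<le>k. real (k choose i)) = 2 ^ k"
        using choose_row_sum[of k] by (metis of_nat_numeral of_nat_power of_nat_sum)
      then show ?thesis by (simp add: sum_distrib_right[symmetric])
    qed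
    finally have "\<nu> (x ^ k) \<le> D * B" using zk by (simp add: D_def algebra_simps)
    moreover have "1 \<le> D * B" using D B1 mult_mono[of 1 D 1 B] by simp
    ultimately show ?thesis by (simp add: w_def x_def power_mult[symmetric] mult.commute)
  qed
  moreover have "w (m + n) \<le> w m * w n" for m n
  proof -
    have "\<nu> (y ^ (m + n)) \<le> \<nu> (y ^ m) * \<nu> (y ^ n)" by (rule \<nu>_power_add[OF y(1)])
    also have "\<dots> \<le> w m * w n"
      using \<nu>w w1[of m] by (intro mult_mono) (auto intro!: \<nu>_nonneg mem_intros y)
    finally show ?thesis using w1[of m] w1[of n] mult_mono[of 1 "w m" 1 "w n"] by (simp add: w_def[of "m + n"])
  qed
  moreover have "w 0 = 1" by (simp add: w_def)
  ultimately obtain K where "0 \<le> K" "\<And>n. w n \<le> exp (K * real n powr \<gamma>)"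
    using subexponential_recursion[OF k \<gamma> p(1), of w D] w1 D by blast
  then show ?thesis using \<nu>w by (intro that[of K]) (auto intro: order_trans)
qed

text \<open>Nothing is assumed about the size of \<nu>(y). After scaling \<open>y\<close> to norm at
  most 1 in the ambient algebra the powers grow subexponentially in \<open>\<nu>\<close>, so undoing
  the scaling gives geometric decay and the Neumann series converges in \<open>R\<close>.\<close>

lemma one_minus_invertible:
  assumes y: "y \<in> R" "bounded_by y r" "r < 1"
  obtains s where "s \<in> R" "(1 - y) * s = 1" "s * (1 - y) = 1"
proof -
  \<comment> \<open>The maximum keeps \<rho> positive when \<open>r\<close> is 0; any constant in
    (0, 1) would serve. Half of the decay, in the form sqrt \<rho>, is left after the subexponential
    growth has been absorbed.\<close>
  define \<rho> where "\<rho> = max r (1 / 4)"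
  have \<rho>: "0 < \<rho>" "\<rho> < 1" using y by (auto simp: \<rho>_def)
  define x where "x = sc (1 / \<rho>) * y"
  have x: "x \<in> R" by (simp add: x_def mem_intros y)
  have "bounded_by x (cmod (1 / \<rho>) * \<rho>)"
    unfolding x_def using y by (intro bounded_by_mult bounded_by_sc bounded_by_mono[OF y(2)]) (simp add: \<rho>_def)
  then have bx: "bounded_by x 1" using \<rho> by (simp add: norm_divide)
  obtain \<gamma> where \<gamma>: "0 < \<gamma>" "\<gamma> < 1" "p < real k powr \<gamma>" by (rule growth_exponent)
  obtain K where K: "\<And>n. \<nu> (x ^ n) \<le> exp (K * real n powr \<gamma>)"
    using subexponential_growth[OF \<gamma>(1,3) x bx] by blast
  have sq: "1 < 1 / sqrt \<rho>" using \<rho> by simp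
  obtain B where B: "0 \<le> B" "\<And>n::nat. real (n + 1) * exp (K * real n powr \<gamma>) \<le> B * (1 / sqrt \<rho>) ^ n"
    using subexponential_bounded[OF \<gamma>(2) sq] by blast
  have "\<nu> (y ^ n * 1) \<le> B * sqrt \<rho> ^ n" for n
  proof -
    have "y = sc \<rho> * x" using \<rho> sc_cancel[of "of_real \<rho>" y] by (simp add: x_def)
    then have "y ^ n * 1 = sc (\<rho> ^ n) * x ^ n" by (simp add: sc_mult_power)
    then have "\<nu> (y ^ n * 1) \<le> cmod (of_real (\<rho> ^ n)) * \<nu> (x ^ n)"
      using \<nu>_sc_mult_le[of "x ^ n" "of_real (\<rho> ^ n)"] x by (simp add: mem_intros)
    also have "\<dots> \<le> \<rho> ^ n * (B * (1 / sqrt \<rho>) ^ n)"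
    proof -
      have "exp (K * real n powr \<gamma>) \<le> real (n + 1) * exp (K * real n powr \<gamma>)" by simp
      then have "\<nu> (x ^ n) \<le> B * (1 / sqrt \<rho>) ^ n" using K[of n] B(2)[of n] by linarith
      then show ?thesis using \<rho> by (simp add: norm_power mult_left_mono)
    qed
    also have "\<dots> = B * (\<rho> * (1 / sqrt \<rho>)) ^ n" by (simp only: power_mult_distrib mult_ac)
    also have "\<rho> * (1 / sqrt \<rho>) = sqrt \<rho>" using \<rho> real_div_sqrt[of \<rho>] by simp
    finally show ?thesis .
  qed
  moreover have "0 \<le> sqrt \<rho>" "sqrt \<rho> < 1" using \<rho> by auto
  ultimately obtain s where s: "s \<in> R" "(1 - y) * s = 1"
    "\<And>w. w \<in> R \<Longrightarrow> w * y = y * w \<Longrightarrow> w * 1 = 1 * w \<Longrightarrow> w * s = s * w"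
    using neumann[OF y(1) one_mem] by metis
  have "s * (1 - y) = 1"
    using s(3)[of "1 - y"] s y by (simp add: mem_intros algebra_simps)
  with s show ?thesis by (intro that)
qed

section \<open>Resolvents and Cayley transforms of selfadjoint elements\<close>

lemma adj_1 [simp]: "adj 1 = 1"
  using adj_sc[of 1] by simp

lemma adj_minus: "adj (- x) = - adj x"
proof -
  have "adj (x * sc (- 1)) = sc (- 1) * adj x" by (simp only: adj_mult adj_sc) simp
  then show ?thesis by (simp only: sc_minus sc_1) simp
qed

lemma adj_diff: "adj (x - y) = adj x - adj y"
  using adj_add[of x "- y"] by (simp add: adj_minus)

lemma bounded_by_minus: "bounded_by x r \<Longrightarrow> bounded_by (- x) r"
  using bounded_by_mult[OF bounded_by_sc[of "- 1"], of x r] by (simp add: sc_minus)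

lemma bounded_by_diff: "bounded_by x r \<Longrightarrow> bounded_by y s \<Longrightarrow> bounded_by (x - y) (r + s)"
  using bounded_by_add[of x r "- y" s] bounded_by_minus[of y s] by simp

lemma bounded_by_sc_mult: "bounded_by x r \<Longrightarrow> bounded_by (sc a * x) (cmod a * r)"
  by (intro bounded_by_mult bounded_by_sc)

lemma bounded_by_1: "bounded_by 1 1"
  using bounded_by_sc[of 1] by simp

lemma bounded_by_unitary: "adj u * u = 1 \<Longrightarrow> bounded_by u 1"
  by (rule bounded_by_adj_mult) (auto simp: bounded_by_1)

text \<open>The norm of \<open>x - i t\<close> is at most \<open>sqrt (r\<^sup>2 + t\<^sup>2)\<close>, which is less than \<open>t + \<delta>\<close> for large \<open>t\<close>.\<close>
lemma selfadjoint_resolvent: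
  assumes x: "x \<in> R" "adj x = x" and \<delta>: "0 < \<delta>"
  obtains s where "s \<in> R" "(x + sc (\<i> * of_real \<delta>)) * s = 1" "s * (x + sc (\<i> * of_real \<delta>)) = 1"
proof -
  obtain r where r: "bounded_by x r" using bounded_by_ex by blast
  have r0: "0 \<le> r" using bounded_by_nonneg[OF r] .
  define t where "t = r ^ 2 / \<delta>"
  have t: "0 \<le> t" "r ^ 2 = t * \<delta>" using \<delta> by (auto simp: t_def)
  define b where "b = x - sc (\<i> * of_real t)"
  have b: "b \<in> R" by (simp add: b_def mem_intros x)
  have "adj b * b = x * x + sc (of_real (t ^ 2))"
  proof -
    have "adj b = x + sc (\<i> * of_real t)"
      by (simp add: b_def adj_diff x adj_sc sc_minus)
    then have "adj b * b = x * x + (sc (\<i> * of_real t) * x - x * sc (\<i> * of_real t))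
        - sc (\<i> * of_real t) * sc (\<i> * of_real t)"
      by (simp add: b_def algebra_simps)
    moreover have "sc (\<i> * of_real t) * sc (\<i> * of_real t) = - sc (of_real (t ^ 2))"
    proof -
      have "\<i> * of_real t * (\<i> * of_real t) = - complex_of_real (t ^ 2)"
        by (simp add: complex_eq_iff power2_eq_square)
      then show ?thesis by (simp only: sc_mult[symmetric] sc_minus[symmetric])
    qed
    ultimately show ?thesis using sc_commute[of "\<i> * of_real t" x] by simp
  qed
  moreover have "bounded_by (x * x + sc (of_real (t ^ 2))) (r * r + cmod (of_real (t ^ 2)))"
    by (intro bounded_by_add bounded_by_mult r bounded_by_sc)
  ultimately have "bounded_by (adj b * b) ((sqrt (r ^ 2 + t ^ 2)) ^ 2)"
    by (simp add: power2_eq_square norm_mult)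
  then have bb: "bounded_by b (sqrt (r ^ 2 + t ^ 2))" by (rule bounded_by_adj_mult) simp
  \<comment> \<open>With this scaling, x + i \<delta> = i (t + \<delta>) (1 - y): the resolvent
    close to the real axis is expanded around the distant point i t.\<close>
  define y where "y = sc (\<i> / of_real (t + \<delta>)) * b"
  have y: "y \<in> R" by (simp add: y_def mem_intros b)
  have by': "bounded_by y (1 / (t + \<delta>) * sqrt (r ^ 2 + t ^ 2))"
    using bounded_by_sc_mult[OF bb, of "\<i> / of_real (t + \<delta>)"] t \<delta>
    by (simp add: y_def norm_divide del: of_real_add)
  have "r ^ 2 + t ^ 2 < (t + \<delta>) ^ 2"
    using t \<delta> mult_nonneg_nonneg[of t \<delta>] mult_pos_pos[OF \<delta> \<delta>]
      add_pos_nonneg[of "\<delta> * \<delta>" "\<delta> * t"]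
    by (simp add: power2_eq_square algebra_simps)
  then have "sqrt (r ^ 2 + t ^ 2) < t + \<delta>" using t \<delta> by (intro real_less_lsqrt) auto
  then have "1 / (t + \<delta>) * sqrt (r ^ 2 + t ^ 2) < 1" using t \<delta> by (simp add: field_simps)
  from one_minus_invertible[OF y by' this]
  obtain s where s: "s \<in> R" "(1 - y) * s = 1" "s * (1 - y) = 1" by blast
  define g where "g = \<i> * complex_of_real (t + \<delta>)"
  have g: "g \<noteq> 0" using t \<delta> by (simp add: g_def del: of_real_add)
  have e: "x + sc (\<i> * of_real \<delta>) = sc g * (1 - y)"
  proof -
    have "sc g * y = sc (g * (\<i> / of_real (t + \<delta>))) * b"
      by (simp only: y_def sc_mult mult.assoc)
    also have "g * (\<i> / of_real (t + \<delta>)) = - 1"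
      using t \<delta> by (simp add: g_def del: of_real_add)
    finally have "sc g * y = - b" by (simp add: sc_minus)
    then show ?thesis
      by (simp add: right_diff_distrib b_def g_def distrib_left sc_add)
  qed
  show ?thesis
  proof (rule that[of "sc (1 / g) * s"])
    show "sc (1 / g) * s \<in> R" by (simp add: mem_intros s)
    have "sc g * (1 - y) * (sc (1 / g) * s) = sc g * (sc (1 / g) * ((1 - y) * s))"
      by (simp only: mult.assoc sc_left_commute[of "1 - y"])
    then show "(x + sc (\<i> * of_real \<delta>)) * (sc (1 / g) * s) = 1"
      using s g by (simp add: e sc_mult[symmetric])
    have "sc (1 / g) * s * (sc g * (1 - y)) = sc (1 / g) * (sc g * (s * (1 - y)))"
      by (simp only: mult.assoc sc_left_commute[of s])
    then show "(sc (1 / g) * s) * (x + sc (\<i> * of_real \<delta>)) = 1"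
      using s g by (simp add: e sc_mult[symmetric])
  qed
qed

text \<open>The two factors x + i \<delta> and x - i \<delta> are adjoint to each other and commute,
  so \<open>u\<close> is isometric and bounded by 1. The remaining bounds come from \<delta> s = (1
  - u) / (2 i) and x s = (1 + u) / 2. Either sign of \<delta> is allowed, so the lemma also applies
  to \<open>adj s\<close> with -\<delta>.\<close>

lemma cayley_transform:
  assumes x: "adj x = x" and \<delta>: "\<delta> \<noteq> 0"
    and s: "(x + sc (\<i> * of_real \<delta>)) * s = 1" "s * (x + sc (\<i> * of_real \<delta>)) = 1"
  defines "u \<equiv> (x - sc (\<i> * of_real \<delta>)) * s"
  shows "adj s * (x - sc (\<i> * of_real \<delta>)) = 1" "(x - sc (\<i> * of_real \<delta>)) * adj s = 1"
    and "u = 1 - sc (2 * \<i> * of_real \<delta>) * s" "x * s = s * x" "bounded_by u 1"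
    and "bounded_by (sc (of_real \<delta>) * s) 1" "bounded_by (x * s) 1"
proof -
  let ?d = "sc (\<i> * of_real \<delta>)"
  have ad: "adj (x + ?d) = x - ?d" by (simp add: adj_add x adj_sc sc_minus)
  show 1: "adj s * (x - ?d) = 1" "(x - ?d) * adj s = 1"
    using arg_cong[OF s(1), of adj] arg_cong[OF s(2), of adj] by (simp_all add: adj_mult ad)
  have "u = (x + ?d) * s - (?d + ?d) * s" by (simp add: u_def algebra_simps)
  then show u: "u = 1 - sc (2 * \<i> * of_real \<delta>) * s"
    by (simp add: s sc_add[symmetric] mult.assoc)
  have xs: "x * s = 1 - ?d * s" using s(1) by (simp add: algebra_simps)
  have "s * x = 1 - s * ?d" using s(2) by (simp add: algebra_simps)
  then show "x * s = s * x" using xs by (simp add: sc_commute[of _ s])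
  have comm: "(x + ?d) * (x - ?d) = (x - ?d) * (x + ?d)"
    using sc_commute[of "\<i> * of_real \<delta>" x] by (simp add: algebra_simps)
  have "adj u = adj s * (x + ?d)" by (simp add: u_def adj_mult adj_diff x adj_sc sc_minus)
  then have "adj u * u = adj s * ((x + ?d) * (x - ?d)) * s" by (simp add: u_def mult.assoc)
  also have "\<dots> = (adj s * (x - ?d)) * ((x + ?d) * s)" by (simp only: comm mult.assoc)
  also have "\<dots> = 1" by (simp add: 1 s)
  finally show bu: "bounded_by u 1" by (rule bounded_by_unitary)
  have "sc (of_real \<delta>) * s = sc (1 / (2 * \<i>)) * (1 - u)"
  proof -
    have "sc (1 / (2 * \<i>)) * (1 - u) = sc (1 / (2 * \<i>)) * (sc (2 * \<i> * of_real \<delta>) * s)"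
      by (simp add: u)
    also have "\<dots> = sc (1 / (2 * \<i>) * (2 * \<i> * of_real \<delta>)) * s"
      by (simp only: sc_mult mult.assoc)
    also have "1 / (2 * \<i>) * (2 * \<i> * of_real \<delta>) = complex_of_real \<delta>" by simp
    finally show ?thesis by simp
  qed
  moreover have "bounded_by (sc (1 / (2 * \<i>)) * (1 - u)) (cmod (1 / (2 * \<i>)) * (1 + 1))"
    by (intro bounded_by_sc_mult bounded_by_diff bounded_by_1 bu)
  ultimately show "bounded_by (sc (of_real \<delta>) * s) 1" by (simp add: norm_divide norm_mult)
  have "x * s = sc (1 / 2) * (1 + u)"
  proof -
    have "1 + u = (x + ?d) * s + (x - ?d) * s" by (simp add: s u_def)
    then have "1 + u = x * s + x * s" by (simp add: algebra_simps)
    then have "sc (1 / 2) * (1 + u) = (sc (1 / 2) + sc (1 / 2)) * (x * s)"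
      by (simp only: distrib_left distrib_right)
    then show ?thesis by (simp add: sc_add[symmetric])
  qed
  moreover have "bounded_by (sc (1 / 2) * (1 + u)) (cmod (1 / 2) * (1 + 1))"
    by (intro bounded_by_sc_mult bounded_by_add bounded_by_1 bu)
  ultimately show "bounded_by (x * s) 1" by simp
qed

end

section \<open>Approximate annihilators and local decompositions\<close>

lemma power_mult_commuting:
  fixes x y :: "'a::monoid_mult"
  assumes "x * y = y * x"
  shows "(x * y) ^ n = x ^ n * y ^ n"
proof (induction n)
  case (Suc n)
  have "(x * y) ^ Suc n = x * (y * x ^ n) * y ^ n" by (simp add: Suc mult.assoc)
  also have "y * x ^ n = x ^ n * y" using power_commuting_commutes[OF assms] by simp
  finally show ?case by (simp add: mult.assoc)
qed simp

lemma (in banach_subring) \<nu>_power: "x \<in> R \<Longrightarrow> \<nu> (x ^ n) \<le> \<nu> x ^ n"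
proof (induction n)
  case (Suc n)
  then have "\<nu> (x * x ^ n) \<le> \<nu> x * \<nu> (x ^ n)" by (intro \<nu>_mult mem_intros)
  also have "\<dots> \<le> \<nu> x * \<nu> x ^ n" using Suc by (intro mult_left_mono \<nu>_nonneg) auto
  finally show ?case by simp
qed simp

lemma inverse_commutes:
  fixes e s z :: "'a::monoid_mult"
  assumes "e * s = 1" "s * e = 1" "z * e = e * z"
  shows "z * s = s * z"
proof -
  have "z * s = s * (e * z) * s" by (simp add: mult.assoc[symmetric] assms)
  also have "\<dots> = s * z * (e * s)" by (simp only: assms(3)[symmetric] mult.assoc)
  finally show ?thesis by (simp add: assms)
qed

context differential_star_ring
begin

text \<open>The witness is \<open>c = \<delta>\<^sup>2 / (\<delta>\<^sup>2 + x\<^sup>2)\<close> with \<open>x = a a\<^sup>*\<close>.\<close>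
lemma approximate_annihilator:
  assumes a: "a \<in> R" and \<delta>: "0 < \<delta>"
  obtains c h where "c \<in> R" "h \<in> R" "bounded_by (adj a * c) (sqrt \<delta>)" "bounded_by c 1"
    "1 - c = (a * adj a) * h" "1 - c = h * (a * adj a)"
proof -
  define x where "x = a * adj a"
  have x: "x \<in> R" "adj x = x" by (auto simp: x_def mem_intros a adj_mem adj_mult)
  let ?d = "sc (\<i> * of_real \<delta>)"
  obtain s where s: "s \<in> R" "(x + ?d) * s = 1" "s * (x + ?d) = 1"
    by (rule selfadjoint_resolvent[OF x \<delta>])
  define t where "t = adj s"
  have t: "t \<in> R" by (simp add: t_def adj_mem s)
  have \<delta>0: "\<delta> \<noteq> 0" "- \<delta> \<noteq> 0" using \<delta> by auto
  note cs = cayley_transform[OF x(2) \<delta>0(1) s(2,3), folded t_def]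
  have dm: "sc (\<i> * of_real (- \<delta>)) = - ?d" by (simp add: sc_minus)
  have t': "(x + sc (\<i> * of_real (- \<delta>))) * t = 1" "t * (x + sc (\<i> * of_real (- \<delta>))) = 1"
    using cs(1,2) by (simp_all only: dm add_uminus_conv_diff)
  note ct = cayley_transform[OF x(2) \<delta>0(2) t']
  have bt: "bounded_by (sc (of_real \<delta>) * t) 1"
    using bounded_by_minus[OF ct(6)] by (simp add: sc_minus)
  have E: "(x + ?d) * (x - ?d) = (x - ?d) * (x + ?d)" "(x + ?d) * (x - ?d) = x * x + sc (of_real (\<delta> ^ 2))"
  proof -
    have "\<i> * of_real \<delta> * (\<i> * of_real \<delta>) = - complex_of_real (\<delta> ^ 2)"
      by (simp add: complex_eq_iff power2_eq_square)
    then have "?d * ?d = - sc (of_real (\<delta> ^ 2))" by (simp only: sc_mult[symmetric] sc_minus[symmetric])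
    then show "(x + ?d) * (x - ?d) = x * x + sc (of_real (\<delta> ^ 2))"
      using sc_commute[of "\<i> * of_real \<delta>" x] by (simp add: algebra_simps)
    show "(x + ?d) * (x - ?d) = (x - ?d) * (x + ?d)"
      using sc_commute[of "\<i> * of_real \<delta>" x] by (simp add: algebra_simps)
  qed
  have 1: "(x * x + sc (of_real (\<delta> ^ 2))) * (s * t) = 1"
  proof -
    have "(x - ?d) * (x + ?d) * (s * t) = (x - ?d) * ((x + ?d) * s) * t" by (simp only: mult.assoc)
    also have "\<dots> = 1" by (simp add: s cs)
    finally show ?thesis using E by simp
  qed
  define c where "c = sc (of_real (\<delta> ^ 2)) * (s * t)"
  define h where "h = x * (s * t)"
  have xst: "(s * t) * x = x * (s * t)"
    using cs(4) ct(4) by (metis mult.assoc)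
  have "1 - c = x * x * (s * t)" using 1 by (simp add: c_def distrib_right algebra_simps)
  then have h: "1 - c = x * h" "1 - c = h * x"
    using xst by (simp_all add: h_def mult.assoc)
  have c2: "c = (sc (of_real \<delta>) * s) * (sc (of_real \<delta>) * t)"
  proof -
    have "(sc (of_real \<delta>) * s) * (sc (of_real \<delta>) * t) = sc (of_real \<delta>) * (sc (of_real \<delta>) * (s * t))"
      by (simp only: mult.assoc sc_left_commute[of s])
    then show ?thesis by (simp add: c_def power2_eq_square sc_mult mult.assoc)
  qed
  have bc: "bounded_by c 1"
    unfolding c2 using bounded_by_mult[OF cs(6) bt] by simp
  have adjc: "adj c = c"
  proof -
    have "adj c = (s * t) * sc (of_real (\<delta> ^ 2))" by (simp add: c_def t_def adj_mult adj_sc)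
    then show ?thesis using sc_commute[of "of_real (\<delta> ^ 2)" "s * t"] by (simp add: c_def)
  qed
  \<comment> \<open>Written as c (x s) (\<delta> t) times one scalar \<delta>, the product has norm
    at most \<delta>, since the three other factors are bounded by 1.\<close>
  have "adj (adj a * c) * (adj a * c) = c * x * c"
    by (simp add: adj_mult adjc x_def mult.assoc)
  also have "\<dots> = sc (of_real \<delta>) * (c * ((x * s) * (sc (of_real \<delta>) * t)))"
  proof -
    have "c * x * c = c * (x * (sc (of_real \<delta>) * (s * (sc (of_real \<delta>) * t))))"
      by (subst (2) c2) (simp only: mult.assoc)
    also have "\<dots> = sc (of_real \<delta>) * (c * (x * (s * (sc (of_real \<delta>) * t))))"
      by (simp only: sc_left_commute[of x "of_real \<delta>" "s * (sc (of_real \<delta>) * t)"]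
          sc_left_commute[of c "of_real \<delta>" "x * (s * (sc (of_real \<delta>) * t))"])
    finally show ?thesis by (simp only: mult.assoc)
  qed
  finally have eq: "adj (adj a * c) * (adj a * c) = \<dots>" .
  have "bounded_by (sc (of_real \<delta>) * (c * ((x * s) * (sc (of_real \<delta>) * t)))) (cmod (of_real \<delta>) * (1 * (1 * 1)))"
    by (intro bounded_by_sc_mult bounded_by_mult bc cs(7) bt)
  then have "bounded_by (adj (adj a * c) * (adj a * c)) (sqrt \<delta> ^ 2)"
    using \<delta> by (simp add: eq)
  then have "bounded_by (adj a * c) (sqrt \<delta>)" by (rule bounded_by_adj_mult) (use \<delta> in simp)
  then show ?thesis
    using h bc by (intro that[of c h]) (auto simp: x_def[symmetric] c_def h_def mem_intros s t x)
qed

text \<open>A spectral partition of unity for the Cayley transform \<open>u\<close> of \<open>x\<close>, transported back to \<open>x\<close>.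
  The pieces located near the point \<open>1\<close>, which corresponds to infinity, vanish because \<open>u - 1\<close> is
  invertible.\<close>
lemma local_family:
  assumes x: "x \<in> R" "adj x = x" and \<epsilon>: "0 < \<epsilon>"
  obtains N :: nat and P :: "nat \<Rightarrow> 'r" and \<alpha> :: "nat \<Rightarrow> complex" and M :: real
  where "0 \<le> M" "\<And>j. P j \<in> R" "(\<Sum>j<N. P j) = 1"
    "\<And>j n. \<nu> ((x - sc (\<alpha> j)) ^ n * P j) \<le> M * \<epsilon> ^ n"
    "\<And>j z. z \<in> R \<Longrightarrow> z * x = x * z \<Longrightarrow> z * P j = P j * z"
proof -
  define d where "d = sc (\<i> * of_real 1)"
  obtain s where s: "s \<in> R" "(x + d) * s = 1" "s * (x + d) = 1"
    by (rule selfadjoint_resolvent[OF x zero_less_one, folded d_def])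
  define t where "t = adj s"
  have t: "t \<in> R" by (simp add: t_def adj_mem s)
  have n0: "(1::real) \<noteq> 0" "(- 1::real) \<noteq> 0" by auto
  note cs = cayley_transform[OF x(2) n0(1) s(2,3)[unfolded d_def], folded t_def d_def]
  have dm: "sc (\<i> * of_real (- 1)) = - d" by (simp add: d_def sc_minus)
  have t': "(x + sc (\<i> * of_real (- 1))) * t = 1" "t * (x + sc (\<i> * of_real (- 1))) = 1"
    using cs(1,2) by (simp_all only: dm add_uminus_conv_diff)
  note ct = cayley_transform[OF x(2) n0(2) t']
  define u where "u = (x - d) * s"
  define v where "v = (x + d) * t"
  have mem: "u \<in> R" "v \<in> R" "x + d \<in> R" by (auto simp: u_def v_def d_def mem_intros x s t)
  have bu: "bounded_by u 1" "bounded_by v 1"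
    using cs(5) ct(5) unfolding u_def v_def by (simp_all only: dm diff_minus_eq_add)
  have uv: "u * v = 1"
  proof -
    have "u * v = (x - d) * (s * (x + d)) * t" by (simp only: u_def v_def mult.assoc)
    then show ?thesis by (simp add: s cs)
  qed
  obtain \<gamma> where \<gamma>: "0 < \<gamma>" "\<gamma> < 1" "p < real k powr \<gamma>" by (rule growth_exponent)
  obtain K1 where K1: "0 \<le> K1" "\<And>n. \<nu> (u ^ n) \<le> exp (K1 * real n powr \<gamma>)"
    using subexponential_growth[OF \<gamma>(1,3) mem(1) bu(1)] by blast
  obtain K2 where K2: "0 \<le> K2" "\<And>n. \<nu> (v ^ n) \<le> exp (K2 * real n powr \<gamma>)"
    using subexponential_growth[OF \<gamma>(1,3) mem(2) bu(2)] by blast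
  define K where "K = max K1 K2"
  have K: "0 \<le> K" using K1 by (simp add: K_def)
  have g: "\<nu> (zpow u v m) \<le> exp (K * \<bar>of_int m\<bar> powr \<gamma>)" for m
  proof (cases "0 \<le> m")
    case True
    have "\<nu> (u ^ nat m) \<le> exp (K1 * real (nat m) powr \<gamma>)" by (rule K1)
    also have "\<dots> \<le> exp (K * \<bar>of_int m\<bar> powr \<gamma>)"
      using True by (simp add: K_def mult_right_mono)
    finally show ?thesis using True by (simp add: zpow_def)
  next
    case False
    have "\<nu> (v ^ nat (- m)) \<le> exp (K2 * real (nat (- m)) powr \<gamma>)" by (rule K2)
    also have "\<dots> \<le> exp (K * \<bar>of_int m\<bar> powr \<gamma>)"
      using False by (simp add: K_def mult_right_mono)
    finally show ?thesis using False by (simp add: zpow_def)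
  qed
  define \<kappa> where "\<kappa> = \<nu> (x + d) + 1"
  have \<kappa>: "1 \<le> \<kappa>" "\<nu> (x + d) \<le> \<kappa>" using \<nu>_nonneg[OF mem(3)] by (auto simp: \<kappa>_def)
  \<comment> \<open>Two demands on the radius: \<kappa>^2 e \<le> \<epsilon> serves the far pieces,
    where passing from \<open>u\<close> to \<open>x\<close> costs \<kappa> twice, and \<kappa> e
    \<le> 1/2 brings the ratio (\<kappa> e + 1) / 2 of the near pieces down to 3/4.\<close>
  define e where "e = min (\<epsilon> / \<kappa> ^ 2) (1 / (2 * \<kappa>))"
  have e: "0 < e" "e \<le> \<epsilon> / \<kappa> ^ 2" "e \<le> 1 / (2 * \<kappa>)" using \<epsilon> \<kappa> by (auto simp: e_def)
  have e1: "\<kappa> * \<kappa> * e \<le> \<epsilon>" and e2: "\<kappa> * e \<le> 1 / 2"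
    using e(2,3) \<kappa> by (auto simp: field_simps power2_eq_square)
  show ?thesis
  proof (rule spectral_partition[OF mem(1,2) uv K \<gamma>(1,2) g e(1)])
    fix N :: nat and P :: "nat \<Rightarrow> 'r" and \<zeta> :: "nat \<Rightarrow> complex" and M :: real
    assume P: "0 \<le> M" "\<And>j. P j \<in> R" "(\<Sum>j<N. P j) = 1"
      "\<And>j n. \<nu> ((u - sc (\<zeta> j)) ^ n * P j) \<le> M * e ^ n"
      "\<And>j z. z \<in> R \<Longrightarrow> z * u = u * z \<Longrightarrow> z * v = v * z \<Longrightarrow> z * P j = P j * z"
    have u1: "u = 1 - sc (2 * \<i>) * s" using cs(3) by (simp add: u_def)
    have xds: "(x + d) ^ n * s ^ n = 1" for n
      using power_mult_commuting[of "x + d" s n] s by simp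
    have \<kappa>n: "\<nu> ((x + d) ^ n) \<le> \<kappa> ^ n" for n
      using \<nu>_power[OF mem(3), of n] power_mono[OF \<kappa>(2) \<nu>_nonneg[OF mem(3)], of n] by simp
    \<comment> \<open>The inverse of \<open>x + d\<close> is s = (i/2)(u - 1). On such a piece
      \<open>u - 1\<close> has radius at most e + 1/\<kappa>, so in P_j = (x + d)^n s^n P_j the
      growth \<kappa>^n loses against the decay of s^n.\<close>
    have near: "P j = 0" if "cmod (\<zeta> j - 1) < 1 / \<kappa>" for j
    proof (rule eqI_small[OF P(2) zero_mem])
      have su: "s = sc (\<i> / 2) * (u - 1)"
      proof -
        have "sc (\<i> / 2) * (u - 1) = - (sc (\<i> / 2) * (sc (2 * \<i>) * s))" by (simp add: u1)
        also have "\<dots> = - (sc (\<i> / 2 * (2 * \<i>)) * s)" by (simp only: sc_mult mult.assoc)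
        also have "\<i> / 2 * (2 * \<i>) = - 1" by simp
        finally show ?thesis by (simp add: sc_minus)
      qed
      have un: "\<nu> ((u - 1) ^ n * P j) \<le> M * (e + 1 / \<kappa>) ^ n" for n
      proof -
        have "u - 1 = (u - sc (\<zeta> j)) + sc (\<zeta> j - 1)" by (simp add: sc_diff)
        moreover have "\<nu> (((u - sc (\<zeta> j)) + sc (\<zeta> j - 1)) ^ n * P j) \<le> M * (e + 1 / \<kappa>) ^ n"
        proof (rule \<nu>_power_sum_mult_le)
          fix i l
          have "(u - sc (\<zeta> j)) ^ i * sc (\<zeta> j - 1) ^ l * P j
              = sc ((\<zeta> j - 1) ^ l) * ((u - sc (\<zeta> j)) ^ i * P j)"
            by (simp only: sc_power[symmetric] mult.assoc sc_left_commute)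
          also have "\<nu> \<dots> \<le> cmod ((\<zeta> j - 1) ^ l) * \<nu> ((u - sc (\<zeta> j)) ^ i * P j)"
            by (intro \<nu>_sc_mult_le mem_intros mem P sc_mem)
          also have "\<dots> \<le> (1 / \<kappa>) ^ l * (M * e ^ i)"
            using that P(4)[of j i] \<kappa>
            by (intro mult_mono) (auto simp: norm_power intro!: power_mono \<nu>_nonneg mem_intros mem P)
          finally show "\<nu> ((u - sc (\<zeta> j)) ^ i * sc (\<zeta> j - 1) ^ l * P j) \<le> M * e ^ i * (1 / \<kappa>) ^ l"
            by (simp add: mult_ac)
        next
          show "(u - sc (\<zeta> j)) * sc (\<zeta> j - 1) = sc (\<zeta> j - 1) * (u - sc (\<zeta> j))"
            by (rule sc_commute[symmetric])
        qed (intro mem_intros mem P sc_mem)+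
        ultimately show ?thesis by (simp only:)
      qed
      have bound: "\<nu> (P j) \<le> M * (3 / 4) ^ n" for n
      proof -
        have "P j = (x + d) ^ n * (s ^ n * P j)" using xds[of n] by (simp add: mult.assoc[symmetric])
        also have "s ^ n * P j = sc ((\<i> / 2) ^ n) * ((u - 1) ^ n * P j)"
          by (subst su) (simp only: sc_mult_power mult.assoc)
        finally have "\<nu> (P j) = \<nu> ((x + d) ^ n * (sc ((\<i> / 2) ^ n) * ((u - 1) ^ n * P j)))" by simp
        also have "\<dots> \<le> \<nu> ((x + d) ^ n) * \<nu> (sc ((\<i> / 2) ^ n) * ((u - 1) ^ n * P j))"
          by (intro \<nu>_mult mem_intros mem P sc_mem one_mem)
        also have "\<dots> \<le> \<kappa> ^ n * ((1 / 2) ^ n * (M * (e + 1 / \<kappa>) ^ n))"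
        proof (intro mult_mono \<kappa>n)
          have "\<nu> (sc ((\<i> / 2) ^ n) * ((u - 1) ^ n * P j)) \<le> cmod ((\<i> / 2) ^ n) * \<nu> ((u - 1) ^ n * P j)"
            by (intro \<nu>_sc_mult_le mem_intros mem P one_mem)
          also have "\<dots> \<le> (1 / 2) ^ n * (M * (e + 1 / \<kappa>) ^ n)"
            using un[of n] by (simp add: norm_power norm_divide mult_left_mono)
          finally show "\<nu> (sc ((\<i> / 2) ^ n) * ((u - 1) ^ n * P j)) \<le> (1 / 2) ^ n * (M * (e + 1 / \<kappa>) ^ n)" .
          show "0 \<le> \<kappa> ^ n" using \<kappa> by simp
          show "0 \<le> \<nu> (sc ((\<i> / 2) ^ n) * ((u - 1) ^ n * P j))"
            by (intro \<nu>_nonneg mem_intros mem P sc_mem one_mem)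
        qed
        also have "\<dots> = M * (\<kappa> * (1 / 2) * (e + 1 / \<kappa>)) ^ n" by (simp only: power_mult_distrib mult_ac)
        also have "\<dots> \<le> M * (3 / 4) ^ n"
        proof (intro mult_left_mono power_mono P)
          have "\<kappa> * (1 / 2) * (e + 1 / \<kappa>) = (\<kappa> * e + 1) / 2" using \<kappa> by (simp add: field_simps)
          then show "\<kappa> * (1 / 2) * (e + 1 / \<kappa>) \<le> 3 / 4" using e2 by simp
        qed (use \<kappa> e in auto)
        finally show ?thesis .
      qed
      fix r :: real assume r: "0 < r"
      have "(\<lambda>n. M * (3 / 4) ^ n) \<longlonglongrightarrow> M * 0" by (intro tendsto_intros LIMSEQ_realpow_zero) auto
      then have "\<nu> (P j) \<le> 0" using bound LIMSEQ_le_const[of _ 0 "\<nu> (P j)"] by auto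
      then show "\<nu> (P j - 0) \<le> r" using r by simp
    qed
    \<comment> \<open>The inverse Cayley transform of \<open>\<zeta> j\<close>, obtained by solving
      u - 1 = -2 i s for \<open>x\<close>. It need not be real, as \<open>\<zeta> j\<close> only
      marks a nearby point.\<close>
    define \<alpha> where "\<alpha> j = - (2 * \<i>) / (\<zeta> j - 1) - \<i>" for j
    have far: "\<nu> ((x - sc (\<alpha> j)) ^ n * P j) \<le> M * \<epsilon> ^ n" if z: "1 / \<kappa> \<le> cmod (\<zeta> j - 1)" for j n
    proof -
      have z0: "0 < cmod (\<zeta> j - 1)" using z \<kappa> by (smt (verit) divide_pos_pos)
      then have z1: "\<zeta> j - 1 \<noteq> 0" by simp
      define q where "q = - 1 / (\<zeta> j - 1)"
      have q: "cmod q \<le> \<kappa>" using z z0 \<kappa> by (simp add: q_def norm_divide norm_mult field_simps)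
      \<comment> \<open>The difference of two values of the inverse Cayley transform contains the
        difference of the arguments as a factor; this carries localization of \<open>u\<close> over
        to \<open>x\<close>.\<close>
      have eq: "x - sc (\<alpha> j) = sc q * ((x + d) * (u - sc (\<zeta> j)))"
      proof -
        have "u - sc (\<zeta> j) = sc (1 - \<zeta> j) - sc (2 * \<i>) * s"
          by (simp add: u1 sc_diff algebra_simps)
        then have "(x + d) * (u - sc (\<zeta> j)) = (x + d) * (sc (1 - \<zeta> j) - sc (2 * \<i>) * s)"
          by (simp only:)
        also have "\<dots> = (x + d) * sc (1 - \<zeta> j) - sc (2 * \<i>) * ((x + d) * s)"
          by (simp only: right_diff_distrib sc_left_commute[of "x + d"])
        also have "\<dots> = sc (1 - \<zeta> j) * (x + d) - sc (2 * \<i>)"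
          by (simp add: s sc_commute)
        finally have "sc q * ((x + d) * (u - sc (\<zeta> j))) = sc q * (sc (1 - \<zeta> j) * (x + d) - sc (2 * \<i>))"
          by (rule arg_cong)
        also have "\<dots> = sc (q * (1 - \<zeta> j)) * (x + d) - sc (q * (2 * \<i>))"
          by (simp only: right_diff_distrib[of "sc q"] sc_mult[of q] mult.assoc)
        also have "q * (1 - \<zeta> j) = 1" using z1 by (simp add: q_def field_simps)
        also have "sc 1 * (x + d) - sc (q * (2 * \<i>)) = x - sc (q * (2 * \<i>) - \<i>)"
          by (simp add: sc_diff d_def)
        also have "q * (2 * \<i>) - \<i> = \<alpha> j" by (simp add: \<alpha>_def q_def)
        finally show ?thesis by simp
      qed
      have comm: "(x + d) * (u - sc (\<zeta> j)) = (u - sc (\<zeta> j)) * (x + d)"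
      proof -
        have "(x + d) * u = u * (x + d)"
          unfolding u1 using s by (simp add: right_diff_distrib left_diff_distrib sc_left_commute[of "x + d"] mult.assoc)
        then show ?thesis
          using sc_commute[of "\<zeta> j" "x + d"] by (simp add: right_diff_distrib left_diff_distrib)
      qed
      have "(x - sc (\<alpha> j)) ^ n * P j = sc (q ^ n) * ((x + d) ^ n * ((u - sc (\<zeta> j)) ^ n * P j))"
        by (simp only: eq sc_mult_power power_mult_commuting[OF comm] mult.assoc)
      also have "\<nu> \<dots> \<le> cmod (q ^ n) * \<nu> ((x + d) ^ n * ((u - sc (\<zeta> j)) ^ n * P j))"
        by (intro \<nu>_sc_mult_le mem_intros mem P sc_mem)
      also have "\<dots> \<le> \<kappa> ^ n * (\<kappa> ^ n * (M * e ^ n))"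
      proof (intro mult_mono)
        show "cmod (q ^ n) \<le> \<kappa> ^ n" using q by (simp add: norm_power power_mono)
        have "\<nu> ((x + d) ^ n * ((u - sc (\<zeta> j)) ^ n * P j)) \<le> \<nu> ((x + d) ^ n) * \<nu> ((u - sc (\<zeta> j)) ^ n * P j)"
          by (intro \<nu>_mult mem_intros mem P sc_mem)
        also have "\<dots> \<le> \<kappa> ^ n * (M * e ^ n)"
        proof (intro mult_mono \<kappa>n P)
          show "0 \<le> \<kappa> ^ n" using \<kappa> by simp
          show "0 \<le> \<nu> ((u - sc (\<zeta> j)) ^ n * P j)" by (intro \<nu>_nonneg mem_intros mem P sc_mem)
        qed
        finally show "\<nu> ((x + d) ^ n * ((u - sc (\<zeta> j)) ^ n * P j)) \<le> \<kappa> ^ n * (M * e ^ n)" .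
        show "0 \<le> \<nu> ((x + d) ^ n * ((u - sc (\<zeta> j)) ^ n * P j))" by (intro \<nu>_nonneg mem_intros mem P sc_mem)
        show "0 \<le> \<kappa> ^ n" using \<kappa> by simp
      qed
      also have "\<dots> = M * (\<kappa> * \<kappa> * e) ^ n" by (simp only: power_mult_distrib mult_ac)
      also have "\<dots> \<le> M * \<epsilon> ^ n"
        using e1 \<kappa> e P by (intro mult_left_mono power_mono) auto
      finally show ?thesis .
    qed
    show ?thesis
    proof (rule that[of M P N \<alpha>])
      show "\<nu> ((x - sc (\<alpha> j)) ^ n * P j) \<le> M * \<epsilon> ^ n" for j n
      proof (cases "cmod (\<zeta> j - 1) < 1 / \<kappa>")
        case True
        then show ?thesis using near[of j] P(1) \<epsilon> by simp
      next
        case False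
        then show ?thesis by (intro far) simp
      qed
      show "z * P j = P j * z" if z: "z \<in> R" "z * x = x * z" for j z
      proof (rule P(5)[OF z(1)])
        have zd: "z * (x + d) = (x + d) * z" "z * (x - d) = (x - d) * z"
          using z sc_commute[of "\<i> * of_real 1" z, folded d_def] by (simp_all add: algebra_simps)
        have zs: "z * s = s * z" by (rule inverse_commutes[OF s(2,3) zd(1)])
        have zt: "z * t = t * z" by (rule inverse_commutes[OF cs(2,1) zd(2)])
        show "z * u = u * z" unfolding u_def by (metis mult.assoc zd(2) zs)
        show "z * v = v * z" unfolding v_def by (metis mult.assoc zd(1) zt)
      qed
    qed (use P in auto)
  qed
qed

end

section \<open>Homomorphisms\<close>

locale differential_star_ring_hom = differential_star_ring R \<nu> sc adj bounded_by k p C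
  for R :: "'r::ring_1 set" and \<nu> sc adj bounded_by k p C +
  fixes \<phi> :: "'r \<Rightarrow> 'e::complex_banach_algebra_1" and L :: real
  assumes \<phi>_add: "x \<in> R \<Longrightarrow> y \<in> R \<Longrightarrow> \<phi> (x + y) = \<phi> x + \<phi> y"
    and \<phi>_mult: "x \<in> R \<Longrightarrow> y \<in> R \<Longrightarrow> \<phi> (x * y) = \<phi> x * \<phi> y"
    and \<phi>_sc: "\<phi> (sc a) = a *\<^sub>C 1"
    and \<phi>_bound: "x \<in> R \<Longrightarrow> norm (\<phi> x) \<le> L * \<nu> x" and L: "0 \<le> L"
begin

lemma \<phi>_1 [simp]: "\<phi> 1 = 1"
  using \<phi>_sc[of 1] by (simp add: cscale_one)

lemma \<phi>_0 [simp]: "\<phi> 0 = 0"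
  using \<phi>_add[of 0 0] by simp

lemma \<phi>_minus: "x \<in> R \<Longrightarrow> \<phi> (- x) = - \<phi> x"
  using \<phi>_add[of x "- x"] by (simp add: mem_intros eq_neg_iff_add_eq_0 add.commute)

lemma \<phi>_diff: "x \<in> R \<Longrightarrow> y \<in> R \<Longrightarrow> \<phi> (x - y) = \<phi> x - \<phi> y"
  using \<phi>_add[of x "- y"] \<phi>_minus[of y] by (simp add: mem_intros)

lemma \<phi>_sum: "(\<And>i. i \<in> F \<Longrightarrow> f i \<in> R) \<Longrightarrow> \<phi> (sum f F) = (\<Sum>i\<in>F. \<phi> (f i))"
  by (induction F rule: infinite_finite_induct) (auto simp: \<phi>_add mem_intros)

lemma \<phi>_power: "x \<in> R \<Longrightarrow> \<phi> (x ^ n) = \<phi> x ^ n"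
  by (induction n) (auto simp: \<phi>_mult mem_intros)

text \<open>The radius 2 \<epsilon> is that of a product of two pieces of radius \<epsilon>, and the
  threshold 3 \<epsilon> exceeds it strictly. Below the threshold \<open>a\<close> acts on
  \<open>z\<close> with radius 5 \<epsilon>, and 5 \<epsilon> |g| < 1 kills the image of
  \<open>z\<close>. Above it, (a - \<theta>) / \<theta> has radius 2/3 on \<open>z\<close>, and the
  Neumann series divides \<open>z\<close> by \<open>a\<close>.\<close>

lemma local_piece:
  assumes a: "a \<in> R" and z: "z \<in> R" and g: "g * \<phi> a = 1"
    and bd: "\<And>n. \<nu> ((a - sc \<theta>) ^ n * z) \<le> M * (2 * \<epsilon>) ^ n" and \<epsilon>: "0 < \<epsilon>" "5 * \<epsilon> * norm g < 1"
  shows "\<exists>y\<in>R. \<phi> z = \<phi> a * \<phi> y"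
proof (cases "cmod \<theta> \<le> 3 * \<epsilon>")
  case True
  have M: "0 \<le> M" using bd[of 0] \<nu>_nonneg[OF z] by simp
  have an: "\<nu> (a ^ n * z) \<le> M * (2 * \<epsilon> + 3 * \<epsilon>) ^ n" for n
  proof -
    have "\<nu> (((a - sc \<theta>) + sc \<theta>) ^ n * z) \<le> M * (2 * \<epsilon> + 3 * \<epsilon>) ^ n"
    proof (rule \<nu>_power_sum_mult_le)
      fix i l
      have "(a - sc \<theta>) ^ i * sc \<theta> ^ l * z = sc (\<theta> ^ l) * ((a - sc \<theta>) ^ i * z)"
        by (simp only: sc_power[symmetric] mult.assoc sc_left_commute)
      also have "\<nu> \<dots> \<le> cmod (\<theta> ^ l) * \<nu> ((a - sc \<theta>) ^ i * z)"
        by (intro \<nu>_sc_mult_le mem_intros a z sc_mem)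
      also have "\<dots> \<le> (3 * \<epsilon>) ^ l * (M * (2 * \<epsilon>) ^ i)"
      proof (intro mult_mono bd)
        show "cmod (\<theta> ^ l) \<le> (3 * \<epsilon>) ^ l" unfolding norm_power by (rule power_mono[OF True norm_ge_zero])
        show "0 \<le> \<nu> ((a - sc \<theta>) ^ i * z)" by (intro \<nu>_nonneg mem_intros a z sc_mem)
      qed (use \<epsilon> in simp)
      finally show "\<nu> ((a - sc \<theta>) ^ i * sc \<theta> ^ l * z) \<le> M * (2 * \<epsilon>) ^ i * (3 * \<epsilon>) ^ l"
        by (simp only: mult_ac)
      show "(a - sc \<theta>) * sc \<theta> = sc \<theta> * (a - sc \<theta>)" by (rule sc_commute[symmetric])
    qed (intro mem_intros a z sc_mem)+
    then show ?thesis by simp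
  qed
  have bound: "norm (\<phi> z) \<le> L * M * (5 * \<epsilon> * norm g) ^ n" for n
  proof -
    have "g ^ n * \<phi> a ^ n = 1"
    proof (induction n)
      case (Suc n)
      have "g ^ Suc n * \<phi> a ^ Suc n = g ^ n * (g * \<phi> a) * \<phi> a ^ n"
        by (simp only: power_Suc2[of g] power_Suc[of "\<phi> a"] mult.assoc)
      then show ?case using Suc g by simp
    qed simp
    then have "\<phi> z = g ^ n * \<phi> (a ^ n * z)"
      by (simp add: \<phi>_mult \<phi>_power mem_intros a z mult.assoc[symmetric])
    then have "norm (\<phi> z) \<le> norm (g ^ n) * norm (\<phi> (a ^ n * z))" by (simp add: norm_mult_ineq)
    also have "\<dots> \<le> norm g ^ n * (L * (M * (5 * \<epsilon>) ^ n))"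
    proof (intro mult_mono norm_power_ineq)
      have "norm (\<phi> (a ^ n * z)) \<le> L * \<nu> (a ^ n * z)" by (intro \<phi>_bound mem_intros a z)
      also have "\<dots> \<le> L * (M * (5 * \<epsilon>) ^ n)" using an[of n] L by (intro mult_left_mono) auto
      finally show "norm (\<phi> (a ^ n * z)) \<le> L * (M * (5 * \<epsilon>) ^ n)" .
    qed auto
    also have "\<dots> = L * M * (5 * \<epsilon> * norm g) ^ n" by (simp only: power_mult_distrib mult_ac)
    finally show ?thesis .
  qed
  have "(\<lambda>n. L * M * (5 * \<epsilon> * norm g) ^ n) \<longlonglongrightarrow> L * M * 0"
    using \<epsilon> by (intro tendsto_intros LIMSEQ_realpow_zero) auto
  then have "norm (\<phi> z) \<le> L * M * 0" by (rule LIMSEQ_le_const) (use bound in blast)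
  then show ?thesis by (intro bexI[of _ 0]) auto
next
  case False
  then have \<theta>: "\<theta> \<noteq> 0" "3 * \<epsilon> < cmod \<theta>" using \<epsilon> by auto
  define y where "y = sc (- 1 / \<theta>) * (a - sc \<theta>)"
  have y: "y \<in> R" by (simp add: y_def mem_intros a)
  have yn: "\<nu> (y ^ n * z) \<le> M * (2 / 3) ^ n" for n
  proof -
    have "y ^ n * z = sc ((- 1 / \<theta>) ^ n) * ((a - sc \<theta>) ^ n * z)"
      by (simp only: y_def sc_mult_power mult.assoc)
    then have "\<nu> (y ^ n * z) \<le> cmod ((- 1 / \<theta>) ^ n) * \<nu> ((a - sc \<theta>) ^ n * z)"
      using \<nu>_sc_mult_le[of "(a - sc \<theta>) ^ n * z" "(- 1 / \<theta>) ^ n"] by (simp add: mem_intros a z)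
    also have "\<dots> \<le> (1 / (3 * \<epsilon>)) ^ n * (M * (2 * \<epsilon>) ^ n)"
    proof (intro mult_mono bd)
      have "cmod (- 1 / \<theta>) \<le> 1 / (3 * \<epsilon>)" using \<theta> \<epsilon> by (simp add: norm_divide frac_le)
      then show "cmod ((- 1 / \<theta>) ^ n) \<le> (1 / (3 * \<epsilon>)) ^ n"
        by (simp only: norm_power) (simp add: power_mono)
      show "0 \<le> \<nu> ((a - sc \<theta>) ^ n * z)" by (intro \<nu>_nonneg mem_intros a z sc_mem)
    qed (use \<epsilon> in simp)
    also have "\<dots> = M * (1 / (3 * \<epsilon>) * (2 * \<epsilon>)) ^ n" by (simp only: power_mult_distrib mult_ac)
    also have "1 / (3 * \<epsilon>) * (2 * \<epsilon>) = 2 / 3" using \<epsilon> by simp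
    finally show ?thesis .
  qed
  obtain S where S: "S \<in> R" "(1 - y) * S = z"
    by (rule neumann[OF y z yn]) auto
  have "sc \<theta> * y = - (a - sc \<theta>)"
  proof -
    have "sc \<theta> * y = sc (\<theta> * (- 1 / \<theta>)) * (a - sc \<theta>)" by (simp only: y_def sc_mult mult.assoc)
    also have "\<theta> * (- 1 / \<theta>) = - 1" using \<theta> by simp
    finally show ?thesis by (simp add: sc_minus)
  qed
  then have "a = sc \<theta> * (1 - y)" by (simp add: right_diff_distrib)
  then have "a * (sc (1 / \<theta>) * S) = sc \<theta> * ((1 - y) * (sc (1 / \<theta>) * S))" by (simp add: mult.assoc)
  also have "\<dots> = sc \<theta> * (sc (1 / \<theta>) * ((1 - y) * S))" by (simp only: sc_left_commute[of "1 - y"])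
  also have "\<dots> = z" using S \<theta> by (simp add: sc_cancel)
  finally have "\<phi> z = \<phi> a * \<phi> (sc (1 / \<theta>) * S)"
    using \<phi>_mult[of a "sc (1 / \<theta>) * S"] by (simp add: mem_intros a S)
  then show ?thesis using S by (intro bexI[of _ "sc (1 / \<theta>) * S"]) (auto simp: mem_intros)
qed

text \<open>The pieces of a joint partition for the real and imaginary part of \<open>a\<close> on which \<open>a\<close> is
  small are killed by \<open>\<phi>\<close>; the others are multiples of \<open>a\<close>.\<close>
lemma normal_inverse_in_range:
  assumes a: "a \<in> R" "adj a * a = a * adj a" and g: "g * \<phi> a = 1"
  shows "\<exists>h\<in>R. \<phi> a * \<phi> h = 1"
proof -
  define b1 where "b1 = sc (1 / 2) * (a + adj a)"
  define b2 where "b2 = sc (- \<i> / 2) * (a - adj a)"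
  have b: "b1 \<in> R" "b2 \<in> R" by (auto simp: b1_def b2_def mem_intros a adj_mem)
  have sa: "adj b1 = b1" "adj b2 = b2"
  proof -
    have "adj b1 = (adj a + a) * sc (1 / 2)" by (simp add: b1_def adj_mult adj_add adj_sc)
    then show "adj b1 = b1" by (simp add: b1_def sc_commute add.commute)
    have "adj b2 = (adj a - a) * sc (\<i> / 2)" by (simp add: b2_def adj_mult adj_diff adj_sc)
    also have "\<dots> = (a - adj a) * sc (- \<i> / 2)" by (simp add: sc_minus algebra_simps)
    finally show "adj b2 = b2" by (simp only: b2_def sc_commute)
  qed
  have ab: "a = b1 + sc \<i> * b2"
  proof -
    have "sc \<i> * b2 = sc (\<i> * (- \<i> / 2)) * (a - adj a)" by (simp only: b2_def sc_mult mult.assoc)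
    then have "b1 + sc \<i> * b2 = sc (1 / 2) * (a + adj a) + sc (1 / 2) * (a - adj a)"
      by (simp add: b1_def)
    also have "\<dots> = (sc (1 / 2) + sc (1 / 2)) * a" by (simp add: algebra_simps)
    finally show ?thesis by (simp add: sc_add[symmetric])
  qed
  have comm: "b2 * b1 = b1 * b2"
  proof -
    have c: "(a - adj a) * (a + adj a) = (a + adj a) * (a - adj a)"
      using a(2) by (simp add: algebra_simps)
    have "b2 * b1 = sc (- \<i> / 2) * (sc (1 / 2) * ((a - adj a) * (a + adj a)))"
      by (simp only: b1_def b2_def mult.assoc sc_left_commute[of "a - adj a"])
    also have "\<dots> = sc (1 / 2) * (sc (- \<i> / 2) * ((a + adj a) * (a - adj a)))"
      by (simp only: c sc_left_commute[of "sc (- \<i> / 2)"])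
    also have "\<dots> = b1 * b2"
      by (simp only: b1_def b2_def mult.assoc sc_left_commute[of "a + adj a"])
    finally show ?thesis .
  qed
  \<comment> \<open>Fixed by the demand 5 \<epsilon> |g| < 1 of \<open>local_piece\<close>.\<close>
  define \<epsilon> where "\<epsilon> = 1 / (5 * (norm g + 1))"
  have "0 < norm g + 1" using norm_ge_zero[of g] by linarith
  then have \<epsilon>: "0 < \<epsilon>" "5 * \<epsilon> * norm g < 1" by (auto simp: \<epsilon>_def field_simps)
  show ?thesis
  proof (rule local_family[OF b(1) sa(1) \<epsilon>(1)], rule local_family[OF b(2) sa(2) \<epsilon>(1)])
    fix N1 N2 :: nat and P Q :: "nat \<Rightarrow> 'r" and \<alpha> \<beta> :: "nat \<Rightarrow> complex" and M1 M2 :: real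
    assume P: "0 \<le> M1" "\<And>j. P j \<in> R" "(\<Sum>j<N1. P j) = 1"
      "\<And>j n. \<nu> ((b1 - sc (\<alpha> j)) ^ n * P j) \<le> M1 * \<epsilon> ^ n"
      "\<And>j z. z \<in> R \<Longrightarrow> z * b1 = b1 * z \<Longrightarrow> z * P j = P j * z"
    assume Q: "0 \<le> M2" "\<And>j. Q j \<in> R" "(\<Sum>j<N2. Q j) = 1"
      "\<And>j n. \<nu> ((b2 - sc (\<beta> j)) ^ n * Q j) \<le> M2 * \<epsilon> ^ n"
      "\<And>j z. z \<in> R \<Longrightarrow> z * b2 = b2 * z \<Longrightarrow> z * Q j = Q j * z"
    have "\<exists>y\<in>R. \<phi> (P i * Q j) = \<phi> a * \<phi> y" for i j
    proof (rule local_piece[OF a(1) _ g _ \<epsilon>])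
      let ?s = "b1 - sc (\<alpha> i)" and ?t = "b2 - sc (\<beta> j)"
      have st: "?s * ?t = ?t * ?s"
        using comm sc_commute[of "\<alpha> i" b2] sc_commute[of "\<beta> j" b1] sc_commute[of "\<alpha> i" "sc (\<beta> j)"]
        by (simp add: algebra_simps)
      have tb: "?t * b1 = b1 * ?t"
        using comm sc_commute[of "\<beta> j" b1] by (simp add: algebra_simps)
      have "a - sc (\<alpha> i + \<i> * \<beta> j) = ?s + sc \<i> * ?t"
        by (subst ab) (simp add: sc_add sc_mult algebra_simps)
      moreover have "\<nu> ((?s + sc \<i> * ?t) ^ n * (P i * Q j)) \<le> (M1 * M2) * (\<epsilon> + \<epsilon>) ^ n" for n
      proof (rule \<nu>_power_sum_mult_le)
        fix k l
        \<comment> \<open>Normality makes \<open>b1\<close> and \<open>b2\<close> commute, and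
          \<open>P i\<close> commutes with whatever commutes with \<open>b1\<close>. Each difference
          can thus be moved next to its own partition element.\<close>
        have "P i * ?t ^ l = ?t ^ l * P i"
        proof -
          have "?t * P i = P i * ?t" by (rule P(5)[OF _ tb]) (simp add: mem_intros b)
          then show ?thesis using power_commuting_commutes[of ?t "P i" l] by simp
        qed
        then have "?t ^ l * (P i * Q j) = P i * (?t ^ l * Q j)" by (simp add: mult.assoc[symmetric])
        then have "?s ^ k * (sc \<i> * ?t) ^ l * (P i * Q j) = ?s ^ k * (sc (\<i> ^ l) * (P i * (?t ^ l * Q j)))"
          by (simp only: sc_mult_power mult.assoc)
        also have "\<dots> = sc (\<i> ^ l) * ((?s ^ k * P i) * (?t ^ l * Q j))"
          by (simp only: sc_left_commute[of "?s ^ k"] mult.assoc)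
        also have "\<nu> \<dots> \<le> cmod (\<i> ^ l) * \<nu> ((?s ^ k * P i) * (?t ^ l * Q j))"
          by (intro \<nu>_sc_mult_le mem_intros b P Q sc_mem)
        also have "\<dots> = \<nu> ((?s ^ k * P i) * (?t ^ l * Q j))" by (simp add: norm_power)
        also have "\<dots> \<le> \<nu> (?s ^ k * P i) * \<nu> (?t ^ l * Q j)"
          by (intro \<nu>_mult mem_intros b P Q sc_mem)
        also have "\<dots> \<le> (M1 * \<epsilon> ^ k) * (M2 * \<epsilon> ^ l)"
        proof (intro mult_mono P Q)
          show "0 \<le> M1 * \<epsilon> ^ k" using P \<epsilon> by simp
          show "0 \<le> \<nu> (?t ^ l * Q j)" by (intro \<nu>_nonneg mem_intros b Q sc_mem)
        qed
        finally show "\<nu> (?s ^ k * (sc \<i> * ?t) ^ l * (P i * Q j)) \<le> (M1 * M2) * \<epsilon> ^ k * \<epsilon> ^ l"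
          by (simp only: mult_ac)
      next
        show "?s * (sc \<i> * ?t) = sc \<i> * ?t * ?s"
          by (simp only: sc_left_commute[of ?s] st mult.assoc)
      qed (intro mem_intros b P Q sc_mem)+
      ultimately show "\<nu> ((a - sc (\<alpha> i + \<i> * \<beta> j)) ^ n * (P i * Q j)) \<le> (M1 * M2) * (2 * \<epsilon>) ^ n" for n
        by simp
      show "P i * Q j \<in> R" by (intro mem_intros P Q)
    qed
    then obtain y where y: "\<And>i j. y i j \<in> R" "\<And>i j. \<phi> (P i * Q j) = \<phi> a * \<phi> (y i j)"
      by metis
    have "1 = (\<Sum>i<N1. \<Sum>j<N2. P i * Q j)"
      using P(3) Q(3) by (simp add: sum_distrib_left[symmetric])
    then have "\<phi> 1 = \<phi> (\<Sum>i<N1. \<Sum>j<N2. P i * Q j)" by (rule arg_cong)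
    also have "\<dots> = (\<Sum>i<N1. \<Sum>j<N2. \<phi> (P i * Q j))"
      by (simp add: \<phi>_sum mem_intros P Q)
    also have "\<dots> = \<phi> a * \<phi> (\<Sum>i<N1. \<Sum>j<N2. y i j)"
      by (simp add: \<phi>_sum mem_intros y sum_distrib_left)
    finally show ?thesis
      by (intro bexI[of _ "\<Sum>i<N1. \<Sum>j<N2. y i j"]) (auto simp: mem_intros y)
  qed
qed

text \<open>The kernel of \<open>\<phi>\<close> need not be stable under the involution, but it is dense in such an ideal
  for the norm of the ambient \<open>C\<^sup>*\<close>-algebra. So \<open>c\<close>, an approximate spectral projection of \<open>a a\<^sup>*\<close>
  near \<open>0\<close>, is close to an element of the kernel, and \<open>1 - c\<close> is a multiple of \<open>a a\<^sup>*\<close>.\<close>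
lemma adj_invertible:
  assumes mem: "a \<in> R" "b \<in> R" and inv: "\<phi> a * \<phi> b = 1" "\<phi> b * \<phi> a = 1"
  shows "\<exists>w. \<phi> (adj a) * w = 1 \<and> w * \<phi> (adj a) = 1"
proof -
  define i where "i = a * b - 1"
  have i: "i \<in> R" "\<phi> i = 0" using inv by (auto simp: i_def mem_intros mem \<phi>_diff \<phi>_mult)
  have ba: "adj b * adj a = 1 + adj i"
    by (simp add: i_def adj_diff adj_mult)
  obtain r where r: "bounded_by (adj b) r" using bounded_by_ex by blast
  have r0: "0 \<le> r" by (rule bounded_by_nonneg[OF r])
  \<comment> \<open>Chosen so that (r + 1) sqrt \<delta> = 1/2, the bound for \<open>y\<close>
    below.\<close>
  define \<delta> where "\<delta> = (1 / (2 * (r + 1))) ^ 2"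
  have \<delta>: "0 < \<delta>" "sqrt \<delta> = 1 / (2 * (r + 1))" using r0 by (auto simp: \<delta>_def real_sqrt_abs)
  obtain c h where c: "c \<in> R" "h \<in> R" "bounded_by (adj a * c) (sqrt \<delta>)" "bounded_by c 1"
    "1 - c = (a * adj a) * h" "1 - c = h * (a * adj a)"
    by (rule approximate_annihilator[OF mem(1) \<delta>(1)])
  obtain c' h' where c': "c' \<in> R" "h' \<in> R" "bounded_by (adj i * c') (sqrt \<delta>)" "bounded_by c' 1"
    "1 - c' = (i * adj i) * h'" "1 - c' = h' * (i * adj i)"
    by (rule approximate_annihilator[OF i(1) \<delta>(1)])
  have am: "adj a \<in> R" "adj b \<in> R" "adj i \<in> R" by (auto intro: adj_mem mem i)
  \<comment> \<open>An element of the kernel, as 1 - c' contains the factor \<open>i\<close>, that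
    differs from \<open>adj i * c\<close> only by the small term \<open>adj i * c' * c\<close>.
    Hence y = c + m is close to (1 + adj i) c = adj b (adj a c), itself small, while the image of 1
    - y is that of 1 - c.\<close>
  define m where "m = adj i * (1 - c') * c"
  have m: "m \<in> R" "\<phi> m = 0"
    using am c c' i by (auto simp: m_def c'(5) \<phi>_mult mem_intros)
  define y where "y = c + m"
  have y: "y \<in> R" by (simp add: y_def mem_intros c m)
  have "y = adj b * (adj a * c) - (adj i * c') * c"
  proof -
    have "adj b * (adj a * c) = (1 + adj i) * c" by (simp add: mult.assoc[symmetric] ba)
    then show ?thesis by (simp add: y_def m_def algebra_simps)
  qed
  moreover have "bounded_by (adj b * (adj a * c) - (adj i * c') * c) (r * sqrt \<delta> + sqrt \<delta> * 1)"
    by (intro bounded_by_diff bounded_by_mult r c c')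
  ultimately have by': "bounded_by y (r * sqrt \<delta> + sqrt \<delta> * 1)" by simp
  have "r * sqrt \<delta> + sqrt \<delta> * 1 < 1" using r0 by (simp add: \<delta>(2) field_simps)
  from one_minus_invertible[OF y by' this]
  obtain v where v: "v \<in> R" "(1 - y) * v = 1" "v * (1 - y) = 1" by blast
  have e1: "\<phi> (1 - y) = \<phi> a * \<phi> (adj a) * \<phi> h"
  proof -
    have "1 - y = (a * adj a) * h - m" using c(5) by (simp add: y_def algebra_simps)
    then show ?thesis by (simp add: \<phi>_diff \<phi>_mult mem_intros mem am c m)
  qed
  have e2: "\<phi> (1 - y) = \<phi> h * (\<phi> a * \<phi> (adj a))"
  proof -
    have "1 - y = h * (a * adj a) - m" using c(6) by (simp add: y_def algebra_simps)
    then show ?thesis by (simp add: \<phi>_diff \<phi>_mult mem_intros mem am c m)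
  qed
  have v': "\<phi> (1 - y) * \<phi> v = 1" "\<phi> v * \<phi> (1 - y) = 1"
    using \<phi>_mult[of "1 - y" v] \<phi>_mult[of v "1 - y"] v diff_mem[OF one_mem y] by simp_all
  have R1: "\<phi> a * (\<phi> (adj a) * (\<phi> h * \<phi> v)) = 1" using v'(1) by (simp add: e1 mult.assoc)
  have L1: "(\<phi> v * \<phi> h * \<phi> a) * \<phi> (adj a) = 1" using v'(2) by (simp add: e2 mult.assoc)
  define w where "w = \<phi> h * \<phi> v * \<phi> a"
  \<comment> \<open>By \<open>R1\<close> the left side is a right inverse of the image of
    \<open>a\<close>, so it equals the image of \<open>b\<close>. Multiplication by the image of
    \<open>a\<close> on the right then yields a right inverse of the image of
    \<open>adj a\<close>.\<close>
  have "\<phi> (adj a) * (\<phi> h * \<phi> v) = \<phi> b * (\<phi> a * (\<phi> (adj a) * (\<phi> h * \<phi> v)))"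
    by (simp add: mult.assoc[symmetric] inv)
  then have "\<phi> (adj a) * (\<phi> h * \<phi> v) = \<phi> b" by (simp add: R1)
  then have R2: "\<phi> (adj a) * w = 1"
    using inv by (simp add: w_def mult.assoc[symmetric])
  have "w = (\<phi> v * \<phi> h * \<phi> a) * \<phi> (adj a) * w" using L1 by simp
  also have "\<dots> = \<phi> v * \<phi> h * \<phi> a" by (simp only: mult.assoc[of _ "\<phi> (adj a)" w] R2 mult_1_right)
  finally show ?thesis using R2 L1 by (intro exI[of _ w]) simp
qed

end

section \<open>The unitization of a differential subalgebra\<close>

lemma cscale_zero_left [simp]: "0 *\<^sub>C x = (0 :: 'a::complex_normed_algebra)"
  using cscale_add_left[of 0 0 x] by simp

lemma cscale_zero_right [simp]: "c *\<^sub>C 0 = (0 :: 'a::complex_normed_algebra)"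
  using cscale_add_right[of c 0 "0::'a"] by simp

lemma cscale_minus_left: "(- c) *\<^sub>C x = - (c *\<^sub>C (x :: 'a::complex_normed_algebra))"
  using cscale_add_left[of c "- c" x] by (simp add: eq_neg_iff_add_eq_0 add.commute)

lemma star_zero [simp]: "star (0 :: 'a::cstar_algebra) = 0"
  using star_add[of "0::'a" 0] by simp

lemma norm_star: "norm (star x) = norm (x :: 'a::cstar_algebra)"
proof -
  have le: "norm y \<le> norm (star y)" for y :: 'a
  proof (cases "y = 0")
    case False
    have "norm y * norm y \<le> norm (star y) * norm y"
      using norm_mult_ineq[of "star y" y] by (simp add: cstar_identity power2_eq_square)
    then show ?thesis using False by (simp add: mult_le_cancel_right)
  qed simp
  show ?thesis using le[of x] le[of "star x"] by (simp add: star_star)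
qed

text \<open>\<open>Adjoin a c\<close> stands for \<open>a + c 1\<close>, also when \<open>'a\<close> happens to have a unit.\<close>
datatype 'a unitization = Adjoin (base: 'a) (scalar: complex)

instantiation unitization :: (complex_normed_algebra) ring_1
begin

definition "0 = Adjoin 0 0"
definition "1 = Adjoin 0 1"
definition "x + y = Adjoin (base x + base y) (scalar x + scalar y)"
definition "x - y = Adjoin (base x - base y) (scalar x - scalar y)"
definition "- x = Adjoin (- base x) (- scalar x)"
definition "x * y = Adjoin (base x * base y + scalar x *\<^sub>C base y + scalar y *\<^sub>C base x) (scalar x * scalar y)"

instance
  by standard
    (simp_all add: zero_unitization_def one_unitization_def plus_unitization_def
      minus_unitization_def uminus_unitization_def times_unitization_def unitization.expand
      cscale_one cscale_add_left cscale_add_right cscale_cscale mult_cscale_left mult_cscale_right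
      algebra_simps)

end

lemma base_simps [simp]:
  "base 0 = 0" "base 1 = 0" "base (x + y) = base x + base y" "base (x - y) = base x - base y"
  "base (x * y) = base x * base y + scalar x *\<^sub>C base y + scalar y *\<^sub>C base x"
  by (simp_all add: zero_unitization_def one_unitization_def plus_unitization_def
      minus_unitization_def times_unitization_def)

lemma scalar_simps [simp]:
  "scalar 0 = 0" "scalar 1 = 1" "scalar (x + y) = scalar x + scalar y"
  "scalar (x - y) = scalar x - scalar y" "scalar (x * y) = scalar x * scalar y"
  by (simp_all add: zero_unitization_def one_unitization_def plus_unitization_def
      minus_unitization_def times_unitization_def)

lemma scalar_power: "scalar (x ^ n) = scalar x ^ n"
  by (induction n) auto

text \<open>Stated from exponent 1 on, since \<open>ppow a 0\<close> is 0 and not a unit.\<close>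

lemma Adjoin_power:
  "Adjoin (a :: 'a::complex_normed_algebra) 0 ^ Suc n = Adjoin (ppow a (Suc n)) 0"
proof (induction n)
  case (Suc n)
  then show ?case
    by (simp only: power_Suc[of _ "Suc n"] ppow.simps) (simp add: unitization.expand)
qed simp

section \<open>Involution and operator norm on the unitization\<close>

definition uadj :: "'b::cstar_algebra unitization \<Rightarrow> 'b unitization" where
  "uadj x = Adjoin (star (base x)) (cnj (scalar x))"

lemma uadj_simps [simp]: "base (uadj x) = star (base x)" "scalar (uadj x) = cnj (scalar x)"
  by (simp_all add: uadj_def)

text \<open>Upper bounds for a C*-norm with a new unit: the larger of the modulus of the scalar part
  and the norm of left multiplication. The scalar condition matters when the algebra has a unit
  \<open>e\<close>, because then \<open>Adjoin (- e) 1\<close> acts as zero. A predicate avoids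
  introducing a supremum.\<close>

definition operator_bounded :: "'b::cstar_algebra unitization \<Rightarrow> real \<Rightarrow> bool" where
  "operator_bounded x r \<longleftrightarrow>
    cmod (scalar x) \<le> r \<and> (\<forall>b. norm (base x * b + scalar x *\<^sub>C b) \<le> r * norm b)"

lemma operator_bounded_nonneg: "operator_bounded x r \<Longrightarrow> 0 \<le> r"
  unfolding operator_bounded_def by (meson norm_ge_zero order_trans)

lemma operator_bounded_mono: "operator_bounded x r \<Longrightarrow> r \<le> s \<Longrightarrow> operator_bounded x s"
  unfolding operator_bounded_def by (meson mult_right_mono norm_ge_zero order_trans)

lemma operator_bounded_scalar: "operator_bounded (Adjoin 0 c) (cmod c)"
  by (simp add: operator_bounded_def norm_cscale)

lemma operator_bounded_add:
  assumes "operator_bounded x r" "operator_bounded y s"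
  shows "operator_bounded (x + y) (r + s)"
  unfolding operator_bounded_def
proof (intro conjI allI)
  show "cmod (scalar (x + y)) \<le> r + s"
    using assms norm_triangle_ineq[of "scalar x" "scalar y"] by (auto simp: operator_bounded_def)
  fix b
  have "base (x + y) * b + scalar (x + y) *\<^sub>C b
      = (base x * b + scalar x *\<^sub>C b) + (base y * b + scalar y *\<^sub>C b)"
    by (simp add: cscale_add_left algebra_simps)
  then show "norm (base (x + y) * b + scalar (x + y) *\<^sub>C b) \<le> (r + s) * norm b"
    using assms norm_triangle_ineq[of "base x * b + scalar x *\<^sub>C b" "base y * b + scalar y *\<^sub>C b"]
    unfolding operator_bounded_def by (smt (verit) distrib_right)
qed

lemma unitization_mult_action:
  fixes x y :: "'b::complex_normed_algebra unitization"
  shows "base (x * y) * b + scalar (x * y) *\<^sub>C b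
    = base x * (base y * b + scalar y *\<^sub>C b) + scalar x *\<^sub>C (base y * b + scalar y *\<^sub>C b)"
  by (simp add: cscale_add_right cscale_cscale mult_cscale_left mult_cscale_right algebra_simps)

lemma operator_bounded_mult:
  assumes "operator_bounded x r" "operator_bounded y s"
  shows "operator_bounded (x * y) (r * s)"
  unfolding operator_bounded_def
proof (intro conjI allI)
  have r: "0 \<le> r" using assms(1) by (rule operator_bounded_nonneg)
  show "cmod (scalar (x * y)) \<le> r * s"
    using assms r by (auto simp: operator_bounded_def norm_mult intro!: mult_mono)
  fix b
  let ?c = "base y * b + scalar y *\<^sub>C b"
  have "norm (base x * ?c + scalar x *\<^sub>C ?c) \<le> r * norm ?c"
    using assms by (auto simp: operator_bounded_def)
  also have "\<dots> \<le> r * (s * norm b)" using assms r by (auto simp: operator_bounded_def intro!: mult_left_mono)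
  finally show "norm (base (x * y) * b + scalar (x * y) *\<^sub>C b) \<le> r * s * norm b"
    unfolding unitization_mult_action by (simp add: mult.assoc)
qed

text \<open>With y = x b one has y* y = b* (x* x b), so the C*-identity in the given algebra bounds
  |y|^2 by r^2 |b|^2 for every \<open>b\<close>.\<close>

lemma operator_bounded_adj_mult:
  assumes xx: "operator_bounded (uadj x * x) (r ^ 2)" and r: "0 \<le> r"
  shows "operator_bounded x r"
  unfolding operator_bounded_def
proof (intro conjI allI)
  have "cmod (cnj (scalar x) * scalar x) \<le> r ^ 2"
    using xx by (auto simp: operator_bounded_def)
  then have "cmod (scalar x) ^ 2 \<le> r ^ 2" by (simp add: norm_mult power2_eq_square)
  then show "cmod (scalar x) \<le> r" using r by (rule power2_le_imp_le)
  fix b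
  define y where "y = base x * b + scalar x *\<^sub>C b"
  have "star y = star b * star (base x) + cnj (scalar x) *\<^sub>C star b"
    by (simp add: y_def star_add star_mult star_cscale)
  then have "star y * y = star b * (star (base x) * y + cnj (scalar x) *\<^sub>C y)"
    by (simp add: distrib_left distrib_right mult.assoc mult_cscale_left mult_cscale_right)
  then have "star y * y = star b * (base (uadj x * x) * b + scalar (uadj x * x) *\<^sub>C b)"
    by (simp only: unitization_mult_action uadj_simps y_def)
  then have "norm y ^ 2 \<le> norm (star b) * norm (base (uadj x * x) * b + scalar (uadj x * x) *\<^sub>C b)"
    unfolding cstar_identity[symmetric] by (simp only: norm_mult_ineq)
  also have "\<dots> \<le> norm b * (r ^ 2 * norm b)"
    using xx by (intro mult_mono) (auto simp: operator_bounded_def norm_star)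
  also have "\<dots> = (r * norm b) ^ 2" by (simp add: power2_eq_square)
  finally have "norm y \<le> r * norm b" by (rule power2_le_imp_le) (use r in simp)
  then show "norm (base x * b + scalar x *\<^sub>C b) \<le> r * norm b" by (simp add: y_def)
qed

lemma operator_bounded_exists: "operator_bounded x (norm (base x) + cmod (scalar x))"
  unfolding operator_bounded_def
proof (intro conjI allI)
  fix b
  have "norm (base x * b + scalar x *\<^sub>C b) \<le> norm (base x * b) + norm (scalar x *\<^sub>C b)"
    by (rule norm_triangle_ineq)
  also have "\<dots> \<le> (norm (base x) + cmod (scalar x)) * norm b"
    using norm_mult_ineq[of "base x" b] by (simp add: norm_cscale distrib_right)
  finally show "norm (base x * b + scalar x *\<^sub>C b) \<le> (norm (base x) + cmod (scalar x)) * norm b" .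
qed simp

text \<open>Testing on b = (base x)* turns |base x|^2 into the norm of a product; one
  \<open>r\<close> pays for the action of \<open>x\<close> and one for its scalar part.\<close>

lemma norm_base_le:
  assumes "operator_bounded x r"
  shows "norm (base x) \<le> 2 * r"
proof (cases "base x = 0")
  case True
  then show ?thesis using operator_bounded_nonneg[OF assms] by simp
next
  case False
  define b where "b = star (base x)"
  have "norm (base x) * norm (base x) = norm (base x * b)"
    using cstar_identity[of b] by (simp add: b_def star_star norm_star power2_eq_square)
  also have "base x * b = (base x * b + scalar x *\<^sub>C b) - scalar x *\<^sub>C b" by simp
  also have "norm \<dots> \<le> norm (base x * b + scalar x *\<^sub>C b) + norm (scalar x *\<^sub>C b)"
    by (rule norm_triangle_ineq4)
  also have "\<dots> \<le> r * norm b + r * norm b"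
    using assms by (intro add_mono) (auto simp: operator_bounded_def norm_cscale intro!: mult_right_mono)
  also have "\<dots> = (2 * r) * norm (base x)" by (simp add: b_def norm_star)
  finally show ?thesis using False by (simp add: mult_le_cancel_right)
qed

lemma banach_star_subalgebraD:
  fixes A :: "'b::cstar_algebra set"
  assumes "banach_star_subalgebra A nA"
  shows "0 \<in> A" "\<And>x y. x \<in> A \<Longrightarrow> y \<in> A \<Longrightarrow> x + y \<in> A" "\<And>x y. x \<in> A \<Longrightarrow> y \<in> A \<Longrightarrow> x * y \<in> A"
    "\<And>c x. x \<in> A \<Longrightarrow> c *\<^sub>C x \<in> A" "\<And>x. x \<in> A \<Longrightarrow> star x \<in> A"
    "\<And>x y. x \<in> A \<Longrightarrow> y \<in> A \<Longrightarrow> x - y \<in> A"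
    and "\<And>x. x \<in> A \<Longrightarrow> 0 \<le> nA x" "\<And>x. x \<in> A \<Longrightarrow> nA x = 0 \<longleftrightarrow> x = 0"
    "\<And>x y. x \<in> A \<Longrightarrow> y \<in> A \<Longrightarrow> nA (x + y) \<le> nA x + nA y"
    "\<And>c x. x \<in> A \<Longrightarrow> nA (c *\<^sub>C x) = cmod c * nA x"
    "\<And>x y. x \<in> A \<Longrightarrow> y \<in> A \<Longrightarrow> nA (x * y) \<le> nA x * nA y"
    and "\<And>X. (\<And>n::nat. X n \<in> A) \<Longrightarrow> \<forall>e>0. \<exists>N. \<forall>m\<ge>N. \<forall>n\<ge>N. nA (X m - X n) < e \<Longrightarrow>
      \<exists>L\<in>A. \<forall>e>0. \<exists>N. \<forall>n\<ge>N. nA (X n - L) < e"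
proof -
  have sa: "star_subalgebra A"
    using assms unfolding banach_star_subalgebra_def by (elim conjE)
  then show "0 \<in> A" "\<And>x y. x \<in> A \<Longrightarrow> y \<in> A \<Longrightarrow> x + y \<in> A" "\<And>x y. x \<in> A \<Longrightarrow> y \<in> A \<Longrightarrow> x * y \<in> A"
    "\<And>c x. x \<in> A \<Longrightarrow> c *\<^sub>C x \<in> A" "\<And>x. x \<in> A \<Longrightarrow> star x \<in> A"
    by (auto simp: star_subalgebra_def)
  show "x - y \<in> A" if "x \<in> A" "y \<in> A" for x y
  proof -
    have "x + (- 1) *\<^sub>C y \<in> A" using sa that by (auto simp: star_subalgebra_def)
    then show ?thesis by (simp add: cscale_minus_left cscale_one)
  qed
  have "\<forall>x\<in>A. nA x \<ge> 0 \<and> (nA x = 0 \<longleftrightarrow> x = 0)"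
    using assms unfolding banach_star_subalgebra_def by (elim conjE)
  then show "\<And>x. x \<in> A \<Longrightarrow> 0 \<le> nA x" "\<And>x. x \<in> A \<Longrightarrow> nA x = 0 \<longleftrightarrow> x = 0" by auto
  have "\<forall>x\<in>A. \<forall>y\<in>A. nA (x + y) \<le> nA x + nA y"
    using assms unfolding banach_star_subalgebra_def by (elim conjE)
  then show "\<And>x y. x \<in> A \<Longrightarrow> y \<in> A \<Longrightarrow> nA (x + y) \<le> nA x + nA y" by auto
  have "\<forall>c. \<forall>x\<in>A. nA (c *\<^sub>C x) = cmod c * nA x"
    using assms unfolding banach_star_subalgebra_def by (elim conjE)
  then show "\<And>c x. x \<in> A \<Longrightarrow> nA (c *\<^sub>C x) = cmod c * nA x" by auto
  have "\<forall>x\<in>A. \<forall>y\<in>A. nA (x * y) \<le> nA x * nA y"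
    using assms unfolding banach_star_subalgebra_def by (elim conjE)
  then show "\<And>x y. x \<in> A \<Longrightarrow> y \<in> A \<Longrightarrow> nA (x * y) \<le> nA x * nA y" by auto
  have "\<forall>X::nat \<Rightarrow> 'b. (\<forall>n. X n \<in> A) \<longrightarrow>
      (\<forall>e>0. \<exists>N. \<forall>m\<ge>N. \<forall>n\<ge>N. nA (X m - X n) < e) \<longrightarrow>
      (\<exists>L\<in>A. \<forall>e>0. \<exists>N. \<forall>n\<ge>N. nA (X n - L) < e)"
    using assms unfolding banach_star_subalgebra_def by (elim conjE)
  then show "\<And>X. (\<And>n::nat. X n \<in> A) \<Longrightarrow> \<forall>e>0. \<exists>N. \<forall>m\<ge>N. \<forall>n\<ge>N. nA (X m - X n) < e \<Longrightarrow>
      \<exists>L\<in>A. \<forall>e>0. \<exists>N. \<forall>n\<ge>N. nA (X n - L) < e" by blast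
qed

text \<open>If \<open>x\<close> is bounded by 1, so are its powers. The scalar part of x^n is the
  n-th power of that of \<open>x\<close>, and removing it leaves an element of \<open>A\<close> of
  C*-norm at most 2. In the differential inequality the factor with exponent \<open>q\<close> is
  then at most 2^q, and only the power \<open>p\<close> of the Banach norm remains.\<close>

lemma differential_star_ring_unitization:
  fixes A :: "'b::cstar_algebra set"
  assumes "differential_subalgebra k p q A nA"
  shows "\<exists>C. differential_star_ring {x. base x \<in> A} (\<lambda>x. nA (base x) + cmod (scalar x)) (Adjoin 0)
    uadj operator_bounded k p C"
proof -
  from assms obtain C where k: "k \<ge> 2" and pq: "p > 0" "q > 0" "p + q = real k"
    and B: "banach_star_subalgebra A nA"
    and C: "C > 0" "\<And>a. a \<in> A \<Longrightarrow> nA (ppow a k) \<le> C * nA a powr p * norm a powr q"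
    unfolding differential_subalgebra_def by blast
  note A = banach_star_subalgebraD(1-5)[OF B] and diffA = banach_star_subalgebraD(6)[OF B]
    and n = banach_star_subalgebraD(7-11)[OF B] and comp = banach_star_subalgebraD(12)[OF B]
  have n0 [simp]: "nA 0 = 0" using n(2)[OF A(1)] by simp
  let ?R = "{x. base x \<in> A}" and ?\<nu> = "\<lambda>x. nA (base x) + cmod (scalar x)"
  have "differential_star_ring ?R ?\<nu> (Adjoin 0) uadj operator_bounded k p (C * 2 powr q)"
  proof (unfold_locales, goal_cases)
    case 1 show ?case by (simp add: one_unitization_def)
  next
    case 2 show ?case by (simp add: unitization.expand)
  next
    case 3 show ?case by (simp add: unitization.expand)
  next
    case 4 show ?case by (simp add: unitization.expand)
  next
    case 5 show ?case using A by simp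
  next
    case 6 then show ?case using A by simp
  next
    case 7 then show ?case using A by simp
  next
    case 8 then show ?case using n by simp
  next
    case (9 x)
    then have "nA (base x) = 0" "scalar x = 0" using n(1)[of "base x"] by (auto simp: add_nonneg_eq_0_iff)
    then show ?case using n(2) 9 by (auto simp: unitization.expand)
  next
    case (10 x y)
    then show ?case using n(3)[of "base x" "base y"] norm_triangle_ineq[of "scalar x" "scalar y"] by simp
  next
    case (11 x y)
    let ?a = "base x" and ?b = "base y" and ?s = "scalar x" and ?t = "scalar y"
    have m: "?a \<in> A" "?b \<in> A" using 11 by auto
    have "nA (?a * ?b + ?s *\<^sub>C ?b + ?t *\<^sub>C ?a) \<le> nA (?a * ?b) + nA (?s *\<^sub>C ?b) + nA (?t *\<^sub>C ?a)"
      using n(3)[of "?a * ?b + ?s *\<^sub>C ?b" "?t *\<^sub>C ?a"] n(3)[of "?a * ?b" "?s *\<^sub>C ?b"] m A by force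
    also have "\<dots> \<le> nA ?a * nA ?b + cmod ?s * nA ?b + cmod ?t * nA ?a" using n m by simp
    finally show ?case by (simp add: norm_mult algebra_simps)
  next
    case 12 show ?case by simp
  next
    case (13 X)
    have bm: "base (X m) \<in> A" for m using 13(1) by simp
    have le: "nA (base (X m) - base (X l)) \<le> ?\<nu> (X m - X l)"
      "cmod (scalar (X m) - scalar (X l)) \<le> ?\<nu> (X m - X l)" for m l
      using n(1)[OF diffA[OF bm bm]] by auto
    have "\<exists>L\<in>A. \<forall>e>0. \<exists>N. \<forall>n\<ge>N. nA (base (X n) - L) < e"
      by (rule comp[OF bm]) (use 13(2) le(1) in \<open>meson le_less_trans\<close>)
    then obtain L where L: "L \<in> A" "\<And>e. e > 0 \<Longrightarrow> \<exists>N. \<forall>n\<ge>N. nA (base (X n) - L) < e" by blast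
    have "Cauchy (\<lambda>n. scalar (X n))"
      unfolding Cauchy_def dist_norm using 13(2) le(2) by (meson le_less_trans)
    then obtain l where l: "(\<lambda>n. scalar (X n)) \<longlonglongrightarrow> l" using Cauchy_convergent convergent_def by blast
    show ?case
    proof (intro bexI[of _ "Adjoin L l"] allI impI)
      fix e :: real assume e: "e > 0"
      obtain N1 where N1: "\<forall>n\<ge>N1. nA (base (X n) - L) < e / 2" using L(2)[of "e / 2"] e by auto
      obtain N2 where N2: "\<forall>n\<ge>N2. cmod (scalar (X n) - l) < e / 2"
        using LIMSEQ_D[OF l, of "e / 2"] e by auto
      have "?\<nu> (X n - Adjoin L l) < e" if "n \<ge> max N1 N2" for n
      proof -
        have "nA (base (X n) - L) < e / 2" "cmod (scalar (X n) - l) < e / 2" using N1 N2 that by auto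
        then show ?thesis by simp
      qed
      then show "\<exists>N. \<forall>n\<ge>N. ?\<nu> (X n - Adjoin L l) < e" by blast
    qed (use L in simp)
  next
    case 14 show ?case by (simp add: unitization.expand star_star)
  next
    case 15 show ?case by (simp add: unitization.expand star_add)
  next
    case 16 show ?case
      by (simp add: unitization.expand star_add star_mult star_cscale algebra_simps)
  next
    case 17 show ?case by (simp add: unitization.expand)
  next
    case 18 then show ?case using A by simp
  next
    case 19 then show ?case by (rule operator_bounded_nonneg)
  next
    case 20 then show ?case by (rule operator_bounded_mono)
  next
    case 21 show ?case by (rule operator_bounded_scalar)
  next
    case 22 then show ?case by (rule operator_bounded_add)
  next
    case 23 then show ?case by (rule operator_bounded_mult)
  next
    case 24 then show ?case by (rule operator_bounded_adj_mult)
  next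
    case 25 show ?case using operator_bounded_exists by blast
  next
    case 26 show ?case by (rule k)
  next
    case 27 show ?case by (rule pq)
  next
    case 28 show ?case using pq by simp
  next
    case 29 show ?case using C by simp
  next
    case (30 x)
    have pw: "operator_bounded (x ^ m) 1" for m
    proof (induction m)
      case 0
      show ?case using operator_bounded_scalar[of 1] by (simp add: one_unitization_def)
    next
      case (Suc m)
      then show ?case using operator_bounded_mult[OF 30(2) Suc] by simp
    qed
    have mem: "base (x ^ m) \<in> A" for m
    proof (induction m)
      case (Suc m)
      then show ?case using A 30(1) by simp
    qed (use A in simp)
    show ?case
    proof (intro exI[of _ "scalar x"] conjI allI)
      show "cmod (scalar x) \<le> 1" using 30 by (simp add: operator_bounded_def)
      fix m
      have z: "x ^ m - Adjoin 0 (scalar x ^ m) = Adjoin (base (x ^ m)) 0"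
        by (simp add: unitization.expand scalar_power)
      obtain k' where k': "k = Suc k'" using k by (cases k) auto
      have "?\<nu> (Adjoin (base (x ^ m)) 0 ^ k) = nA (ppow (base (x ^ m)) k)"
        by (simp only: k' Adjoin_power) simp
      also have "\<dots> \<le> C * nA (base (x ^ m)) powr p * norm (base (x ^ m)) powr q"
        by (rule C(2)[OF mem])
      also have "\<dots> \<le> C * nA (base (x ^ m)) powr p * 2 powr q"
        using C(1) pq norm_base_le[OF pw[of m]] by (intro mult_left_mono powr_mono2) auto
      also have "\<dots> = C * 2 powr q * ?\<nu> (Adjoin (base (x ^ m)) 0) powr p" by simp
      finally show "?\<nu> ((x ^ m - Adjoin 0 (scalar x ^ m)) ^ k)
        \<le> C * 2 powr q * ?\<nu> (x ^ m - Adjoin 0 (scalar x ^ m)) powr p"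
        unfolding z .
    qed
  qed
  then show ?thesis by blast
qed

section \<open>The extended homomorphism\<close>

definition to_unitization :: "'b::cstar_algebra \<times> complex \<Rightarrow> 'b unitization" where
  "to_unitization x = Adjoin (fst x) (snd x)"

text \<open>If \<open>A\<close> has a unit, this is the extension of \<open>\<phi>\<close> to \<open>A \<oplus> \<complex>\<close>, whose unit is a new one; its range
  is still that of \<open>\<phi>\<close>.\<close>
definition extend_hom ::
  "'b::cstar_algebra set \<Rightarrow> ('b \<times> complex \<Rightarrow> 'e::complex_banach_algebra_1) \<Rightarrow> 'b unitization \<Rightarrow> 'e" where
  "extend_hom A \<phi> x =
    (if has_unit A then \<phi> (base x, 0) + scalar x *\<^sub>C 1 else \<phi> (base x, scalar x))"

locale star_subalgebra_hom =
  fixes A :: "'b::cstar_algebra set" and nA :: "'b \<Rightarrow> real"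
    and \<phi> :: "'b \<times> complex \<Rightarrow> 'e::complex_banach_algebra_1"
  assumes banach: "banach_star_subalgebra A nA" and hom: "cont_unital_hom A nA \<phi>"
begin

lemmas subalgebra = banach_star_subalgebraD(1-6)[OF banach]
  and norm_A = banach_star_subalgebraD(7,8,10)[OF banach]

lemma unit_of_A: "has_unit A \<Longrightarrow> unit_of A \<in> A"
  "has_unit A \<Longrightarrow> x \<in> A \<Longrightarrow> unit_of A * x = x \<and> x * unit_of A = x"
proof -
  assume "has_unit A"
  then have "\<exists>e. e \<in> A \<and> (\<forall>x\<in>A. e * x = x \<and> x * e = x)" by (auto simp: has_unit_def)
  from someI_ex[OF this]
  show "unit_of A \<in> A" "x \<in> A \<Longrightarrow> unit_of A * x = x \<and> x * unit_of A = x" by (auto simp: unit_of_def)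
qed

lemma unitz_closed:
  "x \<in> unitz A \<Longrightarrow> y \<in> unitz A \<Longrightarrow> uadd x y \<in> unitz A"
  "x \<in> unitz A \<Longrightarrow> y \<in> unitz A \<Longrightarrow> usub x y \<in> unitz A"
  "x \<in> unitz A \<Longrightarrow> y \<in> unitz A \<Longrightarrow> umult x y \<in> unitz A"
  "x \<in> unitz A \<Longrightarrow> uscale c x \<in> unitz A"
  "x \<in> unitz A \<Longrightarrow> ustar x \<in> unitz A" "uone A \<in> unitz A"
  using subalgebra unit_of_A(1)
  by (auto simp: unitz_def uadd_def usub_def umult_def uscale_def ustar_def uone_def split: if_splits)

lemma \<phi>_uadd: "x \<in> unitz A \<Longrightarrow> y \<in> unitz A \<Longrightarrow> \<phi> (uadd x y) = \<phi> x + \<phi> y"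
  and \<phi>_umult: "x \<in> unitz A \<Longrightarrow> y \<in> unitz A \<Longrightarrow> \<phi> (umult x y) = \<phi> x * \<phi> y"
  and \<phi>_uscale: "x \<in> unitz A \<Longrightarrow> \<phi> (uscale c x) = c *\<^sub>C \<phi> x"
  and \<phi>_uone: "\<phi> (uone A) = 1"
  using hom by (auto simp: cont_unital_hom_def)

lemma \<phi>_usub:
  assumes "x \<in> unitz A" "y \<in> unitz A" shows "\<phi> (usub x y) = \<phi> x - \<phi> y"
proof -
  have "usub x y = uadd x (uscale (- 1) y)"
    by (simp add: usub_def uadd_def uscale_def cscale_minus_left cscale_one)
  then show ?thesis
    using assms by (simp add: \<phi>_uadd \<phi>_uscale unitz_closed cscale_minus_left cscale_one)
qed

text \<open>Continuity at 0 and homogeneity. The constant is taken at least 1 so that it also covers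
  the scalar summand of \<open>extend_hom\<close>.\<close>

lemma \<phi>_bounded: "\<exists>K\<ge>1. \<forall>x\<in>unitz A. norm (\<phi> x) \<le> K * unorm nA x"
proof -
  have z: "(0, 0) \<in> unitz A" using subalgebra(1) by (auto simp: unitz_def)
  have z0: "\<phi> (0, 0) = 0" using \<phi>_usub[OF z z] by (simp add: usub_def)
  have "\<forall>x\<in>unitz A. \<forall>e>0. \<exists>d>0. \<forall>y\<in>unitz A. unorm nA (usub y x) < d \<longrightarrow> norm (\<phi> y - \<phi> x) < e"
    using hom unfolding cont_unital_hom_def by (elim conjE)
  from this[rule_format, OF z, of 1]
  obtain d where d: "d > 0" "\<And>y. y \<in> unitz A \<Longrightarrow> unorm nA y < d \<Longrightarrow> norm (\<phi> y) < 1"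
    by (auto simp: usub_def z0)
  have "norm (\<phi> x) \<le> max 1 (2 / d) * unorm nA x" if x: "x \<in> unitz A" for x
  proof -
    have f: "fst x \<in> A" using x by (auto simp: unitz_def split: if_splits)
    define N where "N = unorm nA x"
    have N: "0 \<le> N" using norm_A(1)[OF f] by (simp add: N_def unorm_def)
    show ?thesis
    proof (cases "N = 0")
      case True
      then have "nA (fst x) = 0" "snd x = 0"
        using norm_A(1)[OF f] by (auto simp: N_def unorm_def add_nonneg_eq_0_iff)
      then have "x = (0, 0)" using norm_A(2)[OF f] by (simp add: prod_eq_iff)
      then show ?thesis using z0 N by (simp add: N_def)
    next
      case False
      then have N: "0 < N" using N by simp
      define c where "c = complex_of_real (d / (2 * N))"
      have c: "cmod c = d / (2 * N)" using d N by (simp add: c_def norm_divide norm_mult)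
      have "unorm nA (uscale c x) = cmod c * N"
        using norm_A(3)[OF f] by (simp add: unorm_def uscale_def N_def norm_mult distrib_left)
      then have "norm (\<phi> (uscale c x)) < 1" using d N x c by (intro d(2) unitz_closed) auto
      then have "d / (2 * N) * norm (\<phi> x) < 1" by (simp add: \<phi>_uscale x norm_cscale c)
      then have "norm (\<phi> x) \<le> 2 / d * N" using d N by (simp add: field_simps)
      also have "\<dots> \<le> max 1 (2 / d) * N" using N by (intro mult_right_mono) auto
      finally show ?thesis by (simp add: N_def)
    qed
  qed
  then show ?thesis by (intro exI[of _ "max 1 (2 / d)"]) auto
qed

lemma extend_hom_to_unitization:
  "x \<in> unitz A \<Longrightarrow> extend_hom A \<phi> (to_unitization x) = \<phi> x"
  by (auto simp: extend_hom_def to_unitization_def unitz_def split: if_splits)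

lemma extend_hom_in_range:
  assumes "base x \<in> A"
  shows "\<exists>y\<in>unitz A. \<phi> y = extend_hom A \<phi> x"
proof (cases "has_unit A")
  case True
  let ?a = "(base x, 0)" and ?u = "uscale (scalar x) (uone A)"
  have a: "?a \<in> unitz A" using True assms by (simp add: unitz_def)
  have "\<phi> (uadd ?a ?u) = \<phi> ?a + scalar x *\<^sub>C 1"
    using a by (simp add: \<phi>_uadd \<phi>_uscale \<phi>_uone unitz_closed)
  then show ?thesis using True a unitz_closed by (intro bexI[of _ "uadd ?a ?u"]) (auto simp: extend_hom_def)
next
  case False
  then show ?thesis using assms by (intro bexI[of _ "(base x, scalar x)"]) (auto simp: extend_hom_def unitz_def)
qed

lemma extend_hom_scalar: "extend_hom A \<phi> (Adjoin 0 c) = c *\<^sub>C 1"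
proof (cases "has_unit A")
  case True
  have "(0, 0) \<in> unitz A" using subalgebra(1) by (auto simp: unitz_def)
  from \<phi>_usub[OF this this] show ?thesis using True by (simp add: extend_hom_def usub_def)
next
  case False
  then have "(0, c) = uscale c (uone A)" by (simp add: uscale_def uone_def)
  then show ?thesis using False by (simp add: extend_hom_def \<phi>_uscale \<phi>_uone unitz_closed)
qed

lemma extend_hom_add:
  assumes "base x \<in> A" "base y \<in> A"
  shows "extend_hom A \<phi> (x + y) = extend_hom A \<phi> x + extend_hom A \<phi> y"
proof (cases "has_unit A")
  case True
  then have "(base x, 0) \<in> unitz A" "(base y, 0) \<in> unitz A" using assms by (auto simp: unitz_def)
  from \<phi>_uadd[OF this] show ?thesis
    using True by (simp add: extend_hom_def uadd_def cscale_add_left)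
next
  case False
  then have "(base x, scalar x) \<in> unitz A" "(base y, scalar y) \<in> unitz A"
    using assms by (auto simp: unitz_def)
  from \<phi>_uadd[OF this] show ?thesis using False by (simp add: extend_hom_def uadd_def)
qed

lemma extend_hom_mult:
  assumes "base x \<in> A" "base y \<in> A"
  shows "extend_hom A \<phi> (x * y) = extend_hom A \<phi> x * extend_hom A \<phi> y"
proof (cases "has_unit A")
  case True
  let ?a = "(base x, 0::complex)" and ?b = "(base y, 0::complex)"
  have ab: "?a \<in> unitz A" "?b \<in> unitz A" using assms True by (auto simp: unitz_def)
  have "(base (x * y), 0) = uadd (umult ?a ?b) (uadd (uscale (scalar x) ?b) (uscale (scalar y) ?a))"
    by (simp add: uadd_def umult_def uscale_def add.assoc)
  then have "\<phi> (base (x * y), 0) = \<phi> ?a * \<phi> ?b + (scalar x *\<^sub>C \<phi> ?b + scalar y *\<^sub>C \<phi> ?a)"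
    using ab by (simp only: \<phi>_uadd \<phi>_umult \<phi>_uscale unitz_closed)
  then show ?thesis
    using True by (simp add: extend_hom_def distrib_left distrib_right mult_cscale_left mult_cscale_right
        cscale_cscale add.assoc cscale_add_right del: base_simps) (simp add: mult.commute add_ac)
next
  case False
  then have "(base x, scalar x) \<in> unitz A" "(base y, scalar y) \<in> unitz A"
    using assms by (auto simp: unitz_def)
  from \<phi>_umult[OF this] show ?thesis using False by (simp add: extend_hom_def umult_def)
qed

lemma extend_hom_bound:
  "\<exists>K\<ge>0. \<forall>x. base x \<in> A \<longrightarrow> norm (extend_hom A \<phi> x) \<le> K * (nA (base x) + cmod (scalar x))"
proof -
  obtain K where K: "K \<ge> 1" "\<And>x. x \<in> unitz A \<Longrightarrow> norm (\<phi> x) \<le> K * unorm nA x"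
    using \<phi>_bounded by auto
  have "norm (extend_hom A \<phi> x) \<le> K * (nA (base x) + cmod (scalar x))" if x: "base x \<in> A" for x
  proof (cases "has_unit A")
    case True
    have "norm (\<phi> (base x, 0) + scalar x *\<^sub>C 1) \<le> norm (\<phi> (base x, 0)) + norm (scalar x *\<^sub>C (1::'e))"
      by (rule norm_triangle_ineq)
    also have "\<dots> \<le> K * nA (base x) + cmod (scalar x)"
      using K(2)[of "(base x, 0)"] True x by (simp add: unitz_def unorm_def norm_cscale)
    also have "\<dots> \<le> K * (nA (base x) + cmod (scalar x))"
      using K(1) mult_right_mono[of 1 K "cmod (scalar x)"] by (simp add: distrib_left)
    finally show ?thesis using True by (simp add: extend_hom_def)
  next
    case False
    then show ?thesis using K(2)[of "(base x, scalar x)"] x by (simp add: unitz_def unorm_def extend_hom_def)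
  qed
  with K(1) show ?thesis by (intro exI[of _ K]) auto
qed

text \<open>An inverse modulo the kernel is the same as an inverse inside the range of \<phi>. The
  range does not change under \<open>extend_hom\<close>, so the witness may be taken in the enlarged
  unitization, where the preceding theory applies.\<close>

lemma spec_quot_iff:
  assumes a: "a \<in> unitz A" and I: "I = {x \<in> unitz A. \<phi> x = 0}"
  shows "c \<notin> spec_quot A I a \<longleftrightarrow>
    (\<exists>b. base b \<in> A \<and> (\<phi> a - c *\<^sub>C 1) * extend_hom A \<phi> b = 1 \<and> extend_hom A \<phi> b * (\<phi> a - c *\<^sub>C 1) = 1)"
proof -
  let ?y = "usub a (uscale c (uone A))"
  have y: "?y \<in> unitz A" "\<phi> ?y = \<phi> a - c *\<^sub>C 1"
    using a by (auto simp: unitz_closed \<phi>_usub \<phi>_uscale \<phi>_uone)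
  have "c \<notin> spec_quot A I a \<longleftrightarrow>
      (\<exists>b\<in>unitz A. (\<phi> a - c *\<^sub>C 1) * \<phi> b = 1 \<and> \<phi> b * (\<phi> a - c *\<^sub>C 1) = 1)"
    unfolding spec_quot_def I
    by (auto simp: unitz_closed y(1) \<phi>_usub \<phi>_umult \<phi>_uone y(2))
  also have "\<dots> \<longleftrightarrow> (\<exists>b. base b \<in> A \<and> (\<phi> a - c *\<^sub>C 1) * extend_hom A \<phi> b = 1 \<and>
      extend_hom A \<phi> b * (\<phi> a - c *\<^sub>C 1) = 1)"
  proof
    assume "\<exists>b\<in>unitz A. (\<phi> a - c *\<^sub>C 1) * \<phi> b = 1 \<and> \<phi> b * (\<phi> a - c *\<^sub>C 1) = 1"
    then obtain b where b: "b \<in> unitz A" "(\<phi> a - c *\<^sub>C 1) * \<phi> b = 1" "\<phi> b * (\<phi> a - c *\<^sub>C 1) = 1" by blast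
    moreover have "base (to_unitization b) \<in> A"
      using b(1) by (auto simp: to_unitization_def unitz_def split: if_splits)
    ultimately show "\<exists>b. base b \<in> A \<and> (\<phi> a - c *\<^sub>C 1) * extend_hom A \<phi> b = 1 \<and>
        extend_hom A \<phi> b * (\<phi> a - c *\<^sub>C 1) = 1"
      by (intro exI[of _ "to_unitization b"]) (simp add: extend_hom_to_unitization)
  next
    assume "\<exists>b. base b \<in> A \<and> (\<phi> a - c *\<^sub>C 1) * extend_hom A \<phi> b = 1 \<and>
        extend_hom A \<phi> b * (\<phi> a - c *\<^sub>C 1) = 1"
    then obtain b where b: "base b \<in> A" "(\<phi> a - c *\<^sub>C 1) * extend_hom A \<phi> b = 1"
        "extend_hom A \<phi> b * (\<phi> a - c *\<^sub>C 1) = 1" by blast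
    obtain b' where "b' \<in> unitz A" "\<phi> b' = extend_hom A \<phi> b" using extend_hom_in_range[OF b(1)] by blast
    with b show "\<exists>b\<in>unitz A. (\<phi> a - c *\<^sub>C 1) * \<phi> b = 1 \<and> \<phi> b * (\<phi> a - c *\<^sub>C 1) = 1"
      by (intro bexI[of _ b']) auto
  qed
  finally show ?thesis .
qed

end

theorem theorem3p16:
  fixes A :: "'b::cstar_algebra set" and nA :: "'b \<Rightarrow> real"
    and k :: nat and p q :: real
    and \<phi> :: "'b \<times> complex \<Rightarrow> 'e::complex_banach_algebra_1"
  assumes "differential_subalgebra k p q A nA"
    and "cont_unital_hom A nA \<phi>"
    and "I = {x \<in> unitz A. \<phi> x = 0}"
  shows "(\<forall>a\<in>unitz A. umult (ustar a) a = umult a (ustar a) \<longrightarrow>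
           spec_quot A I a = spec (\<phi> a)) \<and>
         (\<forall>a\<in>unitz A. spec_quot A I a = spec (\<phi> a) \<union> cnj ` spec (\<phi> (ustar a)))"
proof -
  interpret star_subalgebra_hom A nA \<phi>
    using assms(1,2) by unfold_locales (auto simp: differential_subalgebra_def)
  let ?\<phi> = "extend_hom A \<phi>" and ?R = "{x::'b unitization. base x \<in> A}"
  obtain C where C: "differential_star_ring ?R (\<lambda>x. nA (base x) + cmod (scalar x)) (Adjoin 0)
      uadj operator_bounded k p C"
    using differential_star_ring_unitization[OF assms(1)] by blast
  obtain L where L: "0 \<le> L"
    "\<And>x. base x \<in> A \<Longrightarrow> norm (?\<phi> x) \<le> L * (nA (base x) + cmod (scalar x))"
    using extend_hom_bound by blast
  interpret D: differential_star_ring_hom ?R "\<lambda>x. nA (base x) + cmod (scalar x)" "Adjoin 0"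
    uadj operator_bounded k p C ?\<phi> L
    by (intro differential_star_ring_hom.intro C differential_star_ring_hom_axioms.intro)
      (auto simp: extend_hom_add extend_hom_mult extend_hom_scalar L)
  \<comment> \<open>Represents a - c 1 with the newly adjoined unit. For unital \<open>A\<close>
    this differs from subtracting c times the unit of \<open>A\<close>, yet the extended
    homomorphism sends both to the same element.\<close>
  define Y where "Y a c = to_unitization a - Adjoin 0 c" for a :: "'b \<times> complex" and c
  have Ymem: "base (Y a c) \<in> A" if "a \<in> unitz A" for a c
    using that by (auto simp: Y_def to_unitization_def unitz_def split: if_splits)
  have Y: "?\<phi> (Y a c) = \<phi> a - c *\<^sub>C 1" if "a \<in> unitz A" for a c
  proof -
    have "base (to_unitization a) \<in> A"
      using that by (auto simp: to_unitization_def unitz_def split: if_splits)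
    then show ?thesis
      unfolding Y_def using that subalgebra(1)
      by (simp add: D.\<phi>_diff extend_hom_to_unitization extend_hom_scalar)
  qed
  have Yadj: "uadj (Y a c) = Y (ustar a) (cnj c)" for a c
    unfolding Y_def by (simp add: D.adj_diff D.adj_sc) (simp add: uadj_def to_unitization_def ustar_def)
  have spec: "c \<notin> spec (\<phi> a) \<longleftrightarrow> (\<exists>g. ?\<phi> (Y a c) * g = 1 \<and> g * ?\<phi> (Y a c) = 1)"
    if "a \<in> unitz A" for a c
    using that by (simp add: spec_def Y)
  have quot: "c \<notin> spec_quot A I a \<longleftrightarrow>
      (\<exists>b. base b \<in> A \<and> ?\<phi> (Y a c) * ?\<phi> b = 1 \<and> ?\<phi> b * ?\<phi> (Y a c) = 1)"
    if "a \<in> unitz A" for a c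
    using spec_quot_iff[OF that assms(3)] by (simp add: Y that)
  have sub: "c \<notin> spec_quot A I a \<Longrightarrow> c \<notin> spec (\<phi> a)" if "a \<in> unitz A" for a c
    using that by (auto simp: spec quot)
  have inv_unique: "g = h" if "g * x = 1" "x * h = 1" for g h x :: 'e
    using that by (metis mult.assoc mult_1_left mult_1_right)
  have 1: "spec_quot A I a = spec (\<phi> a)" if a: "a \<in> unitz A" "umult (ustar a) a = umult a (ustar a)" for a
  proof -
    have "c \<notin> spec_quot A I a" if c: "c \<notin> spec (\<phi> a)" for c
    proof -
      obtain g where g: "?\<phi> (Y a c) * g = 1" "g * ?\<phi> (Y a c) = 1" using c spec[OF a(1)] by blast
      have "to_unitization (ustar a) * to_unitization a = to_unitization a * to_unitization (ustar a)"
        using a(2) by (simp add: to_unitization_def umult_def unitization.expand add_ac)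
      then have "uadj (Y a c) * Y a c = Y a c * uadj (Y a c)"
        unfolding Yadj unfolding Y_def
        using D.sc_commute[of c "to_unitization (ustar a)"] D.sc_commute[of "cnj c" "to_unitization a"]
          D.sc_commute[of c "Adjoin 0 (cnj c)"]
        by (simp add: left_diff_distrib right_diff_distrib)
      then obtain h where h: "base h \<in> A" "?\<phi> (Y a c) * ?\<phi> h = 1"
        using D.normal_inverse_in_range[of "Y a c" g] Ymem[OF a(1)] g by auto
      have "g = ?\<phi> h" by (rule inv_unique[OF g(2) h(2)])
      then show ?thesis using g h quot[OF a(1)] by auto
    qed
    then show ?thesis using sub[OF a(1)] by blast
  qed
  have 2: "c \<notin> spec_quot A I a \<longleftrightarrow> c \<notin> spec (\<phi> a) \<and> cnj c \<notin> spec (\<phi> (ustar a))"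
    if a: "a \<in> unitz A" for a c
  proof
    assume c: "c \<notin> spec_quot A I a"
    then obtain b where b: "base b \<in> A" "?\<phi> (Y a c) * ?\<phi> b = 1" "?\<phi> b * ?\<phi> (Y a c) = 1"
      using quot[OF a] by blast
    have "cnj c \<notin> spec (\<phi> (ustar a))"
      using D.adj_invertible[of "Y a c" b] b Ymem[OF a] spec[OF unitz_closed(5)[OF a]]
      by (simp add: Yadj)
    with sub[OF a c] show "c \<notin> spec (\<phi> a) \<and> cnj c \<notin> spec (\<phi> (ustar a))" by blast
  next
    assume c: "c \<notin> spec (\<phi> a) \<and> cnj c \<notin> spec (\<phi> (ustar a))"
    let ?y = "Y a c"
    have ym: "base ?y \<in> A" "base (uadj ?y) \<in> A" using Ymem[OF a] subalgebra(5) by auto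
    obtain g where g: "?\<phi> ?y * g = 1" "g * ?\<phi> ?y = 1" using c spec[OF a] by blast
    obtain f where f: "?\<phi> (uadj ?y) * f = 1" "f * ?\<phi> (uadj ?y) = 1"
      using c spec[OF unitz_closed(5)[OF a]] by (auto simp: Yadj)
    have xm: "base (uadj ?y * ?y) \<in> A" using ym subalgebra by simp
    have \<phi>x: "?\<phi> (uadj ?y * ?y) = ?\<phi> (uadj ?y) * ?\<phi> ?y" using ym by (simp add: D.\<phi>_mult)
    \<comment> \<open>A left inverse of the image of the selfadjoint element y* y is enough to place
      that inverse in the range. Multiplying it by the image of y* recovers \<open>g\<close>, which
      is therefore in the range too.\<close>
    have "(g * f) * ?\<phi> (uadj ?y * ?y) = g * (f * ?\<phi> (uadj ?y)) * ?\<phi> ?y"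
      by (simp only: \<phi>x mult.assoc)
    then have gf: "(g * f) * ?\<phi> (uadj ?y * ?y) = 1" by (simp add: f g)
    have "uadj (uadj ?y * ?y) = uadj ?y * ?y" by (simp add: D.adj_mult)
    then obtain h where h: "base h \<in> A" "?\<phi> (uadj ?y * ?y) * ?\<phi> h = 1"
      using D.normal_inverse_in_range[of "uadj ?y * ?y" "g * f"] xm gf by auto
    have "g * f = ?\<phi> h" by (rule inv_unique[OF gf h(2)])
    then have "?\<phi> (h * uadj ?y) = g * f * ?\<phi> (uadj ?y)" using h ym by (simp add: D.\<phi>_mult)
    also have "\<dots> = g" by (simp add: mult.assoc f)
    finally have "?\<phi> (h * uadj ?y) = g" .
    moreover have "base (h * uadj ?y) \<in> A" using h ym subalgebra by simp
    ultimately show "c \<notin> spec_quot A I a" using g quot[OF a] by blast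
  qed
  have "spec_quot A I a = spec (\<phi> a) \<union> cnj ` spec (\<phi> (ustar a))" if a: "a \<in> unitz A" for a
  proof -
    have cnj_image: "c \<in> cnj ` X \<longleftrightarrow> cnj c \<in> X" for c X
      by (metis complex_cnj_cnj image_iff)
    show ?thesis
    proof (rule set_eqI)
      fix c
      show "c \<in> spec_quot A I a \<longleftrightarrow> c \<in> spec (\<phi> a) \<union> cnj ` spec (\<phi> (ustar a))"
        using 2[OF a, of c] unfolding Un_iff cnj_image by blast
    qed
  qed
  with 1 show ?thesis by blast
qed

end
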